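(* Assume the setting in the context. For each $n$ let $h_n:\Omega_n\to\mathbb{R}$ and let $u_n:\Omega_n\to\mathbb{R}$ be a solution of the graph Poisson equation $$-\Delta_{G_n}u_n(x_i)=h_n(x_i),\qquad x_i\in\Omega_n.$$ Write $\tilde u_n=u_n\circ T_n$ and $\tilde h_n=h_n\circ T_n$. Then there exists a nonincreasing and smooth kernel $\zeta:[0,\infty)\to[0,\infty)$ with compact support such that, with $\zeta_{\varepsilon_n}(s)=\varepsilon_n^{-d}\zeta(s/\varepsilon_n)$: (i) for $1<q<2$, $$\int_\Omega|\tilde u_n|^qdx+\int_\Omega\int_\Omega\zeta_{\varepsilon_n}(|x-y|)\left|\frac{\tilde u_n(y)-\tilde u_n(x)}{\varepsilon_n}\right|^qdy\,dx\le C\left(\int_\Omega|\tilde u_n|dx\right)^q+C\int_\Omega|\tilde h_n|^qdx+C;$$ (ii) for $2\le q<\infty$, $$\int_\Omega|\tilde u_n|^qdx+\int_\Omega\int_\Omega\zeta_{\varepsilon_n}(|x-y|)\left|\frac{(|\tilde u_n|^{(q-2)/2}\tilde u_n)(y)-(|\tilde u_n|^{(q-2)/2}\tilde u_n)(x)}{\varepsilon_n}\right|^2dy\,dx\le C\left(\int_\Omega|\tilde u_n|^{q/2}dx\right)^2+C\int_\Omega|\tilde h_n|^qdx;$$ (iii) for $q=\infty$, $$\|\tilde u_n\|_{L^\infty(\Omega)}\le C\|\tilde u_n\|_{L^1(\Omega)}+C\|\tilde h_n\|_{L^\infty(\Omega)}.$$ Here the constant $C$ in (i)–(iii) does not depend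 on $n$ and $\varepsilon_n$, nor on $u_n$ and $h_n$.
   Context: Standing assumptions: $\Omega\subset\mathbb{R}^d$ ($d\ge3$) is a connected bounded open domain with sufficiently smooth boundary. $\eta:[0,\infty)\to[0,\infty)$ is nonincreasing, piecewise Lipschitz (finitely many pieces), compactly supported, with $\eta(1)\ge1$ and $\eta(2)=0$; $\eta_\varepsilon(s)=\varepsilon^{-d}\eta(s/\varepsilon)$. $\varepsilon_n>0$, $\varepsilon_n\to0$ and $\varepsilon_n/\sqrt{\delta_n}\to\infty$ as $n\to\infty$, where $\delta_n=\frac{(\ln n)^{1/d}}{n^{1/d}}$. The points $x_1,x_2,\dots$ are independent random samples of a probability measure $\mu$ on $\Omega$ with density $\rho\in C^1(\overline\Omega)$, $0<\inf_\Omega\rho\le\sup_\Omega\rho<\infty$; $\Omega_n=\{x_1,\dots,x_n\}$ and $\mu_n=\frac1n\sum_{i=1}^n\delta_{x_i}$. Graph Laplacian: for $u:\Omega_n\to\mathbb{R}$, $\Delta_{G_n}u(x_i)=\frac{1}{n\varepsilon_n^2}\sum_{j=1}^n\eta_{\varepsilon_n}(|x_i-x_j|)(u(x_j)-u(x_i))$. Transportation maps: almost surely there are maps $T_n$ with $T_{n\sharp}\mu=\mu_n$ (push-forward) and constants $c,C_0>0$ with $$c\le\liminf_{n\to\infty}\frac{\|Id-T_n\|_{L^\infty(\Omega)}}{\delta_n}\le\limsup_{n\to\infty}\frac{\|Id-T_n\|_{L^\infty(\Omega)}}{\delta_n}\le C_0,$$ hence $\|Id-T_n\|_{L^\infty(\Omega)}/\varepsilon_n^2\to0$.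 A realization of the data for which such maps exist, and such a sequence $\{T_n\}$, are fixed. *)

theory Defs
  imports "HOL-Analysis.Analysis" "HOL-Probability.Probability"
begin

section \<open>Domains\<close>

primrec C_k :: "nat \<Rightarrow> ('a::euclidean_space \<Rightarrow> real) \<Rightarrow> bool" where
  "C_k 0 f \<longleftrightarrow> continuous_on UNIV f"
| "C_k (Suc k) f \<longleftrightarrow>
     (\<exists>D :: 'a \<Rightarrow> 'a. (\<forall>x. GDERIV f x :> D x) \<and> (\<forall>b\<in>Basis. C_k k (\<lambda>x. D x \<bullet> b)))"

text \<open>Near each boundary point, and in a coordinate system whose last axis is \<open>e\<close>, the domain
  is the region above the graph of a function \<open>\<gamma>\<close> of class \<open>C^k\<close> of the remaining
  coordinates. The vector \<open>x - (x \<bullet> e) e\<close> is the projection of \<open>x\<close> to the hyperplane of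
  these coordinates; a \<open>C^k\<close> function on the hyperplane extends to one on the
  whole space that is constant along \<open>e\<close>.\<close>

definition C_k_boundary :: "nat \<Rightarrow> 'a::euclidean_space set \<Rightarrow> bool" where
  "C_k_boundary k \<Omega> \<longleftrightarrow>
     (\<forall>p \<in> frontier \<Omega>. \<exists>r>0. \<exists>e \<gamma>. norm e = 1 \<and> C_k k \<gamma> \<and>
        \<Omega> \<inter> ball p r = {x \<in> ball p r. \<gamma> (x - (x \<bullet> e) *\<^sub>R e) < x \<bullet> e})"

definition C_k_domain :: "nat \<Rightarrow> 'a::euclidean_space set \<Rightarrow> bool" where
  "C_k_domain k \<Omega> \<longleftrightarrow>
     \<Omega> \<noteq> {} \<and> open \<Omega> \<and> connected \<Omega> \<and> bounded \<Omega> \<and> C_k_boundary k \<Omega>"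

section \<open>Kernels\<close>

text \<open>Kernels and other functions on \<open>[0,\<infinity>)\<close> are functions on the reals whose values at negative
  arguments are irrelevant.\<close>

definition radial_kernel :: "(real \<Rightarrow> real) \<Rightarrow> bool" where
  "radial_kernel \<eta> \<longleftrightarrow>
     (\<forall>s\<ge>0. 0 \<le> \<eta> s) \<and> antimono_on {0..} \<eta> \<and> compact (closure {s \<in> {0..}. \<eta> s \<noteq> 0})"

text \<open>\<open>S\<close> is the set of break points; on each piece between them \<open>\<eta>\<close> is Lipschitz, and jumps at the
  break points are allowed.\<close>

definition piecewise_lipschitz_halfline :: "(real \<Rightarrow> real) \<Rightarrow> bool" where
  "piecewise_lipschitz_halfline \<eta> \<longleftrightarrow>
     (\<exists>L S. finite S \<and>
        (\<forall>a b. 0 \<le> a \<and> a < b \<and> {a<..<b} \<inter> S = {} \<longrightarrow> L-lipschitz_on {a<..<b} \<eta>))"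

definition graph_kernel :: "(real \<Rightarrow> real) \<Rightarrow> bool" where
  "graph_kernel \<eta> \<longleftrightarrow>
     radial_kernel \<eta> \<and> piecewise_lipschitz_halfline \<eta> \<and> 1 \<le> \<eta> 1 \<and> \<eta> 2 = 0"

text \<open>Derivatives of all orders on \<open>[0,\<infinity>)\<close>, one-sided at the origin.\<close>

definition smooth_halfline :: "(real \<Rightarrow> real) \<Rightarrow> bool" where
  "smooth_halfline f \<longleftrightarrow>
     (\<exists>D :: nat \<Rightarrow> real \<Rightarrow> real. D 0 = f \<and>
        (\<forall>k. \<forall>s\<ge>0. (D k has_real_derivative D (Suc k) s) (at s within {0..})))"

text \<open>The condition \<open>0 < \<zeta> 0\<close> excludes exactly the zero function, as \<open>\<zeta>\<close> is nonnegative and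
  nonincreasing.\<close>

definition smooth_kernel :: "(real \<Rightarrow> real) \<Rightarrow> bool" where
  "smooth_kernel \<zeta> \<longleftrightarrow> radial_kernel \<zeta> \<and> smooth_halfline \<zeta> \<and> 0 < \<zeta> 0"

definition scaled_kernel :: "nat \<Rightarrow> (real \<Rightarrow> real) \<Rightarrow> real \<Rightarrow> real \<Rightarrow> real" where
  "scaled_kernel d \<eta> \<epsilon> s = \<eta> (s / \<epsilon>) / \<epsilon> ^ d"

section \<open>Densities, samples and length scales\<close>

definition C1_closure :: "'a::euclidean_space set \<Rightarrow> ('a \<Rightarrow> real) \<Rightarrow> bool" where
  "C1_closure \<Omega> \<rho> \<longleftrightarrow> continuous_on (closure \<Omega>) \<rho> \<and>
     (\<exists>D :: 'a \<Rightarrow> 'a. continuous_on (closure \<Omega>) D \<and> (\<forall>x\<in>\<Omega>. GDERIV \<rho> x :> D x))"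

definition density_measure :: "'a::euclidean_space set \<Rightarrow> ('a \<Rightarrow> real) \<Rightarrow> 'a measure" where
  "density_measure \<Omega> \<rho> = density (restrict_space lborel \<Omega>) (\<lambda>x. ennreal (\<rho> x))"

definition admissible_density :: "'a::euclidean_space set \<Rightarrow> ('a \<Rightarrow> real) \<Rightarrow> bool" where
  "admissible_density \<Omega> \<rho> \<longleftrightarrow> C1_closure \<Omega> \<rho> \<and>
     (\<exists>a b. 0 < a \<and> (\<forall>x\<in>\<Omega>. a \<le> \<rho> x \<and> \<rho> x \<le> b)) \<and>
     prob_space (density_measure \<Omega> \<rho>)"

text \<open>The sample points are \<open>X 1, X 2, \<dots>\<close>; \<open>X 0\<close> is not used. As \<open>space \<mu> = \<Omega>\<close> for
  \<open>\<mu> = density_measure \<Omega> \<rho>\<close>, measurability of \<open>X i\<close> into \<open>\<mu>\<close> includes that \<open>X i\<close> takes its values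
  in \<open>\<Omega>\<close>.\<close>

definition iid_samples :: "'w measure \<Rightarrow> (nat \<Rightarrow> 'w \<Rightarrow> 'a) \<Rightarrow> 'a measure \<Rightarrow> bool" where
  "iid_samples P X \<mu> \<longleftrightarrow> prob_space P \<and> prob_space.indep_vars P (\<lambda>_. \<mu>) X {1..} \<and>
     (\<forall>i\<ge>1. distr P \<mu> (X i) = \<mu>)"

definition transport_scale :: "nat \<Rightarrow> nat \<Rightarrow> real" where
  "transport_scale d n = ln (real n) powr (1 / real d) / real n powr (1 / real d)"

definition admissible_scales :: "nat \<Rightarrow> (nat \<Rightarrow> real) \<Rightarrow> bool" where
  "admissible_scales d \<epsilon> \<longleftrightarrow> (\<forall>n\<ge>1. 0 < \<epsilon> n) \<and> \<epsilon> \<longlonglongrightarrow> 0 \<and>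
     filterlim (\<lambda>n. \<epsilon> n / sqrt (transport_scale d n)) at_top sequentially"

section \<open>Point clouds and transportation maps\<close>

definition point_cloud :: "(nat \<Rightarrow> 'a) \<Rightarrow> nat \<Rightarrow> 'a set" where
  "point_cloud x n = x ` {1..n}"

text \<open>The measure \<open>(1/n) (\<delta>_{x_1} + \<dots> + \<delta>_{x_n})\<close>, obtained as the image of the uniform
  distribution on the indices, so that repeated points are counted with multiplicity.\<close>

definition empirical_measure :: "(nat \<Rightarrow> 'a::topological_space) \<Rightarrow> nat \<Rightarrow> 'a measure" where
  "empirical_measure x n = distr (uniform_count_measure {1..n}) borel x"

lemma measure_empirical_measure:
  assumes "A \<in> sets borel"
  shows "measure (empirical_measure x n) A = (\<Sum>i=1..n. measure (return borel (x i)) A) / n"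
proof -
  have "x \<in> measurable (uniform_count_measure {1..n}) borel"
    by (simp add: measurable_def sets_uniform_count_measure space_uniform_count_measure)
  then have "measure (empirical_measure x n) A = measure (uniform_count_measure {1..n}) (x -` A \<inter> {1..n})"
    using assms by (simp add: empirical_measure_def measure_distr space_uniform_count_measure)
  also have "\<dots> = card (x -` A \<inter> {1..n}) / n"
    by (subst measure_uniform_count_measure) auto
  also have "x -` A \<inter> {1..n} = {i \<in> {1..n}. x i \<in> A}" by auto
  also have "real (card {i \<in> {1..n}. x i \<in> A}) = (\<Sum>i=1..n. indicator A (x i))"
    by (simp add: indicator_def of_bool_def sum.If_cases Int_def)
  finally show ?thesis using assms by (simp add: measure_return)
qed

definition Linf_norm :: "'a::euclidean_space set \<Rightarrow> ('a \<Rightarrow> 'b::real_normed_vector) \<Rightarrow> ereal" where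
  "Linf_norm \<Omega> f = esssup (restrict_space lborel \<Omega>) (\<lambda>x. ereal (norm (f x)))"

definition transport_maps ::
    "'a::euclidean_space set \<Rightarrow> ('a \<Rightarrow> real) \<Rightarrow> (nat \<Rightarrow> 'a) \<Rightarrow> (nat \<Rightarrow> 'a \<Rightarrow> 'a) \<Rightarrow> bool" where
  "transport_maps \<Omega> \<rho> x T \<longleftrightarrow>
     (\<forall>n\<ge>1. T n \<in> measurable (density_measure \<Omega> \<rho>) borel \<and>
        T n ` \<Omega> \<subseteq> point_cloud x n \<and>
        distr (density_measure \<Omega> \<rho>) borel (T n) = empirical_measure x n) \<and>
     (\<exists>c C\<^sub>0. 0 < c \<and> 0 < C\<^sub>0 \<and>
        ereal c \<le> liminf (\<lambda>n. Linf_norm \<Omega> (\<lambda>y. y - T n y) / ereal (transport_scale DIM('a) n)) \<and>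
        limsup (\<lambda>n. Linf_norm \<Omega> (\<lambda>y. y - T n y) / ereal (transport_scale DIM('a) n)) \<le> ereal C\<^sub>0)"

section \<open>The graph Poisson equation\<close>

definition graph_laplacian ::
    "(real \<Rightarrow> real) \<Rightarrow> real \<Rightarrow> (nat \<Rightarrow> 'a::euclidean_space) \<Rightarrow> nat \<Rightarrow> ('a \<Rightarrow> real) \<Rightarrow> 'a \<Rightarrow> real" where
  "graph_laplacian \<eta> \<epsilon> x n u y =
     1 / (real n * \<epsilon>\<^sup>2) *
       (\<Sum>j=1..n. scaled_kernel DIM('a) \<eta> \<epsilon> (norm (y - x j)) * (u (x j) - u y))"

text \<open>Functions on the point cloud are functions on the whole space of which only the values on
  the point cloud matter.\<close>

definition solves_graph_poisson ::
    "(real \<Rightarrow> real) \<Rightarrow> real \<Rightarrow> (nat \<Rightarrow> 'a::euclidean_space) \<Rightarrow> nat \<Rightarrow>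
      ('a \<Rightarrow> real) \<Rightarrow> ('a \<Rightarrow> real) \<Rightarrow> bool" where
  "solves_graph_poisson \<eta> \<epsilon> x n u h \<longleftrightarrow>
     (\<forall>y \<in> point_cloud x n. - graph_laplacian \<eta> \<epsilon> x n u y = h y)"

definition nonlocal_energy ::
    "(real \<Rightarrow> real) \<Rightarrow> real \<Rightarrow> real \<Rightarrow> 'a::euclidean_space set \<Rightarrow> ('a \<Rightarrow> real) \<Rightarrow> real" where
  "nonlocal_energy \<zeta> \<epsilon> p \<Omega> v =
     (LINT x:\<Omega>|lborel. (LINT y:\<Omega>|lborel.
        scaled_kernel DIM('a) \<zeta> \<epsilon> (norm (x - y)) * \<bar>(v y - v x) / \<epsilon>\<bar> powr p))"

end

theory Submission
  imports Defs
begin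

text \<open>
  Since \<open>T\<^sub>n\<close> moves points by much less than \<open>\<epsilon>\<^sub>n\<close>, the graph energy of \<open>f\<close> on the sample controls
  the energy of \<open>f \<circ> T\<^sub>n\<close> over all pairs of points of \<open>\<Omega>\<close> at distance at most \<open>\<epsilon>\<^sub>n / 2\<close>. A cone
  condition, joining \<open>x\<close> to the points \<open>x + r v\<close> by chains with steps of length at most \<open>\<epsilon>\<^sub>n / 2\<close>,
  turns this into the Poincare inequality
  \<open>\<parallel>f\<parallel>\<^sub>q\<^sup>q \<le> C r\<^sup>q E\<^sub>q f + C (r\<^sup>-\<^sup>d \<parallel>f\<parallel>\<^sub>1)\<^sup>q\<close> at every scale \<open>\<epsilon>\<^sub>n / 2 \<le> r \<le> 1\<close>.

  Testing the graph Poisson equation with \<open>\<bar>u\<bar>\<^sup>q\<^sup>-\<^sup>2 u\<close> and using \<open>r = 1\<close> gives (i), even without the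
  last summand, and (ii). For (iii), \<open>v = \<bar>u\<bar> + \<parallel>h\<parallel>\<^sub>\<infinity>\<close> satisfies \<open>- \<Delta> v \<le> v\<close>. The choice
  \<open>r\<^sup>2 \<sim> 1 / p\<close> absorbs the energy of \<open>v\<^sup>p\<^sup>/\<^sup>2\<close> and bounds \<open>\<parallel>v\<parallel>\<^sub>p\<close> by \<open>\<parallel>v\<parallel>\<^sub>p\<^sub>/\<^sub>2\<close>. These doublings
  can be iterated with summable losses until \<open>p \<sim> 1 / \<epsilon>\<^sub>n\<^sup>2\<close>, and from there the equation at a
  maximum point of \<open>v\<close> reaches the supremum, as \<open>\<epsilon>\<^sub>n\<^sup>-\<^sup>d\<^sup>/\<^sup>p\<close> stays bounded.
\<close>

section \<open>Convexity inequalities\<close>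

text \<open>Nothing in the energy controls oscillations below the scale \<epsilon>, so the Sobolev
  embedding of a classical Moser iteration is replaced by a Poincare inequality with a free scale r
  and an L1 remainder, in the manner of Nash. The L1 remainder is what lets all comparisons stay
  inside local cones. Testing with powers of order p costs a factor p in the energy; absorbing it
  needs r^2 p ~ 1, and r \<ge> \<epsilon>/2 is what stops the iteration at p ~ 1/\<epsilon>^2.

  The kernel of the conclusion is a smooth bump, at most 1 and supported in [0,1/2]: points at
  distance at most \<epsilon>/2 have images at distance at most \<epsilon>, where \<eta> is at least
  1 after rescaling, so the graph energy dominates.

  For 1 < q < 2 the test inequality carries the weight (|a| + |b|)^(q-2), which degenerates for
  large values. Pairs with a relatively small difference quotient are therefore estimated by the
  mass of |u|^q alone, with a small factor that is absorbed.

  The nearness of T to the identity holds for large n only. The finitely many other n get constants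
  of their own.\<close>

lemma powr_above_tangent:
  fixes s m q :: real
  assumes "1 \<le> q" "0 \<le> s" "0 < m"
  shows "m powr q + q * m powr (q - 1) * (s - m) \<le> s powr q"
proof (cases "s = 0")
  case True
  have "m powr q = m powr (q - 1) * m"
    using assms by (simp add: powr_mult_base mult.commute)
  then show ?thesis
    using True assms by (simp add: algebra_simps)
next
  case False
  have "((\<lambda>x. x powr q) has_real_derivative q * m powr (q - 1)) (at m within {0<..})"
    using assms by (auto intro!: derivative_eq_intros simp: )
  then have "s powr q - m powr q \<ge> q * m powr (q - 1) * (s - m)"
    using assms False by (intro convex_on_imp_above_tangent[OF powr_convex[OF assms(1)]])
      (auto simp: interior_open convex_connected)
  then show ?thesis by simp
qed

text \<open>The tangent at \<open>s\<close>, evaluated at |s - t| \<ge> s - t. The error is linear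
  in \<open>t\<close>, which is why the Poincare inequality ends with an L1 norm.\<close>

lemma powr_diff_lower_bound:
  fixes s t q :: real
  assumes "1 \<le> q" "0 \<le> s" "0 \<le> t"
  shows "s powr q \<le> \<bar>s - t\<bar> powr q + q * s powr (q - 1) * t"
proof (cases "s = 0")
  case False
  have "s powr q + q * s powr (q - 1) * (\<bar>s - t\<bar> - s) \<le> \<bar>s - t\<bar> powr q"
    using assms False by (intro powr_above_tangent) auto
  moreover have "q * s powr (q - 1) * (- t) \<le> q * s powr (q - 1) * (\<bar>s - t\<bar> - s)"
    using assms by (intro mult_left_mono) auto
  ultimately show ?thesis by simp
qed (use assms in auto)

text \<open>Jensen's inequality: the tangent inequalities at the mean \<open>m\<close> are added,
  and their linear parts cancel.\<close>

lemma powr_sum_le: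
  fixes a :: "'b \<Rightarrow> real"
  assumes "1 \<le> q" "finite A" "A \<noteq> {}" "\<And>i. i \<in> A \<Longrightarrow> 0 \<le> a i"
  shows "(\<Sum>i\<in>A. a i) powr q \<le> real (card A) powr (q - 1) * (\<Sum>i\<in>A. a i powr q)"
proof -
  define N where "N = real (card A)"
  define m where "m = (\<Sum>i\<in>A. a i) / N"
  have N: "0 < N" using assms by (simp add: N_def card_gt_0_iff)
  have m: "0 \<le> m" using assms N by (simp add: m_def sum_nonneg)
  have sumA: "(\<Sum>i\<in>A. a i) = N * m" using N by (simp add: m_def)
  show ?thesis
  proof (cases "m = 0")
    case True
    then show ?thesis using sumA assms by (simp add: sum_nonneg)
  next
    case False
    have "(\<Sum>i\<in>A. m powr q + q * m powr (q - 1) * (a i - m)) \<le> (\<Sum>i\<in>A. a i powr q)"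
      using assms m False by (intro sum_mono powr_above_tangent) auto
    moreover have "(\<Sum>i\<in>A. m powr q + q * m powr (q - 1) * (a i - m)) = N * m powr q"
      by (simp add: sum.distrib sum_distrib_left[symmetric] sum_subtractf sumA N_def[symmetric])
    ultimately have "N * m powr q \<le> (\<Sum>i\<in>A. a i powr q)" by simp
    then have "N powr (q - 1) * (N * m powr q) \<le> N powr (q - 1) * (\<Sum>i\<in>A. a i powr q)"
      by (intro mult_left_mono) auto
    moreover have "N powr (q - 1) * (N * m powr q) = (N * m) powr q"
      using N m by (simp add: powr_mult powr_mult_base mult.assoc[symmetric]) (simp add: mult.commute powr_mult_base)
    ultimately show ?thesis by (simp add: sumA N_def)
  qed
qed

section \<open>Poincare inequality at intermediate scales\<close>

lemma nn_integral_lborel_scale: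
  fixes f :: "'a::euclidean_space \<Rightarrow> ennreal"
  assumes [measurable]: "f \<in> borel_measurable borel" and "0 < l"
  shows "(\<integral>\<^sup>+v. f (x + l *\<^sub>R v) \<partial>lborel) = ennreal (1 / l ^ DIM('a)) * (\<integral>\<^sup>+y. f y \<partial>lborel)"
proof -
  have "(\<integral>\<^sup>+y. f y \<partial>lborel) = ennreal (l ^ DIM('a)) * (\<integral>\<^sup>+v. f (x + l *\<^sub>R v) \<partial>lborel)"
    using assms by (subst lborel_affine[of l x]) (simp_all add: nn_integral_density nn_integral_distr nn_integral_cmult)
  then show ?thesis
    using assms by (simp add: mult.assoc[symmetric] ennreal_mult[symmetric])
qed

lemma nn_integral_lborel_translate:
  fixes f :: "'a::euclidean_space \<Rightarrow> ennreal"
  assumes [measurable]: "f \<in> borel_measurable borel"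
  shows "(\<integral>\<^sup>+x. f (a + x) \<partial>lborel) = (\<integral>\<^sup>+x. f x \<partial>lborel)"
  using nn_integral_lborel_scale[of f 1 a] assms by simp

definition pair_energy :: "'a::euclidean_space set \<Rightarrow> real \<Rightarrow> real \<Rightarrow> ('a \<Rightarrow> real) \<Rightarrow> ennreal" where
  "pair_energy \<Omega> e q w = (\<integral>\<^sup>+x. (\<integral>\<^sup>+y. indicator \<Omega> x * indicator \<Omega> y *
      indicator {..e} (norm (x - y)) * ennreal (\<bar>w y - w x\<bar> powr q) \<partial>lborel) \<partial>lborel)"

text \<open>The left side lives on a part \<open>A\<close> of the domain and the right side on all
  of \<Omega>, so that patches of a cover can be summed. Dividing by e^q e^d gives
  \<open>pair_energy\<close> the normalisation of difference quotients and of a rescaled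
  kernel.\<close>

definition scaled_poincare :: "'a::euclidean_space set \<Rightarrow> 'a set \<Rightarrow> real \<Rightarrow> real \<Rightarrow> bool" where
  "scaled_poincare \<Omega> A q C \<longleftrightarrow>
     (\<forall>w e r I. w \<in> borel_measurable borel \<longrightarrow> 0 < e \<longrightarrow> e \<le> r \<longrightarrow> r \<le> 1 \<longrightarrow> 0 \<le> I \<longrightarrow>
        (\<integral>\<^sup>+x. indicator \<Omega> x * ennreal \<bar>w x\<bar> \<partial>lborel) \<le> ennreal I \<longrightarrow>
        (\<integral>\<^sup>+x. indicator A x * ennreal (\<bar>w x\<bar> powr q) \<partial>lborel)
          \<le> ennreal (C * r powr q / (e powr q * e ^ DIM('a))) * pair_energy \<Omega> e q w
             + ennreal (C * (I / r ^ DIM('a)) powr q))"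

text \<open>The segment from x to x + r v is cut into N steps l v with l = r / N. Jensen costs
  N^(q-1), the N steps contribute equally by translation invariance, and the substitution y = z + l
  v costs l^(-d).\<close>

lemma pair_energy_chain:
  fixes \<Omega> U :: "'a::euclidean_space set" and c :: 'a and w :: "'a \<Rightarrow> real"
  assumes [measurable]: "\<Omega> \<in> sets borel" "U \<in> sets borel" "w \<in> borel_measurable borel"
    and cone: "\<And>x v t. x \<in> \<Omega> \<inter> U \<Longrightarrow> v \<in> ball c \<sigma> \<Longrightarrow> t \<in> {0..1} \<Longrightarrow> x + t *\<^sub>R v \<in> \<Omega>"
    and q: "1 \<le> q" and r: "0 < r" "r \<le> 1" and N: "0 < N" "r / real N * (norm c + \<sigma>) \<le> e"
  shows "(\<integral>\<^sup>+x. (\<integral>\<^sup>+v. indicator (\<Omega> \<inter> U) x * indicator (ball c \<sigma>) v *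
            ennreal (\<bar>w (x + r *\<^sub>R v) - w x\<bar> powr q) \<partial>lborel) \<partial>lborel)
          \<le> ennreal (real N powr q * (real N / r) ^ DIM('a)) * pair_energy \<Omega> e q w"
proof -
  define l where "l = r / real N"
  have l: "0 < l" "l * (norm c + \<sigma>) \<le> e" "real N * l = r" using r N by (auto simp: l_def)
  define G where "G z v = indicator \<Omega> z * indicator \<Omega> (z + l *\<^sub>R v)
      * ennreal (\<bar>w (z + l *\<^sub>R v) - w z\<bar> powr q)" for z v
  define g where "g x y = indicator \<Omega> x * indicator \<Omega> y * indicator {..e} (norm (x - y))
      * ennreal (\<bar>w y - w x\<bar> powr q)" for x y
  have [measurable]: "(\<lambda>p. G (fst p) (snd p)) \<in> borel_measurable (borel \<Otimes>\<^sub>M borel)"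
    unfolding G_def by measurable
  have G1: "(\<lambda>p. G (f p) (h p)) \<in> borel_measurable M"
      if "f \<in> borel_measurable M" "h \<in> borel_measurable M" for f h M
    using measurable_compose[OF measurable_Pair[OF that], of "\<lambda>p. G (fst p) (snd p)" borel] by simp
  note G1[measurable]
  have [measurable]: "g x \<in> borel_measurable borel" for x
    unfolding g_def by measurable
  define b :: "'a \<Rightarrow> ennreal" where "b = indicator (ball c \<sigma>)"
  have [measurable]: "b \<in> borel_measurable borel" unfolding b_def
      by (intro borel_measurable_indicator borel_open open_ball)
  have point: "indicator (\<Omega> \<inter> U) x * indicator (ball c \<sigma>) v
      * ennreal (\<bar>w (x + r *\<^sub>R v) - w x\<bar> powr q)
      \<le> ennreal (real N powr (q - 1)) * (\<Sum>k<N. b v * G ((real k * l) *\<^sub>R v + x) v)" for x v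
  proof (cases "x \<in> \<Omega> \<inter> U \<and> v \<in> ball c \<sigma>")
    case True
    have inO: "(real k * l) *\<^sub>R v + x \<in> \<Omega>" if "k \<le> N" for k
    proof -
      have "real k * l \<le> real N * l" using that l by (intro mult_right_mono) auto
      also have "\<dots> \<le> 1" using l r by simp
      finally show ?thesis using cone[of x v "real k * l"] True l by (simp add: add.commute)
    qed
    define f where "f k = w ((real k * l) *\<^sub>R v + x)" for k
    have "\<bar>w (x + r *\<^sub>R v) - w x\<bar> = \<bar>\<Sum>k<N. f (Suc k) - f k\<bar>"
      unfolding sum_lessThan_telescope using l by (simp add: f_def add.commute)
    also have "\<dots> \<le> (\<Sum>k<N. \<bar>f (Suc k) - f k\<bar>)" by (rule sum_abs)
    finally have "\<bar>w (x + r *\<^sub>R v) - w x\<bar> powr q \<le> (\<Sum>k<N. \<bar>f (Suc k) - f k\<bar>) powr q"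
      using q by (intro powr_mono2) auto
    also have "\<dots> \<le> real N powr (q - 1) * (\<Sum>k<N. \<bar>f (Suc k) - f k\<bar> powr q)"
      using powr_sum_le[OF q, of "{..<N}" "\<lambda>k. \<bar>f (Suc k) - f k\<bar>"] N by auto
    finally have "ennreal (\<bar>w (x + r *\<^sub>R v) - w x\<bar> powr q)
        \<le> ennreal (real N powr (q - 1)) * (\<Sum>k<N. ennreal (\<bar>f (Suc k) - f k\<bar> powr q))"
      by (simp add: ennreal_mult[symmetric] sum_nonneg sum_ennreal ennreal_leI)
    moreover have "(\<Sum>k<N. ennreal (\<bar>f (Suc k) - f k\<bar> powr q))
        = (\<Sum>k<N. G ((real k * l) *\<^sub>R v + x) v)"
    proof (rule sum.cong)
      fix k assume k: "k \<in> {..<N}"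
      have eq: "(real k * l) *\<^sub>R v + x + l *\<^sub>R v = (real (Suc k) * l) *\<^sub>R v + x"
        by (simp add: algebra_simps)
      show "ennreal (\<bar>f (Suc k) - f k\<bar> powr q) = G ((real k * l) *\<^sub>R v + x) v"
        unfolding G_def eq using inO[of k] inO[of "Suc k"] k by (simp add: f_def)
    qed simp
    ultimately show ?thesis using True by (simp add: b_def)
  qed (auto simp: b_def split: split_indicator)
  have "(\<integral>\<^sup>+x. (\<integral>\<^sup>+v. indicator (\<Omega> \<inter> U) x * indicator (ball c \<sigma>) v *
            ennreal (\<bar>w (x + r *\<^sub>R v) - w x\<bar> powr q) \<partial>lborel) \<partial>lborel)
      \<le> (\<integral>\<^sup>+x. (\<integral>\<^sup>+v. ennreal (real N powr (q - 1)) *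
          (\<Sum>k<N. b v * G ((real k * l) *\<^sub>R v + x) v) \<partial>lborel) \<partial>lborel)"
    by (intro nn_integral_mono point)
  also have "\<dots> = ennreal (real N powr (q - 1)) *
      (\<Sum>k<N. \<integral>\<^sup>+x. (\<integral>\<^sup>+v. b v * G ((real k * l) *\<^sub>R v + x) v \<partial>lborel) \<partial>lborel)"
    by (simp add: nn_integral_cmult nn_integral_sum)
  also have "(\<Sum>k<N. \<integral>\<^sup>+x. (\<integral>\<^sup>+v. b v * G ((real k * l) *\<^sub>R v + x) v \<partial>lborel) \<partial>lborel)
     = (\<Sum>k<N. \<integral>\<^sup>+x. (\<integral>\<^sup>+v. b v * G x v \<partial>lborel) \<partial>lborel)"
  proof (rule sum.cong)
    fix k
    \<comment> \<open>For fixed \<open>v\<close> the shift by k l v is independent of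
      \<open>x\<close>, so exchanging the integrals removes it.\<close>
    have "(\<integral>\<^sup>+x. (\<integral>\<^sup>+v. b v * G ((real k * l) *\<^sub>R v + x) v \<partial>lborel) \<partial>lborel)
        = (\<integral>\<^sup>+v. (\<integral>\<^sup>+x. b v * G ((real k * l) *\<^sub>R v + x) v \<partial>lborel) \<partial>lborel)"
      by (intro lborel_pair.Fubini') simp
    also have "\<dots> = (\<integral>\<^sup>+v. (\<integral>\<^sup>+x. b v * G x v \<partial>lborel) \<partial>lborel)"
      by (intro nn_integral_cong nn_integral_lborel_translate) simp
    also have "\<dots> = (\<integral>\<^sup>+x. (\<integral>\<^sup>+v. b v * G x v \<partial>lborel) \<partial>lborel)"
      by (intro lborel_pair.Fubini') simp
    finally show "(\<integral>\<^sup>+x. (\<integral>\<^sup>+v. b v * G ((real k * l) *\<^sub>R v + x) v \<partial>lborel) \<partial>lborel) = \<dots>" .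
  qed simp
  also have "\<dots> \<le> (\<Sum>k<N. \<integral>\<^sup>+x. (\<integral>\<^sup>+v. g x (x + l *\<^sub>R v) \<partial>lborel) \<partial>lborel)"
  proof (intro sum_mono nn_integral_mono)
    fix x v
    have "norm (x - (x + l *\<^sub>R v)) \<le> e" if "v \<in> ball c \<sigma>"
    proof -
      have "norm v \<le> norm c + \<sigma>"
        using that norm_triangle_sub[of v c] by (simp add: dist_norm norm_minus_commute)
      then have "l * norm v \<le> l * (norm c + \<sigma>)" using l by (intro mult_left_mono) auto
      also note l(2)
      finally show ?thesis using l(1) by simp
    qed
    then show "b v * G x v \<le> g x (x + l *\<^sub>R v)"
      by (auto simp: G_def g_def b_def split: split_indicator)
  qed
  also have "\<dots> = of_nat N * (ennreal (1 / l ^ DIM('a)) * pair_energy \<Omega> e q w)"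
  proof -
    have "(\<integral>\<^sup>+x. (\<integral>\<^sup>+v. g x (x + l *\<^sub>R v) \<partial>lborel) \<partial>lborel)
        = (\<integral>\<^sup>+x. ennreal (1 / l ^ DIM('a)) * (\<integral>\<^sup>+y. g x y \<partial>lborel) \<partial>lborel)"
      using l by (intro nn_integral_cong nn_integral_lborel_scale) auto
    also have "\<dots> = ennreal (1 / l ^ DIM('a)) * (\<integral>\<^sup>+x. (\<integral>\<^sup>+y. g x y \<partial>lborel) \<partial>lborel)"
      by (intro nn_integral_cmult) (simp add: g_def)
    finally show ?thesis by (simp add: pair_energy_def g_def)
  qed
  also have "ennreal (real N powr (q - 1))
      * (of_nat N * (ennreal (1 / l ^ DIM('a)) * pair_energy \<Omega> e q w))
     = ennreal (real N powr q * (real N / r) ^ DIM('a)) * pair_energy \<Omega> e q w"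
  proof -
    have "real N powr (q - 1) * (real N * (1 / l ^ DIM('a)))
        = real N powr q * (real N / r) ^ DIM('a)"
      using N by (simp add: l_def power_divide powr_diff)
    moreover have "ennreal (real N powr (q - 1)) * (of_nat N * (ennreal (1 / l ^ DIM('a)) * X))
      = ennreal (real N powr (q - 1) * (real N * (1 / l ^ DIM('a)))) * X" for X
      using l by (simp add: ennreal_mult mult.assoc ennreal_of_nat_eq_real_of_nat del: times_divide_eq_right)
    ultimately show ?thesis by simp
  qed
  finally show ?thesis by (simp add: mult_left_mono)
qed

text \<open>A substitute for Jensen's inequality: if \<open>s\<close> is large compared with the average \<open>A\<close>, the
  term of \<open>powr_diff_lower_bound\<close> that is linear in \<open>\<bar>g v\<bar>\<close> is absorbed after integration.\<close>

lemma average_powr_bound: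
  fixes g :: "'a::euclidean_space \<Rightarrow> real"
  assumes [measurable]: "g \<in> borel_measurable borel" "B \<in> sets borel"
    and B: "emeasure lborel B = ennreal V" "0 < V"
    and q: "1 \<le> q" and s: "0 \<le> s" and A: "0 \<le> A"
    and int: "(\<integral>\<^sup>+v. indicator B v * ennreal \<bar>g v\<bar> \<partial>lborel) \<le> ennreal (V * A)"
  shows "ennreal (\<bar>s\<bar> powr q) \<le> ennreal ((2 * q * A) powr q) +
           ennreal (2 / V) * (\<integral>\<^sup>+v. indicator B v * ennreal (\<bar>s - \<bar>g v\<bar>\<bar> powr q) \<partial>lborel)"
    (is "_ \<le> _ + _ * ?J")
proof (cases "s \<le> 2 * q * A")
  case True
  then have "ennreal (\<bar>s\<bar> powr q) \<le> ennreal ((2 * q * A) powr q)"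
    using q s by (intro ennreal_leI powr_mono2) auto
  then show ?thesis by (simp add: add_increasing2)
next
  case False
  then have sp: "0 < s" using q A s by (smt (verit) mult_nonneg_nonneg)
  show ?thesis
  proof (cases "?J = \<infinity>")
    case True
    then show ?thesis using B by (simp add: ennreal_mult_top)
  next
    case fin: False
    then obtain j where j: "?J = ennreal j" "0 \<le> j"
      by (cases ?J) auto
    have "ennreal (s powr q * V) = (\<integral>\<^sup>+v. indicator B v * ennreal (s powr q) \<partial>lborel)"
      using B by (simp add: nn_integral_multc ennreal_mult mult.commute)
    also have "\<dots> \<le> (\<integral>\<^sup>+v. indicator B v * ennreal (\<bar>s - \<bar>g v\<bar>\<bar> powr q) +
          ennreal (q * s powr (q - 1)) * (indicator B v * ennreal \<bar>g v\<bar>) \<partial>lborel)"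
    proof (intro nn_integral_mono)
      fix v
      have "ennreal (s powr q) \<le> ennreal (\<bar>s - \<bar>g v\<bar>\<bar> powr q + q * s powr (q - 1) * \<bar>g v\<bar>)"
        using powr_diff_lower_bound[OF q s, of "\<bar>g v\<bar>"] by (intro ennreal_leI) auto
      also have "\<dots> = ennreal (\<bar>s - \<bar>g v\<bar>\<bar> powr q) + ennreal (q * s powr (q - 1)) * ennreal \<bar>g v\<bar>"
        using q by (simp add: ennreal_mult ennreal_plus)
      finally show "indicator B v * ennreal (s powr q)
          \<le> indicator B v * ennreal (\<bar>s - \<bar>g v\<bar>\<bar> powr q) +
          ennreal (q * s powr (q - 1)) * (indicator B v * ennreal \<bar>g v\<bar>)"
        by (auto split: split_indicator)
    qed
    also have "\<dots> = ?J + ennreal (q * s powr (q - 1))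
        * (\<integral>\<^sup>+v. indicator B v * ennreal \<bar>g v\<bar> \<partial>lborel)"
      by (simp add: nn_integral_add nn_integral_cmult)
    also have "\<dots> \<le> ennreal j + ennreal (q * s powr (q - 1)) * ennreal (V * A)"
      unfolding j by (intro add_left_mono mult_left_mono int) auto
    also have "\<dots> = ennreal (j + q * s powr (q - 1) * (V * A))"
      using j q A B by (simp add: ennreal_mult ennreal_plus)
    finally have 1: "s powr q * V \<le> j + q * s powr (q - 1) * (V * A)"
      using j q A B by (subst (asm) ennreal_le_iff) auto
    \<comment> \<open>As s > 2 q A, the linear term is at most half of s^q V.\<close>
    have "s powr (q - 1) * V * (2 * q * A) \<le> s powr (q - 1) * V * s"
      using False B by (intro mult_left_mono) auto
    also have "\<dots> = s powr q * V"
      using s by (simp add: powr_mult_base mult.commute mult.left_commute)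
    finally have "s powr q * V \<le> 2 * j" using 1 by (simp add: algebra_simps)
    then have "\<bar>s\<bar> powr q \<le> 2 / V * j" using B s by (simp add: field_simps)
    then have "ennreal (\<bar>s\<bar> powr q) \<le> ennreal (2 / V) * ?J"
      using j B by (simp add: ennreal_mult[symmetric] ennreal_leI)
    then show ?thesis by (simp add: add_increasing)
  qed
qed

text \<open>For x in the patch, |w x| is compared with the mean of |w (x + r v)| over v in
  \<open>ball c \<sigma>\<close>. That mean is at most I / (r^d V), and the chain estimate controls
  the difference.\<close>

lemma cone_patch_poincare:
  fixes \<Omega> U :: "'a::euclidean_space set" and c :: 'a
  assumes [measurable]: "\<Omega> \<in> sets borel" "U \<in> sets borel" and bounded: "bounded \<Omega>"
    and cone: "\<And>x v t. x \<in> \<Omega> \<inter> U \<Longrightarrow> v \<in> ball c \<sigma> \<Longrightarrow> t \<in> {0..1} \<Longrightarrow> x + t *\<^sub>R v \<in> \<Omega>"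
    and \<sigma>: "0 < \<sigma>" and q: "1 \<le> q"
  shows "\<exists>C>0. scaled_poincare \<Omega> (\<Omega> \<inter> U) q C"
proof -
  define d where "d = DIM('a)"
  define R where "R = norm c + \<sigma>"
  define V where "V = measure lborel (ball c \<sigma>)"
  define M where "M = measure lborel (\<Omega> \<inter> U)"
  \<comment> \<open>The first summand belongs to a chain of at most (R + 1) r / e steps, the second
    to the integral of (2 q A)^q over the patch.\<close>
  define C where "C = 2 / V * (R + 1) powr q * (R + 1) ^ d + M * (2 * q / V) powr q"
  have R: "0 < R" using \<sigma> by (simp add: R_def add_nonneg_pos)
  have V: "emeasure lborel (ball c \<sigma>) = ennreal V" "0 < V"
    using \<sigma> emeasure_lborel_ball_finite[of c \<sigma>] by (auto simp: V_def emeasure_eq_ennreal_measure)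
  have "emeasure lborel (\<Omega> \<inter> U) \<noteq> \<infinity>"
    using emeasure_bounded_finite[OF bounded_subset[OF bounded, of "\<Omega> \<inter> U"]] by auto
  then have M: "emeasure lborel (\<Omega> \<inter> U) = ennreal M" "0 \<le> M"
    by (auto simp: M_def emeasure_eq_ennreal_measure)
  have C0: "0 \<le> 2 / V * (R + 1) powr q * (R + 1) ^ d" "0 \<le> M * (2 * q / V) powr q"
    using V M R by auto
  have "0 < 2 / V * (R + 1) powr q * (R + 1) ^ d" using V R by simp
  then have C: "0 < C" using C0 by (simp add: C_def)
  have "(\<integral>\<^sup>+x. indicator (\<Omega> \<inter> U) x * ennreal (\<bar>w x\<bar> powr q) \<partial>lborel)
        \<le> ennreal (C * r powr q / (e powr q * e ^ d)) * pair_energy \<Omega> e q w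
           + ennreal (C * (I / r ^ d) powr q)"
    if [measurable]: "w \<in> borel_measurable borel" and er: "0 < e" "e \<le> r" "r \<le> 1" and I: "0 \<le> I"
      and int: "(\<integral>\<^sup>+x. indicator \<Omega> x * ennreal \<bar>w x\<bar> \<partial>lborel) \<le> ennreal I" for w e r I
  proof -
    define b :: "'a \<Rightarrow> ennreal" where "b = indicator (ball c \<sigma>)"
    have [measurable]: "b \<in> borel_measurable borel"
      unfolding b_def by (intro borel_measurable_indicator borel_open open_ball)
    \<comment> \<open>As |v| < R, this many steps have length at most \<open>e\<close>; rounding up
      adds at most 1 \<le> r / e, whence N \<le> (R + 1) r / e.\<close>
    define N where "N = nat \<lceil>r * R / e\<rceil>"
    define A where "A = I / (r ^ d * V)"
    define J where "J x = (\<integral>\<^sup>+v. b v * ennreal (\<bar>w (x + r *\<^sub>R v) - w x\<bar> powr q) \<partial>lborel)" for x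
    have r: "0 < r" using er by simp
    have rR: "0 < r * R / e" using r R er by simp
    have N1: "r * R / e \<le> real N" unfolding N_def by (rule real_nat_ceiling_ge)
    then have N: "0 < N" using rR by (cases N) auto
    have "real N \<le> r * R / e + 1" unfolding N_def using rR by linarith
    also have "\<dots> \<le> r * R / e + r / e" using er by simp
    finally have N2: "real N \<le> r / e * (R + 1)" by (simp add: algebra_simps add_divide_distrib)
    have step: "r / real N * (norm c + \<sigma>) \<le> e"
      unfolding R_def[symmetric] using N1 N er by (simp add: field_simps)
    have A: "0 \<le> A" using I r V by (simp add: A_def)
    have [measurable]: "J \<in> borel_measurable borel" unfolding J_def by measurable
    have point: "indicator (\<Omega> \<inter> U) x * ennreal (\<bar>w x\<bar> powr q)
       \<le> indicator (\<Omega> \<inter> U) x * ennreal ((2 * q * A) powr q) + ennreal (2 / V) * (indicator (\<Omega> \<inter> U) x * J x)" for x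
    proof (cases "x \<in> \<Omega> \<inter> U")
      case True
      have "(\<integral>\<^sup>+v. b v * ennreal \<bar>w (x + r *\<^sub>R v)\<bar> \<partial>lborel)
         \<le> (\<integral>\<^sup>+v. indicator \<Omega> (x + r *\<^sub>R v) * ennreal \<bar>w (x + r *\<^sub>R v)\<bar> \<partial>lborel)"
        using cone[OF True, of _ r] er
            by (intro nn_integral_mono) (auto simp: b_def split: split_indicator)
      also have "\<dots> = ennreal (1 / r ^ d) * (\<integral>\<^sup>+x. indicator \<Omega> x * ennreal \<bar>w x\<bar> \<partial>lborel)"
        unfolding d_def using r
        by (intro nn_integral_lborel_scale[of "\<lambda>x. indicator \<Omega> x * ennreal \<bar>w x\<bar>" r x]) auto
      also have "\<dots> \<le> ennreal (1 / r ^ d) * ennreal I"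
        by (intro mult_left_mono int) auto
      also have "\<dots> = ennreal (V * A)"
        using V r I by (simp add: A_def ennreal_mult[symmetric])
      finally have avg: "(\<integral>\<^sup>+v. b v * ennreal \<bar>w (x + r *\<^sub>R v)\<bar> \<partial>lborel) \<le> ennreal (V * A)" .
      have "ennreal (\<bar>\<bar>w x\<bar>\<bar> powr q) \<le> ennreal ((2 * q * A) powr q) +
           ennreal (2 / V) * (\<integral>\<^sup>+v. indicator (ball c \<sigma>) v * ennreal (\<bar>\<bar>w x\<bar> - \<bar>w (x + r *\<^sub>R v)\<bar>\<bar> powr q) \<partial>lborel)"
        using avg V q A by (intro average_powr_bound) (auto simp: b_def)
      also have "(\<integral>\<^sup>+v. indicator (ball c \<sigma>) v
          * ennreal (\<bar>\<bar>w x\<bar> - \<bar>w (x + r *\<^sub>R v)\<bar>\<bar> powr q) \<partial>lborel) \<le> J x"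
        unfolding J_def b_def using q
        by (intro nn_integral_mono mult_left_mono ennreal_leI powr_mono2) auto
      finally show ?thesis using True by (simp add: mult_left_mono)
    qed auto
    have "(\<integral>\<^sup>+x. indicator (\<Omega> \<inter> U) x * ennreal (\<bar>w x\<bar> powr q) \<partial>lborel)
       \<le> (\<integral>\<^sup>+x. indicator (\<Omega> \<inter> U) x * ennreal ((2 * q * A) powr q) + ennreal (2 / V) * (indicator (\<Omega> \<inter> U) x * J x) \<partial>lborel)"
      by (intro nn_integral_mono point)
    also have "\<dots> = ennreal M * ennreal ((2 * q * A) powr q)
        + ennreal (2 / V) * (\<integral>\<^sup>+x. indicator (\<Omega> \<inter> U) x * J x \<partial>lborel)"
      by (simp add: nn_integral_add nn_integral_cmult nn_integral_multc M)
    also have "\<dots> \<le> ennreal (C * (I / r ^ d) powr q)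
        + ennreal (C * r powr q / (e powr q * e ^ d)) * pair_energy \<Omega> e q w"
    proof (rule add_mono)
      have "(2 * q * A) powr q = (2 * q / V) powr q * (I / r ^ d) powr q"
        using q V I r by (subst powr_mult[symmetric]) (auto simp: A_def mult_ac)
      moreover have "M * (2 * q / V) powr q * (I / r ^ d) powr q \<le> C * (I / r ^ d) powr q"
        using C0 by (intro mult_right_mono) (auto simp: C_def)
      ultimately have "M * (2 * q * A) powr q \<le> C * (I / r ^ d) powr q" by simp
      then show "ennreal M * ennreal ((2 * q * A) powr q) \<le> ennreal (C * (I / r ^ d) powr q)"
        using M by (simp add: ennreal_mult[symmetric] ennreal_leI)
    next
      have "(\<integral>\<^sup>+x. indicator (\<Omega> \<inter> U) x * J x \<partial>lborel)
         = (\<integral>\<^sup>+x. (\<integral>\<^sup>+v. indicator (\<Omega> \<inter> U) x * indicator (ball c \<sigma>) v *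
            ennreal (\<bar>w (x + r *\<^sub>R v) - w x\<bar> powr q) \<partial>lborel) \<partial>lborel)"
        unfolding J_def b_def[symmetric] by (simp add: nn_integral_cmult[symmetric] mult.assoc)
      also have "\<dots> \<le> ennreal (real N powr q * (real N / r) ^ d) * pair_energy \<Omega> e q w"
        unfolding d_def using er N step q r by (intro pair_energy_chain cone) auto
      also have "\<dots> \<le> ennreal ((r / e * (R + 1)) powr q * ((R + 1) / e) ^ d) * pair_energy \<Omega> e q w"
        using N2 r q R er by (intro mult_right_mono ennreal_leI mult_mono powr_mono2 power_mono)
           (auto simp: field_simps)
      finally have "ennreal (2 / V) * (\<integral>\<^sup>+x. indicator (\<Omega> \<inter> U) x * J x \<partial>lborel)
         \<le> ennreal (2 / V) * (ennreal ((r / e * (R + 1)) powr q * ((R + 1) / e) ^ d) * pair_energy \<Omega> e q w)"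
        by (intro mult_left_mono) auto
      also have "\<dots> = ennreal (2 / V * ((r / e * (R + 1)) powr q * ((R + 1) / e) ^ d))
          * pair_energy \<Omega> e q w"
        using V r er R by (simp add: ennreal_mult mult.assoc del: times_divide_eq_left)
      also have "2 / V * ((r / e * (R + 1)) powr q * ((R + 1) / e) ^ d)
         = 2 / V * (R + 1) powr q * (R + 1) ^ d * (r powr q / (e powr q * e ^ d))"
        using r er R by (simp add: powr_mult powr_divide power_divide)
      also have "ennreal \<dots> \<le> ennreal (C * (r powr q / (e powr q * e ^ d)))"
        using C0 er by (intro ennreal_leI mult_right_mono) (auto simp: C_def)
      finally show "ennreal (2 / V) * (\<integral>\<^sup>+x. indicator (\<Omega> \<inter> U) x * J x \<partial>lborel)
         \<le> ennreal (C * r powr q / (e powr q * e ^ d)) * pair_energy \<Omega> e q w"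
        by (simp add: mult_right_mono)
    qed
    finally show ?thesis by (simp add: add.commute)
  qed
  then show ?thesis using C unfolding d_def scaled_poincare_def
      by (intro exI[of _ C] conjI allI impI)
qed

section \<open>Uniform cone condition\<close>

text \<open>The points x + t v form a truncated cone with vertex x, or a ball about x when c = 0.
  The cone is the same for all x of the patch, which is what permits Fubini and translation in the
  chain estimate.\<close>

abbreviation inward_cone :: "'a::euclidean_space set \<Rightarrow> 'a set \<Rightarrow> 'a \<Rightarrow> real \<Rightarrow> bool" where
  "inward_cone \<Omega> U c \<sigma> \<equiv> \<forall>x\<in>\<Omega> \<inter> U. \<forall>v\<in>ball c \<sigma>. \<forall>t\<in>{0..1}. x + t *\<^sub>R v \<in> \<Omega>"

definition uniform_cone :: "'a::euclidean_space set \<Rightarrow> bool" where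
  "uniform_cone \<Omega> \<longleftrightarrow> (\<exists>F. finite F \<and>
     (\<forall>(U, c, \<sigma>)\<in>F. open U \<and> 0 < \<sigma> \<and>
        inward_cone \<Omega> U c \<sigma>) \<and>
     \<Omega> \<subseteq> (\<Union>(U, c, \<sigma>)\<in>F. U))"

section \<open>Cones over the boundary of a C^1 domain\<close>

lemma C_k_lipschitz_on_cball:
  fixes \<gamma> :: "'a::euclidean_space \<Rightarrow> real"
  assumes "C_k (Suc 0) \<gamma>"
  obtains M where "0 \<le> M" "\<And>x y. x \<in> cball 0 R \<Longrightarrow> y \<in> cball 0 R \<Longrightarrow> \<bar>\<gamma> x - \<gamma> y\<bar> \<le> M * norm (x - y)"
proof -
  from assms obtain D where D: "\<And>x. GDERIV \<gamma> x :> D x" "\<And>b. b \<in> Basis \<Longrightarrow>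
      continuous_on UNIV (\<lambda>x. D x \<bullet> b)"
    by auto
  have "continuous_on (cball 0 R) D"
    using D(2) by (subst continuous_on_componentwise) (auto intro: continuous_on_subset)
  then have "bounded (D ` cball 0 R)"
    by (intro compact_imp_bounded compact_continuous_image) auto
  then obtain M where M: "\<And>x. x \<in> cball 0 R \<Longrightarrow> norm (D x) \<le> M"
    unfolding bounded_iff by blast
  have "\<bar>\<gamma> x - \<gamma> y\<bar> \<le> max M 0 * norm (x - y)" if "x \<in> cball 0 R" "y \<in> cball 0 R" for x y
  proof -
    have "norm (\<gamma> x - \<gamma> y) \<le> max M 0 * norm (x - y)"
    proof (rule differentiable_bound[OF convex_cball])
      show "(\<gamma> has_derivative (\<lambda>h. h \<bullet> D z)) (at z within cball 0 R)" for z
        using D(1)[of z] by (auto simp: gderiv_def intro: has_derivative_at_withinI)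
      show "onorm (\<lambda>h. h \<bullet> D z) \<le> max M 0" if "z \<in> cball 0 R" for z
      proof (rule onorm_bound)
        fix h
        have "norm (h \<bullet> D z) \<le> norm h * norm (D z)" by (simp add: Cauchy_Schwarz_ineq2)
        also have "\<dots> \<le> norm h * max M 0" using M[OF that] by (intro mult_left_mono) auto
        finally show "norm (h \<bullet> D z) \<le> max M 0 * norm h" by (simp add: mult.commute)
      qed simp
    qed (use that in auto)
    then show ?thesis by simp
  qed
  then show ?thesis using that[of "max M 0"] by auto
qed

text \<open>Above a graph with Lipschitz constant M, a displacement v with v . e \<ge> M
  |\<open>\<pi> v\<close>| does not leave the region. Vectors close to a multiple of
  \<open>e\<close> have this property.\<close>

lemma boundary_cone:
  fixes \<Omega> :: "'a::euclidean_space set"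
  assumes "0 < r" "norm e = 1" "C_k (Suc 0) \<gamma>"
    and graph: "\<Omega> \<inter> ball p r = {x \<in> ball p r. \<gamma> (x - (x \<bullet> e) *\<^sub>R e) < x \<bullet> e}"
  shows "\<exists>c \<sigma>. 0 < \<sigma> \<and> inward_cone \<Omega> (ball p (r / 2)) c \<sigma>"
proof -
  obtain M where M: "0 \<le> M"
    "\<And>x y. x \<in> cball 0 (norm p + r) \<Longrightarrow> y \<in> cball 0 (norm p + r) \<Longrightarrow> \<bar>\<gamma> x - \<gamma> y\<bar> \<le> M * norm (x - y)"
    using C_k_lipschitz_on_cball[OF assms(3)] by metis
  define \<pi> where "\<pi> x = x - (x \<bullet> e) *\<^sub>R e" for x
  have ee: "e \<bullet> e = 1" using assms(2) by (simp add: norm_eq_1)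
  have \<pi>_norm: "norm (\<pi> x) \<le> norm x" for x
  proof -
    have "norm (\<pi> x) ^ 2 = norm x ^ 2 - (x \<bullet> e) ^ 2"
      unfolding power2_norm_eq_inner \<pi>_def
          by (simp add: inner_diff inner_commute ee power2_eq_square)
    then have "norm (\<pi> x) ^ 2 \<le> norm x ^ 2" by simp
    then show ?thesis by (rule power2_le_imp_le) simp
  qed
  have \<pi>_add: "\<pi> (x + y) = \<pi> x + \<pi> y" and \<pi>_scale: "\<pi> (t *\<^sub>R x) = t *\<^sub>R \<pi> x" for x y t
    by (simp_all add: \<pi>_def inner_add algebra_simps)
  have \<pi>_e: "\<pi> e = 0" by (simp add: \<pi>_def ee)
  \<comment> \<open>The choice s = r / 4 keeps |v| < s + \<sigma> \<le> r / 2, so x + t v stays in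
    \<open>ball p r\<close>; and (M + 1) \<sigma> = s gives v . e \<ge> s - \<sigma> = M
    \<sigma>.\<close>
  define s where "s = r / 4"
  define \<sigma> where "\<sigma> = s / (M + 1)"
  have s: "0 < s" "0 < \<sigma>" "\<sigma> \<le> s" "(M + 1) * \<sigma> = s"
    using assms M(1) by (auto simp: s_def \<sigma>_def field_simps)
  have "x + t *\<^sub>R v \<in> \<Omega>" if x: "x \<in> \<Omega> \<inter> ball p (r / 2)" and v: "v \<in> ball (s *\<^sub>R e) \<sigma>" and t: "t \<in> {0..1}" for x v t
  proof -
    have v': "norm (v - s *\<^sub>R e) < \<sigma>" using v by (simp add: dist_norm norm_minus_commute)
    have "norm v \<le> norm (v - s *\<^sub>R e) + norm (s *\<^sub>R e)"
        using norm_triangle_ineq[of "v - s *\<^sub>R e" "s *\<^sub>R e"] by simp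
    then have "norm v < r / 2" using v' s assms by (simp add: s_def)
    then have tv: "norm (t *\<^sub>R v) < r / 2" using t mult_left_le_one_le[of "norm v" t] by auto
    have xr: "x \<in> ball p r" "x + t *\<^sub>R v \<in> ball p r"
      using x tv norm_triangle_ineq4[of "p - x" "t *\<^sub>R v"] assms(1)
      by (auto simp: dist_norm algebra_simps)
    \<comment> \<open>The projection of a point may leave \<open>ball p r\<close>. Hence the
      Lipschitz bound on a ball about the origin, which \<open>\<pi>\<close> maps into
      itself.\<close>
    have in_cball: "\<pi> z \<in> cball 0 (norm p + r)" if "z \<in> ball p r" for z
    proof -
      have "norm z \<le> norm p + norm (z - p)" using norm_triangle_ineq[of p "z - p"] by simp
      then show ?thesis using that \<pi>_norm[of z] by (simp add: dist_norm norm_minus_commute)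
    qed
    have "\<pi> v = \<pi> (v - s *\<^sub>R e) " using \<pi>_add[of "v - s *\<^sub>R e" "s *\<^sub>R e"] by (simp add: \<pi>_scale \<pi>_e)
    then have \<pi>v: "norm (\<pi> v) \<le> \<sigma>" using \<pi>_norm[of "v - s *\<^sub>R e"] v' by simp
    have "\<bar>(v - s *\<^sub>R e) \<bullet> e\<bar> \<le> norm (v - s *\<^sub>R e) * norm e" by (rule Cauchy_Schwarz_ineq2)
    then have ve: "M * \<sigma> \<le> v \<bullet> e" using v' assms(2) s by (simp add: inner_diff ee algebra_simps)
    have "\<gamma> (\<pi> (x + t *\<^sub>R v)) \<le> \<gamma> (\<pi> x) + M * norm (\<pi> (x + t *\<^sub>R v) - \<pi> x)"
      using M(2)[OF in_cball[OF xr(2)] in_cball[OF xr(1)]] by linarith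
    also have "\<dots> = \<gamma> (\<pi> x) + t * (M * norm (\<pi> v))" using t by (simp add: \<pi>_add \<pi>_scale)
    also have "\<dots> \<le> \<gamma> (\<pi> x) + t * (v \<bullet> e)"
      using t M(1) \<pi>v ve mult_left_mono[OF \<pi>v M(1)] by (intro add_left_mono mult_left_mono) auto
    also have "\<dots> < x \<bullet> e + t * (v \<bullet> e)"
    proof -
      have "x \<in> {x \<in> ball p r. \<gamma> (x - (x \<bullet> e) *\<^sub>R e) < x \<bullet> e}" using x xr(1) graph by blast
      then show ?thesis by (simp add: \<pi>_def)
    qed
    finally have "x + t *\<^sub>R v \<in> {x \<in> ball p r. \<gamma> (x - (x \<bullet> e) *\<^sub>R e) < x \<bullet> e}"
      using xr(2) unfolding \<pi>_def by (simp add: inner_add)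
    then show ?thesis using graph by blast
  qed
  then show ?thesis using s(2) by blast
qed

text \<open>Compactness of the closure: interior points take a small ball with c = 0, boundary
  points the cone above the graph.\<close>

lemma C_k_domain_uniform_cone:
  fixes \<Omega> :: "'a::euclidean_space set"
  assumes "C_k_domain (Suc 0) \<Omega>"
  shows "uniform_cone \<Omega>"
proof -
  have "open \<Omega>" "bounded \<Omega>" and bd: "C_k_boundary (Suc 0) \<Omega>"
    using assms by (auto simp: C_k_domain_def)
  have loc: "\<exists>\<rho> c \<sigma>. 0 < \<rho> \<and> 0 < \<sigma> \<and> inward_cone \<Omega> (ball p \<rho>) c \<sigma>"
    if p: "p \<in> closure \<Omega>" for p
  proof (cases "p \<in> \<Omega>")
    case True
    then obtain r where r: "0 < r" "ball p r \<subseteq> \<Omega>" using \<open>open \<Omega>\<close> openE by blast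
    have "x + t *\<^sub>R v \<in> \<Omega>" if "x \<in> ball p (r / 2)" "v \<in> ball 0 (r / 2)" "t \<in> {0..1}" for x v t
    proof -
      have "norm (t *\<^sub>R v) < r / 2" using that mult_left_le_one_le[of "norm v" t] by auto
      then have "x + t *\<^sub>R v \<in> ball p r"
        using that norm_triangle_ineq4[of "p - x" "t *\<^sub>R v"] by (auto simp: dist_norm algebra_simps)
      then show ?thesis using r by blast
    qed
    then show ?thesis using r by (intro exI[of _ "r / 2"] exI[of _ 0]) auto
  next
    case False
    then have "p \<in> frontier \<Omega>" using p \<open>open \<Omega>\<close> by (simp add: frontier_def interior_open)
    then obtain r e \<gamma> where r: "0 < r" "norm e = 1" "C_k (Suc 0) \<gamma>"
        "\<Omega> \<inter> ball p r = {x \<in> ball p r. \<gamma> (x - (x \<bullet> e) *\<^sub>R e) < x \<bullet> e}"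
      using bd unfolding C_k_boundary_def by blast
    have "0 < r / 2" using r(1) by simp
    then show ?thesis using boundary_cone[OF r] by blast
  qed
  then obtain \<rho> c \<sigma> where *: "\<And>p. p \<in> closure \<Omega> \<Longrightarrow> 0 < \<rho> p \<and> 0 < \<sigma> p \<and>
      inward_cone \<Omega> (ball p (\<rho> p)) (c p) (\<sigma> p)"
    by metis
  have "compact (closure \<Omega>)" using \<open>bounded \<Omega>\<close> by (simp add: compact_closure)
  moreover have "open (ball p (\<rho> p))" for p by simp
  moreover have "closure \<Omega> \<subseteq> (\<Union>p\<in>closure \<Omega>. ball p (\<rho> p))"
  proof
    fix p assume "p \<in> closure \<Omega>"
    moreover from *[OF this] have "p \<in> ball p (\<rho> p)" by simp
    ultimately show "p \<in> (\<Union>p\<in>closure \<Omega>. ball p (\<rho> p))" by blast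
  qed
  ultimately obtain D where D: "D \<subseteq> closure \<Omega>" "finite D" "closure \<Omega> \<subseteq> (\<Union>p\<in>D. ball p (\<rho> p))"
    by (rule compactE_image)
  then show ?thesis
    unfolding uniform_cone_def
  proof (intro exI[of _ "(\<lambda>p. (ball p (\<rho> p), c p, \<sigma> p)) ` D"] conjI)
    show "\<Omega> \<subseteq> (\<Union>(U, c, \<sigma>)\<in>(\<lambda>p. (ball p (\<rho> p), c p, \<sigma> p)) ` D. U)"
      using D(3) closure_subset[of \<Omega>] by auto
    show "\<forall>(U, c, \<sigma>)\<in>(\<lambda>p. (ball p (\<rho> p), c p, \<sigma> p)) ` D. open U \<and> 0 < \<sigma> \<and>
        inward_cone \<Omega> U c \<sigma>"
    proof
      fix i assume "i \<in> (\<lambda>p. (ball p (\<rho> p), c p, \<sigma> p)) ` D"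
      then obtain p where p: "p \<in> D" and i: "i = (ball p (\<rho> p), c p, \<sigma> p)" by blast
      from p D(1) have "p \<in> closure \<Omega>" by blast
      from *[OF this] show "case i of (U, c, \<sigma>) \<Rightarrow> open U \<and> 0 < \<sigma> \<and>
        inward_cone \<Omega> U c \<sigma>"
        unfolding i by simp
    qed
  qed (use D(2) in simp)
qed

lemma uniform_coneE:
  assumes "uniform_cone \<Omega>"
  obtains F where "finite F" "\<And>x. x \<in> \<Omega> \<Longrightarrow> \<exists>i\<in>F. x \<in> fst i"
    "\<And>U c \<sigma>. (U, c, \<sigma>) \<in> F \<Longrightarrow> open U" "\<And>U c \<sigma>. (U, c, \<sigma>) \<in> F \<Longrightarrow> 0 < \<sigma>"
    "\<And>U c \<sigma> x v t. (U, c, \<sigma>) \<in> F \<Longrightarrow> x \<in> \<Omega> \<inter> U \<Longrightarrow> v \<in> ball c \<sigma> \<Longrightarrow> t \<in> {0..1} \<Longrightarrow> x + t *\<^sub>R v \<in> \<Omega>"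
proof -
  from assms obtain F where F: "finite F" "\<Omega> \<subseteq> (\<Union>(U, c, \<sigma>)\<in>F. U)"
    "\<forall>(U, c, \<sigma>)\<in>F. open U \<and> 0 < \<sigma> \<and>
        inward_cone \<Omega> U c \<sigma>"
    unfolding uniform_cone_def by (elim exE conjE)
  note F3 = bspec[OF F(3), of "(_, _, _)", unfolded prod.case]
  show ?thesis
  proof (rule that[OF F(1)])
    show "\<exists>i\<in>F. x \<in> fst i" if "x \<in> \<Omega>" for x
    proof -
      from that F(2) have "x \<in> (\<Union>(U, c, \<sigma>)\<in>F. U)" by (rule subsetD[rotated])
      then show ?thesis by (auto simp: split_beta)
    qed
  qed (use F3 in \<open>blast+\<close>)
qed

text \<open>The right sides of the patch inequalities differ only in their constants, so the
  inequalities add up over the finite cover.\<close>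

lemma uniform_cone_poincare:
  fixes \<Omega> :: "'a::euclidean_space set"
  assumes [measurable]: "\<Omega> \<in> sets borel" and bounded: "bounded \<Omega>" and "uniform_cone \<Omega>"
    and q: "1 \<le> q"
  obtains C where "0 < C" "scaled_poincare \<Omega> \<Omega> q C"
proof -
  obtain F where F: "finite F" "\<And>x. x \<in> \<Omega> \<Longrightarrow> \<exists>i\<in>F. x \<in> fst i"
    "\<And>U c \<sigma>. (U, c, \<sigma>) \<in> F \<Longrightarrow> open U" "\<And>U c \<sigma>. (U, c, \<sigma>) \<in> F \<Longrightarrow> 0 < \<sigma>"
    "\<And>U c \<sigma> x v t. (U, c, \<sigma>) \<in> F \<Longrightarrow> x \<in> \<Omega> \<inter> U \<Longrightarrow> v \<in> ball c \<sigma> \<Longrightarrow> t \<in> {0..1} \<Longrightarrow> x + t *\<^sub>R v \<in> \<Omega>"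
    by (rule uniform_coneE[OF assms(3)]) (rule that)
  have "\<exists>C>0. scaled_poincare \<Omega> (\<Omega> \<inter> fst i) q C" if "i \<in> F" for i
  proof -
    obtain U c \<sigma> where i: "i = (U, c, \<sigma>)" by (cases i) auto
    note U = F(3-5)[OF that[unfolded i]]
    show ?thesis
      unfolding i fst_conv
      using cone_patch_poincare[OF assms(1) borel_open[OF U(1)] bounded U(3) U(2) q] .
  qed
  then obtain C where C: "\<And>i. i \<in> F \<Longrightarrow> 0 < C i" "\<And>i. i \<in> F \<Longrightarrow>
      scaled_poincare \<Omega> (\<Omega> \<inter> fst i) q (C i)" by metis
  \<comment> \<open>The summand 1 keeps \<open>K\<close> positive even for an empty cover.\<close>
  define K where "K = (\<Sum>i\<in>F. C i) + 1"
  have sumC: "0 \<le> (\<Sum>i\<in>F. C i)" using C(1) by (simp add: sum_nonneg less_imp_le)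
  have "(\<integral>\<^sup>+x. indicator \<Omega> x * ennreal (\<bar>w x\<bar> powr q) \<partial>lborel)
        \<le> ennreal (K * r powr q / (e powr q * e ^ DIM('a))) * pair_energy \<Omega> e q w
           + ennreal (K * (I / r ^ DIM('a)) powr q)"
    if [measurable]: "w \<in> borel_measurable borel" and er: "0 < e" "e \<le> r" "r \<le> 1" and I: "0 \<le> I"
      and int: "(\<integral>\<^sup>+x. indicator \<Omega> x * ennreal \<bar>w x\<bar> \<partial>lborel) \<le> ennreal I" for w e r I
  proof -
    define X where "X = r powr q / (e powr q * e ^ DIM('a))"
    define Y where "Y = (I / r ^ DIM('a)) powr q"
    have XY: "0 \<le> X" "0 \<le> Y" using er by (auto simp: X_def Y_def)
    have "(\<integral>\<^sup>+x. indicator \<Omega> x * ennreal (\<bar>w x\<bar> powr q) \<partial>lborel)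
        \<le> (\<integral>\<^sup>+x. (\<Sum>i\<in>F. indicator (\<Omega> \<inter> fst i) x * ennreal (\<bar>w x\<bar> powr q)) \<partial>lborel)"
    proof (intro nn_integral_mono)
      fix x
      show "indicator \<Omega> x * ennreal (\<bar>w x\<bar> powr q)
          \<le> (\<Sum>i\<in>F. indicator (\<Omega> \<inter> fst i) x * ennreal (\<bar>w x\<bar> powr q))"
      proof (cases "x \<in> \<Omega>")
        case True
        then obtain i where "i \<in> F" "x \<in> fst i" using F(2) by blast
        then have "indicator (\<Omega> \<inter> fst i) x * ennreal (\<bar>w x\<bar> powr q)
            \<le> (\<Sum>i\<in>F. indicator (\<Omega> \<inter> fst i) x * ennreal (\<bar>w x\<bar> powr q))"
          using F(1) by (intro member_le_sum) auto
        then show ?thesis using True \<open>x \<in> fst i\<close> by simp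
      qed simp
    qed
    also have "\<dots> = (\<Sum>i\<in>F. \<integral>\<^sup>+x. indicator (\<Omega> \<inter> fst i) x * ennreal (\<bar>w x\<bar> powr q) \<partial>lborel)"
    proof (intro nn_integral_sum)
      fix i assume "i \<in> F"
      then have [measurable]: "fst i \<in> sets borel"
          using F(3)[of "fst i" "fst (snd i)" "snd (snd i)"] by simp
      show "(\<lambda>x. indicator (\<Omega> \<inter> fst i) x
          * ennreal (\<bar>w x\<bar> powr q)) \<in> borel_measurable lborel" by measurable
    qed
    also have "\<dots> \<le> (\<Sum>i\<in>F. ennreal (C i * X) * pair_energy \<Omega> e q w + ennreal (C i * Y))"
    proof (intro sum_mono)
      fix i assume "i \<in> F"
      note Ci = C(2)[OF this, unfolded scaled_poincare_def, rule_format, OF that]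
      then show "(\<integral>\<^sup>+x. indicator (\<Omega> \<inter> fst i) x * ennreal (\<bar>w x\<bar> powr q) \<partial>lborel)
          \<le> ennreal (C i * X) * pair_energy \<Omega> e q w + ennreal (C i * Y)"
        by (simp only: X_def Y_def times_divide_eq_right)
    qed
    also have "\<dots> = (\<Sum>i\<in>F. ennreal (C i * X)) * pair_energy \<Omega> e q w + (\<Sum>i\<in>F. ennreal (C i * Y))"
      by (simp add: sum.distrib sum_distrib_right)
    also have "\<dots> = ennreal ((\<Sum>i\<in>F. C i) * X) * pair_energy \<Omega> e q w + ennreal ((\<Sum>i\<in>F. C i) * Y)"
      using C(1) XY by (simp add: sum_distrib_right less_imp_le)
    also have "\<dots> \<le> ennreal (K * X) * pair_energy \<Omega> e q w + ennreal (K * Y)"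
      using XY by (intro add_mono mult_right_mono ennreal_leI) (auto simp: K_def)
    finally show ?thesis by (simp add: X_def Y_def)
  qed
  moreover have "0 < K" using sumC by (simp add: K_def)
  ultimately show ?thesis unfolding scaled_poincare_def
      by (intro that[of K, unfolded scaled_poincare_def] allI impI)
qed

text \<open>The cone at x, shrunk by the factor s / R, lies in \<Omega> and within distance s of x.
  This is what bounds the degrees of the graph from below.\<close>

lemma uniform_cone_volume:
  fixes \<Omega> :: "'a::euclidean_space set"
  assumes [measurable]: "\<Omega> \<in> sets borel" and "uniform_cone \<Omega>"
  shows "\<exists>c>0. \<forall>x\<in>\<Omega>. \<forall>s. 0 < s \<longrightarrow> s \<le> 1 \<longrightarrow>
      ennreal (c * s ^ DIM('a)) \<le> emeasure lborel (\<Omega> \<inter> cball x s)"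
proof -
  obtain F where F: "finite F" "\<And>x. x \<in> \<Omega> \<Longrightarrow> \<exists>i\<in>F. x \<in> fst i"
    "\<And>U c \<sigma>. (U, c, \<sigma>) \<in> F \<Longrightarrow> 0 < \<sigma>"
    "\<And>U c \<sigma> x v t. (U, c, \<sigma>) \<in> F \<Longrightarrow> x \<in> \<Omega> \<inter> U \<Longrightarrow> v \<in> ball c \<sigma> \<Longrightarrow> t \<in> {0..1} \<Longrightarrow> x + t *\<^sub>R v \<in> \<Omega>"
    using uniform_coneE[OF assms(2)] by metis
  define f :: "'a set \<times> 'a \<times> real \<Rightarrow> real" where "f i = norm (fst (snd i)) + snd (snd i)" for i
  have fnn: "0 \<le> f i" if "i \<in> F" for i
    using F(3)[of "fst i" "fst (snd i)" "snd (snd i)"] that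
        by (simp add: f_def add_nonneg_nonneg less_imp_le)
  define R where "R = (\<Sum>i\<in>F. f i) + 1"
  have R: "norm c + \<sigma> \<le> R" if "(U, c, \<sigma>) \<in> F" for U c \<sigma>
    using member_le_sum[OF that _ F(1), of f] fnn by (simp add: R_def f_def)
  have R1: "1 \<le> R" using fnn by (simp add: R_def sum_nonneg)
  \<comment> \<open>A radius common to all patches gives one volume \<open>V\<close>; inserting 1
    makes the set nonempty.\<close>
  define m where "m = Min (insert 1 ((\<lambda>(U, c, \<sigma>). \<sigma>) ` F))"
  have m: "0 < m" "\<And>U c \<sigma>. (U, c, \<sigma>) \<in> F \<Longrightarrow> m \<le> \<sigma>"
    using F(1,3) by (auto simp: m_def Min_le_iff)
  define V where "V = measure lborel (ball (0::'a) m)"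
  have V: "0 < V" "emeasure lborel (ball z m) = ennreal V" for z :: 'a
    using m emeasure_lborel_ball_finite[of z m] emeasure_ball[of m z] content_ball[of m "0::'a"]
    by (auto simp: V_def)
  have "ennreal (V / R ^ DIM('a) * s ^ DIM('a)) \<le> emeasure lborel (\<Omega> \<inter> cball x s)"
    if x: "x \<in> \<Omega>" and s: "0 < s" "s \<le> 1" for x s
  proof -
    from F(2)[OF x] obtain U c \<sigma> where i: "(U, c, \<sigma>) \<in> F" "x \<in> U" by auto
    define l where "l = s / R"
    have l: "0 < l" "l \<le> 1" "l * R = s" using s R1 by (auto simp: l_def)
    have sub: "x + l *\<^sub>R v \<in> \<Omega> \<inter> cball x s" if v: "v \<in> ball c m" for v
    proof -
      have "v \<in> ball c \<sigma>" using v m(2)[OF i(1)] by auto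
      then have 1: "x + l *\<^sub>R v \<in> \<Omega>" using F(4)[OF i(1)] l x i(2) by auto
      have "norm v \<le> norm c + \<sigma>"
        using \<open>v \<in> ball c \<sigma>\<close> norm_triangle_sub[of v c] by (simp add: dist_norm norm_minus_commute)
      also note R[OF i(1)]
      finally have "l * norm v \<le> l * R" using l by (intro mult_left_mono) auto
      then show ?thesis using 1 l by (simp add: dist_norm)
    qed
    have "ennreal (V / R ^ DIM('a) * s ^ DIM('a)) = ennreal (l ^ DIM('a)) * ennreal V"
      using V(1) s R1 by (simp add: ennreal_mult[symmetric] l_def power_divide mult.commute)
    also have "\<dots> = ennreal (l ^ DIM('a)) * (\<integral>\<^sup>+v. indicator (ball c m) v \<partial>lborel)"
        using V(2)[of c] by simp
    also have "\<dots> \<le> ennreal (l ^ DIM('a)) * (\<integral>\<^sup>+v. indicator (\<Omega> \<inter> cball x s) (x + l *\<^sub>R v) \<partial>lborel)"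
      using sub by (intro mult_left_mono nn_integral_mono) (auto split: split_indicator)
    also have "\<dots> = ennreal (l ^ DIM('a))
        * (ennreal (1 / l ^ DIM('a)) * (\<integral>\<^sup>+y. indicator (\<Omega> \<inter> cball x s) y \<partial>lborel))"
      using l by (subst nn_integral_lborel_scale) (auto intro!: borel_measurable_indicator sets.Int[OF assms(1) borel_closed[OF closed_cball]])
    also have "\<dots> = emeasure lborel (\<Omega> \<inter> cball x s)"
      using l by (simp add: mult.assoc[symmetric] ennreal_mult[symmetric])
    finally show ?thesis .
  qed
  moreover have "0 < V / R ^ DIM('a)" using V(1) R1 by simp
  ultimately show ?thesis by blast
qed

section \<open>Point clouds\<close>

text \<open>Integration against the empirical measure, written on functions of the index so that
  repeated sample points count with multiplicity.\<close>

definition avg :: "nat \<Rightarrow> (nat \<Rightarrow> real) \<Rightarrow> real" where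
  "avg n f = (\<Sum>i=1..n. f i) / real n"

lemma avg_nonneg: "(\<And>i. i \<in> {1..n} \<Longrightarrow> 0 \<le> f i) \<Longrightarrow> 0 \<le> avg n f"
  unfolding avg_def by (intro divide_nonneg_nonneg sum_nonneg) auto

lemma avg_mono: "(\<And>i. i \<in> {1..n} \<Longrightarrow> f i \<le> g i) \<Longrightarrow> avg n f \<le> avg n g"
  unfolding avg_def by (intro divide_right_mono sum_mono) auto

lemma avg_cong: "(\<And>i. i \<in> {1..n} \<Longrightarrow> f i = g i) \<Longrightarrow> avg n f = avg n g"
  unfolding avg_def by (metis (mono_tags, lifting) sum.cong)

lemma avg_add: "avg n (\<lambda>i. f i + g i) = avg n f + avg n g"
  by (simp add: avg_def sum.distrib add_divide_distrib)

lemma avg_cmult: "avg n (\<lambda>i. c * f i) = c * avg n f"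
  by (simp add: avg_def sum_distrib_left)

lemma avg_const: "1 \<le> n \<Longrightarrow> avg n (\<lambda>_. c) = c"
  by (simp add: avg_def)

lemma avg_swap: "avg n (\<lambda>i. avg n (\<lambda>j. f i j)) = avg n (\<lambda>j. avg n (\<lambda>i. f i j))"
  unfolding avg_def by (simp add: sum_divide_distrib) (rule sum.swap)

lemma le_avg:
  assumes "\<And>i. i \<in> {1..n} \<Longrightarrow> 0 \<le> f i" "i \<in> {1..n}"
  shows "f i \<le> real n * avg n f"
proof -
  have "f i \<le> (\<Sum>i=1..n. f i)" using assms by (intro member_le_sum) auto
  then show ?thesis using assms(2) by (simp add: avg_def)
qed

text \<open>The data at one fixed \<open>n\<close>. The push-forward identity and a \<le> \<rho>
  \<le> b exchange integrals of g o T over \<Omega> with averages over the sample; the factors are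
  powers of a and b only and hence uniform in n.\<close>

locale cloud =
  fixes \<Omega> :: "'a::euclidean_space set" and \<rho> :: "'a \<Rightarrow> real" and a b :: real
    and x :: "nat \<Rightarrow> 'a" and n :: nat and T :: "'a \<Rightarrow> 'a"
  assumes borel_\<Omega> [measurable]: "\<Omega> \<in> sets borel" and bounded_\<Omega>: "bounded \<Omega>"
    and meas_\<rho>: "\<rho> \<in> borel_measurable (restrict_space lborel \<Omega>)"
    and a: "0 < a" and \<rho>: "\<And>y. y \<in> \<Omega> \<Longrightarrow> a \<le> \<rho> y" "\<And>y. y \<in> \<Omega> \<Longrightarrow> \<rho> y \<le> b"
    and n: "1 \<le> n"
    and meas_T: "T \<in> measurable (restrict_space lborel \<Omega>) borel"
    and T: "\<And>y. y \<in> \<Omega> \<Longrightarrow> T y \<in> point_cloud x n"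
    and push: "distr (density_measure \<Omega> \<rho>) borel T = empirical_measure x n"
begin

text \<open>An arbitrary \<open>g\<close> need not be measurable, but \<open>cut g\<close> is and agrees with \<open>g\<close> on the cloud.\<close>

definition cut :: "('a \<Rightarrow> real) \<Rightarrow> 'a \<Rightarrow> real" where
  "cut g z = (\<Sum>p\<in>point_cloud x n. g p * indicator {p} z)"

lemma finite_cloud: "finite (point_cloud x n)"
  by (simp add: point_cloud_def)

lemma cut_eq: "z \<in> point_cloud x n \<Longrightarrow> cut g z = g z"
proof -
  assume z: "z \<in> point_cloud x n"
  have "cut g z = (\<Sum>p\<in>point_cloud x n. if p = z then g p else 0)"
    unfolding cut_def by (intro sum.cong) (auto split: split_indicator)
  then show ?thesis using z finite_cloud by simp
qed

lemma x_cloud: "j \<in> {1..n} \<Longrightarrow> x j \<in> point_cloud x n"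
  by (simp add: point_cloud_def)

lemma cut_measurable [measurable]: "cut g \<in> borel_measurable borel"
  unfolding cut_def[abs_def] by measurable

text \<open>Information on \<open>T\<close> is confined to \<Omega>, where it takes finitely many
  values. Composition with any \<open>g\<close> is therefore measurable once it is cut off by the
  indicator.\<close>

lemma comp_measurable: "(\<lambda>y. indicator \<Omega> y * g (T y)) \<in> borel_measurable borel" for g :: "'a \<Rightarrow> real"
proof -
  have "(\<lambda>y. cut g (T y)) \<in> borel_measurable (restrict_space lborel \<Omega>)"
    using meas_T by measurable
  then have "(\<lambda>y. cut g (T y) * indicator \<Omega> y) \<in> borel_measurable lborel"
    by (subst (asm) borel_measurable_restrict_space_iff) (auto simp: mult.commute)
  moreover have "(\<lambda>y. cut g (T y) * indicator \<Omega> y) = (\<lambda>y. indicator \<Omega> y * g (T y))"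
    using T by (auto simp: cut_eq split: split_indicator)
  ultimately show ?thesis by simp
qed

text \<open>The empirical measure is itself an image, of the uniform measure on the indices, so the
  transformation formula is applied to both descriptions of it.\<close>

lemma nn_integral_cloud:
  assumes "\<And>z. 0 \<le> g z"
  shows "(\<integral>\<^sup>+y. indicator \<Omega> y * ennreal (\<rho> y * g (T y)) \<partial>lborel) = ennreal (avg n (\<lambda>j. g (x j)))"
proof -
  have cn: "0 \<le> cut g z" for z unfolding cut_def using assms by (intro sum_nonneg) auto
  have "(\<integral>\<^sup>+z. ennreal (cut g z) \<partial>empirical_measure x n)
      = (\<integral>\<^sup>+j. ennreal (cut g (x j)) \<partial>uniform_count_measure {1..n})"
  proof -
    have "x \<in> measurable (uniform_count_measure {1..n}) borel"
      by (auto simp: measurable_def sets_uniform_count_measure space_uniform_count_measure)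
    moreover have "(\<lambda>z. ennreal (cut g z)) \<in> borel_measurable borel"
      using cut_measurable[of g] by measurable
    ultimately show ?thesis by (simp add: nn_integral_distr empirical_measure_def)
  qed
  also have "\<dots> = (\<Sum>j\<in>{1..n}. ennreal (1 / real n) * ennreal (cut g (x j)))"
    unfolding uniform_count_measure_def by (subst nn_integral_point_measure_finite) auto
  also have "\<dots> = (\<Sum>j\<in>{1..n}. ennreal (g (x j) / real n))"
    using assms by (intro sum.cong) (auto simp: cut_eq x_cloud ennreal_mult[symmetric])
  also have "\<dots> = ennreal (avg n (\<lambda>j. g (x j)))"
    using assms by (simp add: avg_def sum_divide_distrib)
  finally have "ennreal (avg n (\<lambda>j. g (x j)))
      = (\<integral>\<^sup>+z. ennreal (cut g z) \<partial>distr (density_measure \<Omega> \<rho>) borel T)"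
    by (simp add: push)
  also have "\<dots> = (\<integral>\<^sup>+y. ennreal (cut g (T y)) \<partial>density_measure \<Omega> \<rho>)"
    using meas_T unfolding density_measure_def by (intro nn_integral_distr) auto
  also have "\<dots> = (\<integral>\<^sup>+y. ennreal (\<rho> y) * ennreal (cut g (T y)) \<partial>restrict_space lborel \<Omega>)"
    unfolding density_measure_def
    by (intro nn_integral_density measurable_compose[OF meas_\<rho> measurable_ennreal]
        measurable_compose[OF meas_T measurable_compose[OF cut_measurable measurable_ennreal]])
  also have "\<dots> = (\<integral>\<^sup>+y. ennreal (\<rho> y) * ennreal (cut g (T y)) * indicator \<Omega> y \<partial>lborel)"
    by (intro nn_integral_restrict_space) simp
  also have "\<dots> = (\<integral>\<^sup>+y. indicator \<Omega> y * ennreal (\<rho> y * g (T y)) \<partial>lborel)"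
    using assms by (intro nn_integral_cong) (auto simp: cut_eq T ennreal_mult'' mult.commute split: split_indicator)
  finally show ?thesis by simp
qed

section \<open>Integrals over the domain and averages over the sample\<close>

abbreviation nnint :: "('a \<Rightarrow> real) \<Rightarrow> ennreal" where
  "nnint g \<equiv> \<integral>\<^sup>+y. indicator \<Omega> y * ennreal (g (T y)) \<partial>lborel"

abbreviation pair_nnint :: "('a \<Rightarrow> 'a \<Rightarrow> real) \<Rightarrow> ennreal" where
  "pair_nnint g \<equiv> \<integral>\<^sup>+y. \<integral>\<^sup>+z. indicator \<Omega> y * indicator \<Omega> z * ennreal (g y z) \<partial>lborel \<partial>lborel"

lemma nn_integral_cloud_bounds:
  assumes "\<And>z. 0 \<le> g z"
  shows "ennreal a * nnint g
      \<le> ennreal (avg n (\<lambda>j. g (x j)))"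
    and "ennreal (avg n (\<lambda>j. g (x j)))
        \<le> ennreal b * nnint g"
proof -
  have eq: "indicator \<Omega> y * ennreal (g (T y)) = ennreal (indicator \<Omega> y * g (T y))" for y
    by (auto split: split_indicator)
  have m: "(\<lambda>y. indicator \<Omega> y * ennreal (g (T y))) \<in> borel_measurable lborel"
    unfolding eq using comp_measurable[of g] by simp
  have "ennreal a * nnint g
     = (\<integral>\<^sup>+y. ennreal a * (indicator \<Omega> y * ennreal (g (T y))) \<partial>lborel)"
    using m by (simp add: nn_integral_cmult)
  also have "\<dots> \<le> (\<integral>\<^sup>+y. indicator \<Omega> y * ennreal (\<rho> y * g (T y)) \<partial>lborel)"
    using \<rho> a assms by (intro nn_integral_mono)
      (auto simp: ennreal_mult[symmetric] mult_right_mono ennreal_leI split: split_indicator)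
  finally show "ennreal a * nnint g
      \<le> ennreal (avg n (\<lambda>j. g (x j)))"
    by (simp add: nn_integral_cloud assms)
  have "(\<integral>\<^sup>+y. indicator \<Omega> y * ennreal (\<rho> y * g (T y)) \<partial>lborel)
     \<le> (\<integral>\<^sup>+y. ennreal b * (indicator \<Omega> y * ennreal (g (T y))) \<partial>lborel)"
  proof (intro nn_integral_mono)
    fix y
    show "indicator \<Omega> y * ennreal (\<rho> y * g (T y)) \<le> ennreal b * (indicator \<Omega> y * ennreal (g (T y)))"
    proof (cases "y \<in> \<Omega>")
      case True
      then have "0 \<le> b" using \<rho>[OF True] a by linarith
      then show ?thesis using True \<rho>(2)[OF True] assms
        by (simp add: ennreal_mult[symmetric] mult_right_mono ennreal_leI)
    qed simp
  qed
  also have "\<dots> = ennreal b * nnint g"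
    using m by (simp add: nn_integral_cmult)
  finally show "ennreal (avg n (\<lambda>j. g (x j)))
      \<le> ennreal b * nnint g"
    by (simp add: nn_integral_cloud assms)
qed

text \<open>A nonpositive \<open>b\<close> becomes 0 in \<open>ennreal\<close>, and the upper bound
  for g = 1 would contradict the total mass 1 of the empirical measure.\<close>

lemma b_pos: "0 < b"
proof -
  have "ennreal 1 \<le> ennreal b * (\<integral>\<^sup>+y. indicator \<Omega> y * ennreal 1 \<partial>lborel)"
    using nn_integral_cloud_bounds(2)[of "\<lambda>_. 1"] n by (simp add: avg_const)
  then have "ennreal b \<noteq> 0" by (intro notI) simp
  then show ?thesis by (simp add: ennreal_eq_0_iff not_le)
qed

lemma nn_integral_cloud_le:
  assumes "\<And>z. 0 \<le> g z"
  shows "nnint g \<le> ennreal (avg n (\<lambda>j. g (x j)) / a)"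
proof -
  have "nnint g
     = ennreal (1 / a) * (ennreal a * nnint g)"
    using a by (simp add: mult.assoc[symmetric] ennreal_mult[symmetric])
  also have "\<dots> \<le> ennreal (1 / a) * ennreal (avg n (\<lambda>j. g (x j)))"
    by (intro mult_left_mono nn_integral_cloud_bounds assms) simp
  also have "\<dots> = ennreal (avg n (\<lambda>j. g (x j)) / a)"
    using a assms by (simp add: ennreal_mult[symmetric] avg_nonneg)
  finally show ?thesis .
qed

text \<open>The bound by an average makes the nonnegative integral finite, so the Bochner integral
  is not the default value 0 of a non-integrable function.\<close>

lemma LINT_cloud:
  assumes "\<And>z. 0 \<le> g z"
  shows "ennreal (LINT y:\<Omega>|lborel. g (T y)) = nnint g"
proof -
  have eq: "indicator \<Omega> y * ennreal (g (T y)) = ennreal (indicator \<Omega> y * g (T y))" for y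
    by (auto split: split_indicator)
  have "(\<integral>\<^sup>+y. ennreal (indicator \<Omega> y * g (T y)) \<partial>lborel) < \<infinity>"
    using nn_integral_cloud_le[of g] assms unfolding eq by (auto intro: le_less_trans)
  then have "integrable lborel (\<lambda>y. indicator \<Omega> y * g (T y))"
    using assms comp_measurable[of g] by (intro integrableI_nonneg) auto
  then show ?thesis
    unfolding eq set_lebesgue_integral_def using assms
    by (subst nn_integral_eq_integral) auto
qed

lemma LINT_cloud_bounds:
  assumes "\<And>z. 0 \<le> g z"
  shows "(LINT y:\<Omega>|lborel. g (T y)) \<le> avg n (\<lambda>j. g (x j)) / a"
    and "avg n (\<lambda>j. g (x j)) \<le> b * (LINT y:\<Omega>|lborel. g (T y))"
    and "0 \<le> (LINT y:\<Omega>|lborel. g (T y))"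
proof -
  show nn: "0 \<le> (LINT y:\<Omega>|lborel. g (T y))"
    unfolding set_lebesgue_integral_def using assms by (intro integral_nonneg_AE) auto
  show "(LINT y:\<Omega>|lborel. g (T y)) \<le> avg n (\<lambda>j. g (x j)) / a"
  proof -
    have "ennreal (LINT y:\<Omega>|lborel. g (T y)) \<le> ennreal (avg n (\<lambda>j. g (x j)) / a)"
      unfolding LINT_cloud[of g, OF assms] by (intro nn_integral_cloud_le assms)
    moreover have "0 \<le> avg n (\<lambda>j. g (x j)) / a" using assms a by (simp add: avg_nonneg)
    ultimately show ?thesis using ennreal_le_iff by blast
  qed
  show "avg n (\<lambda>j. g (x j)) \<le> b * (LINT y:\<Omega>|lborel. g (T y))"
  proof -
    have "ennreal (avg n (\<lambda>j. g (x j))) \<le> ennreal b * ennreal (LINT y:\<Omega>|lborel. g (T y))"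
      unfolding LINT_cloud[of g, OF assms] by (intro nn_integral_cloud_bounds assms)
    also have "\<dots> = ennreal (b * (LINT y:\<Omega>|lborel. g (T y)))"
      using b_pos nn by (simp add: ennreal_mult)
    finally show ?thesis using b_pos nn by (subst (asm) ennreal_le_iff) auto
  qed
qed

lemma nn_integral_cloud_pair:
  assumes "\<And>z z'. 0 \<le> F z z'"
  shows "(\<integral>\<^sup>+y. (\<integral>\<^sup>+y'. indicator \<Omega> y * indicator \<Omega> y' * ennreal (F (T y) (T y')) \<partial>lborel) \<partial>lborel)
     \<le> ennreal (avg n (\<lambda>i. avg n (\<lambda>j. F (x i) (x j))) / a\<^sup>2)"
proof -
  define G where "G z = avg n (\<lambda>j. F z (x j)) / a" for z
  have G: "0 \<le> G z" for z using assms a by (simp add: G_def avg_nonneg)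
  have "(\<integral>\<^sup>+y. (\<integral>\<^sup>+y'. indicator \<Omega> y * indicator \<Omega> y' * ennreal (F (T y) (T y')) \<partial>lborel) \<partial>lborel)
     \<le> (\<integral>\<^sup>+y. indicator \<Omega> y * ennreal (G (T y)) \<partial>lborel)"
  proof (intro nn_integral_mono)
    fix y
    show "(\<integral>\<^sup>+y'. indicator \<Omega> y * indicator \<Omega> y' * ennreal (F (T y) (T y')) \<partial>lborel)
        \<le> indicator \<Omega> y * ennreal (G (T y))"
    proof (cases "y \<in> \<Omega>")
      case True
      then show ?thesis using nn_integral_cloud_le[of "F (T y)"] assms by (simp add: G_def)
    qed simp
  qed
  also have "\<dots> \<le> ennreal (avg n (\<lambda>i. G (x i)) / a)"
    by (intro nn_integral_cloud_le G)
  also have "avg n (\<lambda>i. G (x i)) / a = avg n (\<lambda>i. avg n (\<lambda>j. F (x i) (x j))) / a\<^sup>2"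
    using avg_cmult[of n "1 / a" "\<lambda>i. avg n (\<lambda>j. F (x i) (x j))"]
        by (simp add: G_def power2_eq_square)
  finally show ?thesis .
qed

text \<open>A sample point has empirical mass at least 1 / n, hence its preimage under
  \<open>T\<close> cannot be a null set. Statements that hold almost everywhere on \<Omega> thus
  reach every sample point.\<close>

lemma point_has_mass:
  assumes "i \<in> {1..n}"
  shows "\<not> (AE y in lborel. y \<in> \<Omega> \<longrightarrow> T y \<noteq> x i)"
proof
  assume ae: "AE y in lborel. y \<in> \<Omega> \<longrightarrow> T y \<noteq> x i"
  have "ennreal (avg n (\<lambda>j. indicator {x i} (x j))) \<le>
      ennreal b * (\<integral>\<^sup>+y. indicator \<Omega> y * ennreal (indicator {x i} (T y)) \<partial>lborel)"
    by (intro nn_integral_cloud_bounds) auto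
  also have "(\<integral>\<^sup>+y. indicator \<Omega> y * ennreal (indicator {x i} (T y)) \<partial>lborel)
      = (\<integral>\<^sup>+y. 0 \<partial>(lborel :: 'a measure))"
    using ae by (intro nn_integral_cong_AE) (auto split: split_indicator)
  finally have "avg n (\<lambda>j. indicator {x i} (x j)) \<le> 0" by (simp add: ennreal_eq_0_iff)
  moreover have "1 \<le> real n * avg n (\<lambda>j. indicator {x i} (x j))"
    using le_avg[of n "\<lambda>j. indicator {x i} (x j)" i] assms by simp
  moreover have "real n * avg n (\<lambda>j. indicator {x i} (x j)) \<le> 0"
    using calculation(1) by (simp add: mult_nonneg_nonpos)
  ultimately show False by linarith
qed

text \<open>No sample point is lost in the essential supremum, since its preimage under
  \<open>T\<close> is not a null set.\<close>

lemma Linf_norm_cloud: "Linf_norm \<Omega> (f \<circ> T) = ereal (Max ((\<lambda>i. \<bar>f (x i)\<bar>) ` {1..n}))"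
    for f :: "'a \<Rightarrow> real"
proof (rule antisym)
  let ?M = "restrict_space lborel \<Omega>"
  have ne: "(\<lambda>i. \<bar>f (x i)\<bar>) ` {1..n} \<noteq> {}" using n by auto
  have "(\<lambda>y. cut f (T y)) \<in> borel_measurable ?M" using meas_T by measurable
  then have m: "(\<lambda>y. f (T y)) \<in> borel_measurable ?M"
    by (subst measurable_cong[where g = "\<lambda>y. cut f (T y)"]) (auto simp: space_restrict_space cut_eq T)
  have "AE y in ?M. ereal (norm ((f \<circ> T) y)) \<le> ereal (Max ((\<lambda>i. \<bar>f (x i)\<bar>) ` {1..n}))"
  proof (intro AE_I2)
    fix y assume "y \<in> space ?M"
    then have "y \<in> \<Omega>" by (simp add: space_restrict_space)
    from T[OF this] obtain i where "i \<in> {1..n}" "T y = x i" by (auto simp: point_cloud_def)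
    then show "ereal (norm ((f \<circ> T) y)) \<le> ereal (Max ((\<lambda>i. \<bar>f (x i)\<bar>) ` {1..n}))" by simp
  qed
  then show "Linf_norm \<Omega> (f \<circ> T) \<le> ereal (Max ((\<lambda>i. \<bar>f (x i)\<bar>) ` {1..n}))"
    unfolding Linf_norm_def using m by (intro esssup_I) (auto simp: comp_def)
  obtain i where i: "i \<in> {1..n}" "Max ((\<lambda>i. \<bar>f (x i)\<bar>) ` {1..n}) = \<bar>f (x i)\<bar>"
    using Max_in[OF _ ne] by auto
  have "AE y in ?M. ereal (norm ((f \<circ> T) y)) \<le> Linf_norm \<Omega> (f \<circ> T)"
    unfolding Linf_norm_def by (rule esssup_AE)
  then have ae: "AE y in lborel. y \<in> \<Omega> \<longrightarrow> ereal (norm ((f \<circ> T) y)) \<le> Linf_norm \<Omega> (f \<circ> T)"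
    by (subst (asm) AE_restrict_space_iff) auto
  show "ereal (Max ((\<lambda>i. \<bar>f (x i)\<bar>) ` {1..n})) \<le> Linf_norm \<Omega> (f \<circ> T)"
  proof (rule ccontr)
    assume neg: "\<not> ?thesis"
    have "AE y in lborel. y \<in> \<Omega> \<longrightarrow> T y \<noteq> x i"
      using ae by eventually_elim (use neg i in auto)
    then show False using point_has_mass[OF i(1)] by blast
  qed
qed

end

section \<open>Energy estimates on weighted graphs\<close>

text \<open>The odd power of exponent s + 1. The test function of the equation has s = q - 2, the
  function in the energy s = (q - 2) / 2. For s < 0 the value at 0 is still 0.\<close>

definition signed_powr :: "real \<Rightarrow> real \<Rightarrow> real" where
  "signed_powr s a = \<bar>a\<bar> powr s * a"

section \<open>Odd powers and the pointwise inequalities for test functions\<close>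

lemma signed_powr_minus [simp]: "signed_powr s (- a) = - signed_powr s a"
  by (simp add: signed_powr_def)

lemma signed_powr_nonneg: "0 \<le> a \<Longrightarrow> signed_powr s a = a powr (s + 1)"
  by (cases "a = 0") (simp_all add: signed_powr_def powr_add)

lemma abs_signed_powr: "\<bar>signed_powr s a\<bar> = \<bar>a\<bar> powr (s + 1)"
  by (cases "a = 0") (simp_all add: signed_powr_def powr_add abs_mult)

text \<open>A rule for inequalities between differences of odd functions: they are invariant under
  swapping and under a joint change of sign, so two nonnegative ordered numbers and two numbers of
  opposite sign remain.\<close>

lemma signed_pair_cases:
  fixes P :: "real \<Rightarrow> real \<Rightarrow> bool"
  assumes "\<And>a b. 0 \<le> b \<Longrightarrow> b \<le> a \<Longrightarrow> P a b" "\<And>a c. 0 \<le> a \<Longrightarrow> 0 \<le> c \<Longrightarrow> P a (- c)"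
    and "\<And>a b. P a b \<Longrightarrow> P b a" "\<And>a b. P a b \<Longrightarrow> P (- a) (- b)"
  shows "P a b"
proof -
  consider "0 \<le> b" "b \<le> a" | "0 \<le> a" "a \<le> b" | "0 \<le> a" "b \<le> 0" | "a \<le> 0" "0 \<le> b"
    | "b \<le> a" "a \<le> 0" | "a \<le> b" "b \<le> 0" by linarith
  then show ?thesis
  proof cases
    case 3 then show ?thesis using assms(2)[of a "- b"] by simp
  next
    case 4 then show ?thesis using assms(3)[OF assms(2)[of b "- a"]] by simp
  next
    case 5 then show ?thesis using assms(4)[OF assms(3)[OF assms(1)[of "- a" "- b"]]] by simp
  next
    case 6 then show ?thesis using assms(4)[OF assms(1)[of "- b" "- a"]] by simp
  qed (use assms in auto)
qed

text \<open>The Stroock-Varopoulos inequality with a constant linear in \<open>q\<close>; this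
  growth fixes r^2 ~ 1/q in the iteration. Equal signs use the tangent at the larger number,
  opposite signs (s + t)^2 \<le> 2 (s^2 + t^2).\<close>

lemma signed_powr_test_ge2:
  assumes "2 \<le> q"
  shows "(signed_powr ((q - 2) / 2) a - signed_powr ((q - 2) / 2) b)\<^sup>2
     \<le> q * ((a - b) * (signed_powr (q - 2) a - signed_powr (q - 2) b))"
proof -
  define m where "m = q / 2"
  have m: "1 \<le> m" using assms by (simp add: m_def)
  have e: "(q - 2) / 2 + 1 = m" "q - 2 + 1 = q - 1" "2 * m = q" by (auto simp: m_def field_simps)
  show ?thesis
  proof (induction a b rule: signed_pair_cases)
    case (1 a b)
    have "(a powr m - b powr m)\<^sup>2 \<le> 2 * m * ((a - b) * (a powr (2 * m - 1) - b powr (2 * m - 1)))"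
    proof (cases "a = 0")
      case False
      then have a: "0 < a" using 1 by simp
      have "a powr m - b powr m \<le> m * a powr (m - 1) * (a - b)"
        using powr_above_tangent[OF m 1(1) a] by (simp add: algebra_simps)
      moreover have mono: "0 \<le> a powr m - b powr m" using 1 m by (simp add: powr_mono2)
      ultimately have "(a powr m - b powr m)\<^sup>2
          \<le> m * a powr (m - 1) * (a - b) * (a powr m - b powr m)"
        unfolding power2_eq_square by (intro mult_right_mono)
      also have "\<dots> = m * (a - b) * (a powr (m - 1) * (a powr m - b powr m))" by simp
      also have "\<dots> \<le> m * (a - b) * (a powr (2 * m - 1) - b powr (2 * m - 1))"
      proof (intro mult_left_mono)
        have "b powr (2 * m - 1) = b powr m * b powr (m - 1)"
          by (simp add: powr_add[symmetric])
        also have "\<dots> \<le> b powr m * a powr (m - 1)" using 1 m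
            by (intro mult_left_mono powr_mono2) auto
        finally have "b powr (2 * m - 1) \<le> b powr m * a powr (m - 1)" .
        moreover have "a powr (2 * m - 1) = a powr m * a powr (m - 1)"
          by (simp add: powr_add[symmetric])
        ultimately show "a powr (m - 1) * (a powr m - b powr m)
            \<le> a powr (2 * m - 1) - b powr (2 * m - 1)"
          by (simp add: algebra_simps)
      qed (use 1 m in auto)
      also have "\<dots> \<le> 2 * m * (a - b) * (a powr (2 * m - 1) - b powr (2 * m - 1))"
        using 1 m by (intro mult_right_mono) (auto intro: powr_mono2)
      finally show ?thesis by (simp add: mult.assoc)
    qed (use 1 in auto)
    then show ?case using 1 by (simp add: signed_powr_nonneg e)
  next
    case (2 a c)
    have "(a powr m + c powr m)\<^sup>2 \<le> 2 * ((a powr m)\<^sup>2 + (c powr m)\<^sup>2)"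
      using sum_squares_bound[of "a powr m" "c powr m"] by (simp add: power2_sum algebra_simps)
    also have "(a powr m)\<^sup>2 + (c powr m)\<^sup>2 = a * a powr (2 * m - 1) + c * c powr (2 * m - 1)"
      using 2 by (simp add: powr_mult_base power2_eq_square powr_add[symmetric])
    also have "\<dots> \<le> (a + c) * (a powr (2 * m - 1) + c powr (2 * m - 1))"
      using 2 by (simp add: algebra_simps)
    also have "2 * \<dots> \<le> 2 * m * \<dots>"
      using m 2 by (intro mult_right_mono) auto
    finally show ?case using 2 by (simp add: signed_powr_nonneg e)
  next
    case (3 a b)
    have "(signed_powr ((q - 2) / 2) b - signed_powr ((q - 2) / 2) a)\<^sup>2
        = (signed_powr ((q - 2) / 2) a - signed_powr ((q - 2) / 2) b)\<^sup>2"
      by (rule power2_commute)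
    then show ?case using 3 by (simp add: algebra_simps)
  next
    case (4 a b)
    have "(- signed_powr ((q - 2) / 2) a - - signed_powr ((q - 2) / 2) b)\<^sup>2
        = (signed_powr ((q - 2) / 2) a - signed_powr ((q - 2) / 2) b)\<^sup>2"
      by (simp add: power2_eq_square algebra_simps)
    then show ?case using 4 by (simp add: algebra_simps)
  qed
qed

text \<open>Young's inequality for b^p a^(1-p), divided by a^(1-p).\<close>

lemma powr_below_tangent:
  fixes a b p :: real
  assumes "0 < p" "p < 1" "0 < a" "0 \<le> b"
  shows "b powr p \<le> a powr p + p * a powr (p - 1) * (b - a)"
proof (cases "b = 0")
  case True
  have "a powr p = a powr (p - 1) * a" using assms by (simp add: powr_mult_base mult.commute)
  then have "a powr p + p * a powr (p - 1) * (b - a) = (1 - p) * a powr p" using True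
      by (simp add: algebra_simps)
  then show ?thesis using True assms by simp
next
  case False
  have "b powr p * a powr (1 - p) \<le> p * b + (1 - p) * a"
    using assms False by (intro Youngs_inequality_0) auto
  then have "a powr (p - 1) * (b powr p * a powr (1 - p)) \<le> a powr (p - 1) * (p * b + (1 - p) * a)"
    by (intro mult_left_mono) auto
  moreover have "a powr (p - 1) * a powr (1 - p) = 1" using assms by (simp add: powr_add[symmetric])
  then have "a powr (p - 1) * (b powr p * a powr (1 - p)) = b powr p"
      by (simp add: mult.left_commute)
  moreover have "a powr (p - 1) * a = a powr p" using assms
      by (simp add: powr_mult_base mult.commute)
  then have "a powr (p - 1) * (p * b + (1 - p) * a) = a powr p + p * a powr (p - 1) * (b - a)"
    by (simp add: algebra_simps)
  ultimately show ?thesis by simp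
qed

text \<open>Concavity of t^(q-1): for equal signs the tangent at the larger number gives the factor
  a^(q-2), which dominates (a + b)^(q-2) because the exponent is negative.\<close>

lemma signed_powr_test_lt2:
  assumes "1 < q" "q < 2"
  shows "(q - 1) * ((a - b)\<^sup>2 * (\<bar>a\<bar> + \<bar>b\<bar>) powr (q - 2))
     \<le> (a - b) * (signed_powr (q - 2) a - signed_powr (q - 2) b)"
proof (induction a b rule: signed_pair_cases)
  case (1 a b)
  show ?case
  proof (cases "a = 0")
    case False
    then have a: "0 < a" using 1 by simp
    have "(a + b) powr (q - 2) \<le> a powr (q - 2)"
      using a 1 assms by (intro powr_mono2') auto
    then have "(q - 1) * (a + b) powr (q - 2) * (a - b) \<le> (q - 1) * a powr (q - 2) * (a - b)"
      using 1 assms by (intro mult_right_mono mult_left_mono) auto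
    also have "\<dots> \<le> a powr (q - 1) - b powr (q - 1)"
      using powr_below_tangent[of "q - 1" a b] assms a 1 by (simp add: algebra_simps)
    finally have "(a - b) * ((q - 1) * (a + b) powr (q - 2) * (a - b))
        \<le> (a - b) * (a powr (q - 1) - b powr (q - 1))"
      using 1 by (intro mult_left_mono) auto
    then show ?thesis using 1 a by (simp add: signed_powr_nonneg power2_eq_square mult_ac)
  qed (use 1 in auto)
next
  case (2 a c)
  have *: "(a + c) powr (q - 2) * y \<le> y powr (q - 1)" if "0 \<le> y" "y \<le> a + c" for y
  proof (cases "y = 0")
    case False
    then have "(a + c) powr (q - 2) * y \<le> y powr (q - 2) * y"
      using that assms by (intro mult_right_mono powr_mono2') auto
    also have "\<dots> = y powr (q - 1)" using False that by (simp add: powr_mult_base mult.commute)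
    finally show ?thesis .
  qed simp
  have "(q - 1) * ((a + c) powr (q - 2) * (a + c)) \<le> 1 * ((a + c) powr (q - 2) * (a + c))"
    using assms 2 by (intro mult_right_mono) auto
  also have "\<dots> \<le> a powr (q - 1) + c powr (q - 1)" using *[of a] *[of c] 2
      by (simp add: algebra_simps)
  finally have "(a + c) * ((q - 1) * ((a + c) powr (q - 2) * (a + c)))
      \<le> (a + c) * (a powr (q - 1) + c powr (q - 1))"
    using 2 by (intro mult_left_mono) auto
  then show ?case using 2 by (simp add: signed_powr_nonneg power2_eq_square mult_ac)
next
  case (3 a b)
  then show ?case by (simp add: power2_commute[of b a] add.commute algebra_simps)
next
  case (4 a b)
  then show ?case by (simp add: power2_eq_square algebra_simps)
qed

text \<open>Young's inequality up to constants, by comparing t with \<delta> s: in either case one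
  factor is replaced by the other.\<close>

lemma Young_split:
  fixes s t \<delta> q :: real
  assumes "1 \<le> q" "0 < \<delta>" "0 \<le> s" "0 \<le> t"
  shows "s powr (q - 1) * t \<le> \<delta> * s powr q + \<delta> powr (1 - q) * t powr q"
proof (cases "t \<le> \<delta> * s")
  case True
  then have "s powr (q - 1) * t \<le> s powr (q - 1) * (\<delta> * s)" by (intro mult_left_mono) auto
  also have "\<dots> = \<delta> * s powr q" using assms by (simp add: powr_mult_base mult_ac)
  finally show ?thesis by (simp add: add_increasing2)
next
  case False
  then have st: "s \<le> t / \<delta>" using assms by (simp add: field_simps)
  have "s powr (q - 1) * t \<le> (t / \<delta>) powr (q - 1) * t"
    using st assms by (intro mult_right_mono powr_mono2) auto
  also have "(t / \<delta>) powr (q - 1) = t powr (q - 1) * \<delta> powr (1 - q)"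
    using assms using powr_minus_divide[of \<delta> "q - 1"] by (simp add: powr_divide)
  also have "t powr (q - 1) * \<delta> powr (1 - q) * t = \<delta> powr (1 - q) * t powr q"
    using assms by (simp add: powr_mult_base mult_ac)
  finally show ?thesis using assms by (simp add: add_increasing)
qed

lemma powr_add_le:
  fixes s t q :: real
  assumes "0 \<le> q" "0 \<le> s" "0 \<le> t"
  shows "(s + t) powr q \<le> 2 powr q * (s powr q + t powr q)"
proof -
  have "(s + t) powr q \<le> (2 * max s t) powr q" using assms by (intro powr_mono2) auto
  also have "\<dots> = 2 powr q * max s t powr q" using assms by (simp add: powr_mult)
  also have "max s t powr q \<le> s powr q + t powr q" by (auto simp: max_def)
  finally show ?thesis by simp
qed

text \<open>The constant of \<open>estimate_ge2\<close>; 1 / (4 q C) is the Young parameter \<delta>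
  there. A closed formula shows that neither n nor \<epsilon> enters.\<close>

definition bound_ge2 :: "real \<Rightarrow> real \<Rightarrow> real" where
  "bound_ge2 q C = 2 * C + 1 + 4 * q * (C + 1) * (1 / (4 * q * C)) powr (1 - q)"

lemma bound_ge2_pos: "2 \<le> q \<Longrightarrow> 0 < C \<Longrightarrow> 0 < bound_ge2 q C"
  unfolding bound_ge2_def by (intro add_pos_nonneg) auto

text \<open>The constant of \<open>estimate_lt2\<close>: \<tau> is the threshold at which pairs are
  split, chosen so that 8 D \<tau>^q = 1 / (4 C); \<open>L\<close> is the factor in front of the
  tested equation and 1 / (4 L C) the Young parameter.\<close>

definition bound_lt2 :: "real \<Rightarrow> real \<Rightarrow> real \<Rightarrow> real" where
  "bound_lt2 q C D = (let \<tau> = (1 / (32 * D * C)) powr (1 / q); L = 2 * \<tau> powr (q - 2) / (q - 1)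
     in 2 * C + 1 + 2 * (C + 1) * (L * (1 / (4 * L * C)) powr (1 - q)))"

lemma bound_lt2_pos: "1 < q \<Longrightarrow> 0 < C \<Longrightarrow> 0 < bound_lt2 q C D"
  unfolding bound_lt2_def Let_def by (intro add_pos_nonneg) auto

section \<open>Testing the equation on a symmetric weighted graph\<close>

locale weighted_graph =
  fixes n :: nat and K :: "nat \<Rightarrow> nat \<Rightarrow> real" and \<epsilon> :: real
  assumes n: "1 \<le> n" and K_sym: "\<And>i j. K i j = K j i" and K_nonneg: "\<And>i j. 0 \<le> K i j" and \<epsilon>: "0 < \<epsilon>"
begin

text \<open>The sign is that of - \<Delta>, so the operator is nonnegative and the Poisson equation
  reads lap u = h.\<close>

definition lap :: "(nat \<Rightarrow> real) \<Rightarrow> nat \<Rightarrow> real" where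
  "lap u i = avg n (\<lambda>j. K i j * (u i - u j)) / \<epsilon>\<^sup>2"

definition energy :: "real \<Rightarrow> (nat \<Rightarrow> real) \<Rightarrow> real" where
  "energy q f = avg n (\<lambda>i. avg n (\<lambda>j. K i j * (\<bar>f j - f i\<bar> / \<epsilon>) powr q))"

lemma energy_nonneg: "0 \<le> energy q f"
  unfolding energy_def by (intro avg_nonneg mult_nonneg_nonneg K_nonneg) auto

text \<open>Summation by parts: exchanging i and j, together with the symmetry of \<open>K\<close>,
  turns one half of the double sum into the other.\<close>

lemma green_identity: "avg n (\<lambda>i. avg n (\<lambda>j. K i j * ((u i - u j) * (f i - f j))))
    = 2 * \<epsilon>\<^sup>2 * avg n (\<lambda>i. f i * lap u i)"
proof -
  define X where "X = avg n (\<lambda>i. avg n (\<lambda>j. K i j * (u i - u j) * f i))"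
  have X: "\<epsilon>\<^sup>2 * avg n (\<lambda>i. f i * lap u i) = X"
  proof -
    have "\<epsilon>\<^sup>2 * (f i * lap u i) = avg n (\<lambda>j. K i j * (u i - u j) * f i)" for i
      using \<epsilon> avg_cmult[of n "f i" "\<lambda>j. K i j * (u i - u j)"] by (simp add: lap_def mult_ac)
    then show ?thesis by (simp add: X_def avg_cmult[symmetric])
  qed
  have "X = avg n (\<lambda>i. avg n (\<lambda>j. K j i * (u j - u i) * f j))"
    unfolding X_def by (rule avg_swap)
  also have "\<dots> = avg n (\<lambda>i. avg n (\<lambda>j. - 1 * (K i j * (u i - u j) * f j)))"
  proof -
    have "K j i * (u j - u i) * f j = - 1 * (K i j * (u i - u j) * f j)" for i j
      unfolding K_sym[of j i] by (simp add: algebra_simps)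
    then show ?thesis by simp
  qed
  finally have "X + X = avg n (\<lambda>i. avg n (\<lambda>j. K i j * (u i - u j) * f i))
      + avg n (\<lambda>i. avg n (\<lambda>j. - 1 * (K i j * (u i - u j) * f j)))"
    by (simp only: X_def[symmetric])
  also have "\<dots> = avg n (\<lambda>i. avg n (\<lambda>j. K i j * ((u i - u j) * (f i - f j))))"
    unfolding avg_add[symmetric] by (simp add: algebra_simps)
  finally show ?thesis using X by simp
qed

lemma test_signed_powr:
  assumes "1 < q" "0 < \<delta>"
  shows "avg n (\<lambda>i. signed_powr (q - 2) (u i) * lap u i)
     \<le> \<delta> * avg n (\<lambda>i. \<bar>u i\<bar> powr q) + \<delta> powr (1 - q) * avg n (\<lambda>i. \<bar>lap u i\<bar> powr q)"
proof -
  have "signed_powr (q - 2) (u i) * lap u i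
      \<le> \<delta> * \<bar>u i\<bar> powr q + \<delta> powr (1 - q) * \<bar>lap u i\<bar> powr q" for i
  proof -
    have "signed_powr (q - 2) (u i) * lap u i \<le> \<bar>signed_powr (q - 2) (u i) * lap u i\<bar>" by simp
    also have "\<dots> = \<bar>u i\<bar> powr (q - 1) * \<bar>lap u i\<bar>" by (simp add: abs_mult abs_signed_powr)
    also have "\<dots> \<le> \<delta> * \<bar>u i\<bar> powr q + \<delta> powr (1 - q) * \<bar>lap u i\<bar> powr q"
      using assms by (intro Young_split) auto
    finally show ?thesis .
  qed
  then show ?thesis unfolding avg_cmult[symmetric] avg_add[symmetric] by (intro avg_mono)
qed

lemma energy_test_ge2:
  assumes "2 \<le> q"
  shows "energy 2 (\<lambda>i. signed_powr ((q - 2) / 2) (u i))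
      \<le> 2 * q * avg n (\<lambda>i. signed_powr (q - 2) (u i) * lap u i)"
proof -
  let ?f = "\<lambda>i. signed_powr ((q - 2) / 2) (u i)" and ?g = "\<lambda>i. signed_powr (q - 2) (u i)"
  have "energy 2 ?f \<le> avg n (\<lambda>i. avg n (\<lambda>j. q / \<epsilon>\<^sup>2 * (K i j * ((u i - u j) * (?g i - ?g j)))))"
    unfolding energy_def
  proof (intro avg_mono)
    fix i j
    have "(\<bar>?f j - ?f i\<bar> / \<epsilon>) powr 2 = (?f i - ?f j)\<^sup>2 / \<epsilon>\<^sup>2"
      using \<epsilon> by (simp add: powr_numeral power_divide power2_commute)
    also have "\<dots> \<le> q * ((u i - u j) * (?g i - ?g j)) / \<epsilon>\<^sup>2"
      by (intro divide_right_mono signed_powr_test_ge2 assms) simp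
    finally have "K i j * (\<bar>?f j - ?f i\<bar> / \<epsilon>) powr 2
        \<le> K i j * (q * ((u i - u j) * (?g i - ?g j)) / \<epsilon>\<^sup>2)"
      by (intro mult_left_mono K_nonneg)
    then show "K i j * (\<bar>?f j - ?f i\<bar> / \<epsilon>) powr 2
        \<le> q / \<epsilon>\<^sup>2 * (K i j * ((u i - u j) * (?g i - ?g j)))"
      by (simp add: mult_ac)
  qed
  also have "\<dots> = 2 * q * avg n (\<lambda>i. ?g i * lap u i)"
    unfolding avg_cmult green_identity using \<epsilon> by simp
  finally show ?thesis .
qed

text \<open>The Poincare inequality is assumed for functions of \<open>u\<close> only: sample points may coincide, so
  it is not available for arbitrary functions of the index.\<close>

lemma estimate_ge2:
  assumes q: "2 \<le> q" and C: "0 < C"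
    and poincare: "\<And>\<phi>. avg n (\<lambda>i. \<bar>\<phi> (u i)\<bar> powr 2)
      \<le> C * energy 2 (\<lambda>i. \<phi> (u i)) + C * avg n (\<lambda>i. \<bar>\<phi> (u i)\<bar>) powr 2"
  shows "avg n (\<lambda>i. \<bar>u i\<bar> powr q) + energy 2 (\<lambda>i. signed_powr ((q - 2) / 2) (u i))
     \<le> bound_ge2 q C * ((avg n (\<lambda>i. \<bar>u i\<bar> powr (q / 2)))\<^sup>2 + avg n (\<lambda>i. \<bar>lap u i\<bar> powr q))"
proof -
  \<comment> \<open>With this size the term C E, where E \<le> 2 q (\<delta> U + D H), contributes
    only U / 2 to the bound for U.\<close>
  define \<delta> where "\<delta> = 1 / (4 * q * C)"
  define U where "U = avg n (\<lambda>i. \<bar>u i\<bar> powr q)"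
  define H where "H = avg n (\<lambda>i. \<bar>lap u i\<bar> powr q)"
  define W where "W = avg n (\<lambda>i. \<bar>u i\<bar> powr (q / 2))"
  define E where "E = energy 2 (\<lambda>i. signed_powr ((q - 2) / 2) (u i))"
  define D where "D = \<delta> powr (1 - q)"
  have \<delta>: "0 < \<delta>" "4 * q * C * \<delta> = 1" using q C by (auto simp: \<delta>_def)
  have pos: "0 \<le> H" "0 \<le> W" "0 \<le> D" by (auto simp: H_def W_def D_def intro: avg_nonneg)
  have e: "(q - 2) / 2 + 1 = q / 2" by (simp add: field_simps)
  have "U \<le> C * E + C * W\<^sup>2"
    using poincare[of "signed_powr ((q - 2) / 2)"] pos
    by (simp add: abs_signed_powr e powr_powr U_def E_def W_def)
  moreover have "E \<le> 2 * q * (\<delta> * U + D * H)"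
  proof -
    have "avg n (\<lambda>i. signed_powr (q - 2) (u i) * lap u i) \<le> \<delta> * U + D * H"
      unfolding U_def H_def D_def using q \<delta> by (intro test_signed_powr) auto
    then have "2 * q * avg n (\<lambda>i. signed_powr (q - 2) (u i) * lap u i) \<le> 2 * q * (\<delta> * U + D * H)"
      using q by (intro mult_left_mono) auto
    with energy_test_ge2[OF q, of u] show ?thesis unfolding E_def by linarith
  qed
  moreover from this have "C * E \<le> C * (2 * q * (\<delta> * U + D * H))" using C
      by (intro mult_left_mono) auto
  moreover have "C * (2 * q * (\<delta> * U + D * H)) = U / 2 * (4 * q * C * \<delta>) + 2 * q * C * (D * H)"
    by (simp add: algebra_simps)
  ultimately have U: "U \<le> 4 * q * C * (D * H) + 2 * C * W\<^sup>2" unfolding \<delta>(2) by simp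
  have "2 * q * \<delta> = 1 / (2 * C)" using q C by (simp add: \<delta>_def)
  with \<open>E \<le> 2 * q * (\<delta> * U + D * H)\<close> have "E \<le> U / (2 * C) + 2 * q * (D * H)"
    by (simp add: algebra_simps)
  also have "U / (2 * C) \<le> (4 * q * C * (D * H) + 2 * C * W\<^sup>2) / (2 * C)"
    using U C by (intro divide_right_mono) auto
  also have "\<dots> = 2 * q * (D * H) + W\<^sup>2" using C by (simp add: field_simps)
  finally have "U + E \<le> (2 * C + 1) * W\<^sup>2 + 4 * q * (C + 1) * D * H" using U
      by (simp add: algebra_simps)
  also have "\<dots> \<le> bound_ge2 q C * W\<^sup>2 + bound_ge2 q C * H"
    using q C pos by (intro add_mono mult_right_mono) (auto simp: bound_ge2_def D_def \<delta>_def)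
  finally show ?thesis by (simp add: U_def E_def H_def W_def algebra_simps)
qed

text \<open>With S = |u i| + |u j| and difference quotient s, pairs are split at s = \<tau> S.
  Below, s^q \<le> \<tau>^q S^q is summed by means of the degree bound \<open>D\<close>. Above,
  s^(q-2) \<le> (\<tau> S)^(q-2), and the weighted test inequality applies.\<close>

lemma energy_test_lt2:
  assumes q: "1 < q" "q < 2" and \<tau>: "0 < \<tau>" and D: "\<And>i. i \<in> {1..n} \<Longrightarrow> avg n (K i) \<le> D"
  shows "energy q u \<le> 8 * D * \<tau> powr q * avg n (\<lambda>i. \<bar>u i\<bar> powr q)
     + 2 * \<tau> powr (q - 2) / (q - 1) * avg n (\<lambda>i. signed_powr (q - 2) (u i) * lap u i)"
proof -
  let ?g = "\<lambda>i. signed_powr (q - 2) (u i)"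
  define L where "L = \<tau> powr (q - 2) / (q - 1)"
  define U where "U = avg n (\<lambda>i. \<bar>u i\<bar> powr q)"
  have Unn: "0 \<le> U" unfolding U_def by (intro avg_nonneg) auto
  have "energy q u \<le> avg n (\<lambda>i. avg n (\<lambda>j. 4 * \<tau> powr q * (K i j * \<bar>u i\<bar> powr q
      + K i j * \<bar>u j\<bar> powr q)
      + L / \<epsilon>\<^sup>2 * (K i j * ((u i - u j) * (?g i - ?g j)))))"
    unfolding energy_def
  proof (intro avg_mono)
    fix i j
    define s where "s = \<bar>u j - u i\<bar> / \<epsilon>"
    define S where "S = \<bar>u i\<bar> + \<bar>u j\<bar>"
    define Q where "Q = (u i - u j) * (?g i - ?g j)"
    have s: "0 \<le> s" and S: "0 \<le> S" using \<epsilon> by (auto simp: s_def S_def)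
    have Q: "(q - 1) * (s\<^sup>2 * S powr (q - 2)) \<le> Q / \<epsilon>\<^sup>2"
    proof -
      have "(q - 1) * ((u i - u j)\<^sup>2 * S powr (q - 2)) / \<epsilon>\<^sup>2 \<le> Q / \<epsilon>\<^sup>2"
        unfolding S_def Q_def by (intro divide_right_mono signed_powr_test_lt2 q) simp
      then show ?thesis by (simp add: s_def power_divide power2_commute)
    qed
    have "0 \<le> (q - 1) * (s\<^sup>2 * S powr (q - 2))" using q by (intro mult_nonneg_nonneg) auto
    then have Q0: "0 \<le> Q / \<epsilon>\<^sup>2" using Q by linarith
    have L0: "0 \<le> L" using q by (simp add: L_def)
    \<comment> \<open>The 4 bounds 2^q; the two equal sums over i and over j double it to the 8 of
      the conclusion.\<close>
    have Sq: "S powr q \<le> 4 * (\<bar>u i\<bar> powr q + \<bar>u j\<bar> powr q)"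
    proof -
      have "S powr q \<le> 2 powr q * (\<bar>u i\<bar> powr q + \<bar>u j\<bar> powr q)"
        unfolding S_def using q by (intro powr_add_le) auto
      also have "2 powr q \<le> (2::real) powr 2" using q by (intro powr_mono) auto
      finally show ?thesis by (simp add: mult_right_mono)
    qed
    have "s powr q \<le> \<tau> powr q * S powr q + L * (Q / \<epsilon>\<^sup>2)"
    proof (cases "s \<le> \<tau> * S")
      case True
      then have "s powr q \<le> (\<tau> * S) powr q" using s q by (intro powr_mono2) auto
      also have "\<dots> = \<tau> powr q * S powr q" using \<tau> S by (simp add: powr_mult)
      finally show ?thesis using mult_nonneg_nonneg[OF L0 Q0] by linarith
    next
      case False
      then have sp: "0 < s" using \<tau> S by (smt (verit) mult_nonneg_nonneg)
      have "S \<noteq> 0"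
      proof
        assume "S = 0"
        then have "u i = 0" "u j = 0" by (auto simp: S_def)
        then show False using sp by (simp add: s_def)
      qed
      then have Sp: "0 < S" using S by simp
      have "s powr q = s powr 2 * s powr (q - 2)" by (simp flip: powr_add)
      also have "s powr 2 = s\<^sup>2" using sp by (simp add: powr_numeral)
      also have "s\<^sup>2 * s powr (q - 2) \<le> s\<^sup>2 * (\<tau> * S) powr (q - 2)"
        using False q \<tau> Sp by (intro mult_left_mono powr_mono2') auto
      also have "\<dots> = L * ((q - 1) * (s\<^sup>2 * S powr (q - 2)))"
        using q \<tau> Sp by (simp add: L_def powr_mult mult_ac)
      also have "\<dots> \<le> L * (Q / \<epsilon>\<^sup>2)" by (intro mult_left_mono Q L0)
      finally show ?thesis by (simp add: add_increasing)
    qed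
    also have "\<dots> \<le> \<tau> powr q * (4 * (\<bar>u i\<bar> powr q + \<bar>u j\<bar> powr q)) + L * (Q / \<epsilon>\<^sup>2)"
      by (intro add_right_mono mult_left_mono Sq) simp
    finally have "K i j * s powr q \<le> K i j * (\<tau> powr q * (4 * (\<bar>u i\<bar> powr q + \<bar>u j\<bar> powr q))
        + L * (Q / \<epsilon>\<^sup>2))"
      by (intro mult_left_mono K_nonneg)
    then show "K i j * (\<bar>u j - u i\<bar> / \<epsilon>) powr q
        \<le> 4 * \<tau> powr q * (K i j * \<bar>u i\<bar> powr q + K i j * \<bar>u j\<bar> powr q)
      + L / \<epsilon>\<^sup>2 * (K i j * ((u i - u j) * (?g i - ?g j)))"
      unfolding s_def[symmetric] Q_def[symmetric] by (simp add: algebra_simps)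
  qed
  also have "\<dots> = 4 * \<tau> powr q * (avg n (\<lambda>i. avg n (\<lambda>j. K i j * \<bar>u i\<bar> powr q))
      + avg n (\<lambda>i. avg n (\<lambda>j. K i j * \<bar>u j\<bar> powr q)))
      + L / \<epsilon>\<^sup>2 * (2 * \<epsilon>\<^sup>2 * avg n (\<lambda>i. ?g i * lap u i))"
    unfolding avg_add avg_cmult green_identity by simp
  also have "avg n (\<lambda>i. avg n (\<lambda>j. K i j * \<bar>u j\<bar> powr q))
      = avg n (\<lambda>i. avg n (\<lambda>j. K i j * \<bar>u i\<bar> powr q))"
    by (subst avg_swap) (subst K_sym, simp)
  also have "L / \<epsilon>\<^sup>2 * (2 * \<epsilon>\<^sup>2 * avg n (\<lambda>i. ?g i * lap u i)) = 2 * L * avg n (\<lambda>i. ?g i * lap u i)"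
    using \<epsilon> by simp
  finally have *: "energy q u \<le> 8 * \<tau> powr q * avg n (\<lambda>i. avg n (\<lambda>j. K i j * \<bar>u i\<bar> powr q))
      + 2 * L * avg n (\<lambda>i. ?g i * lap u i)"
    by simp
  have "avg n (\<lambda>i. avg n (\<lambda>j. K i j * \<bar>u i\<bar> powr q)) \<le> avg n (\<lambda>i. D * \<bar>u i\<bar> powr q)"
  proof (intro avg_mono)
    fix i assume i: "i \<in> {1..n}"
    have "avg n (\<lambda>j. K i j * \<bar>u i\<bar> powr q) = \<bar>u i\<bar> powr q * avg n (K i)"
      using avg_cmult[of n "\<bar>u i\<bar> powr q" "K i"] by (simp add: mult.commute)
    also have "\<dots> \<le> \<bar>u i\<bar> powr q * D" by (intro mult_left_mono D i) simp
    finally show "avg n (\<lambda>j. K i j * \<bar>u i\<bar> powr q) \<le> D * \<bar>u i\<bar> powr q" by (simp add: mult.commute)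
  qed
  also have "\<dots> = D * U" by (simp add: avg_cmult U_def)
  finally have "8 * \<tau> powr q * avg n (\<lambda>i. avg n (\<lambda>j. K i j * \<bar>u i\<bar> powr q))
      \<le> 8 * \<tau> powr q * (D * U)"
    by (intro mult_left_mono) auto
  with * show ?thesis by (simp add: L_def U_def mult_ac)
qed

text \<open>Two absorptions: both 8 D \<tau>^q and L \<delta> are set to 1 / (4 C), so that E \<le>
  U / (2 C) + B H and the Poincare inequality returns only U / 2.\<close>

lemma estimate_lt2:
  assumes q: "1 < q" "q < 2" and C: "0 < C" and D: "0 < D" "\<And>i. i \<in> {1..n} \<Longrightarrow> avg n (K i) \<le> D"
    and poincare: "avg n (\<lambda>i. \<bar>u i\<bar> powr q) \<le> C * energy q u + C * avg n (\<lambda>i. \<bar>u i\<bar>) powr q"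
  shows "avg n (\<lambda>i. \<bar>u i\<bar> powr q) + energy q u
     \<le> bound_lt2 q C D * (avg n (\<lambda>i. \<bar>u i\<bar>) powr q + avg n (\<lambda>i. \<bar>lap u i\<bar> powr q))"
proof -
  define \<tau> where "\<tau> = (1 / (32 * D * C)) powr (1 / q)"
  define L where "L = 2 * \<tau> powr (q - 2) / (q - 1)"
  define \<delta> where "\<delta> = 1 / (4 * L * C)"
  define B where "B = L * \<delta> powr (1 - q)"
  define U where "U = avg n (\<lambda>i. \<bar>u i\<bar> powr q)"
  define H where "H = avg n (\<lambda>i. \<bar>lap u i\<bar> powr q)"
  define W where "W = avg n (\<lambda>i. \<bar>u i\<bar>) powr q"
  define E where "E = energy q u"
  have \<tau>: "0 < \<tau>" "8 * D * \<tau> powr q = 1 / (4 * C)"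
    using q C D by (auto simp: \<tau>_def powr_powr)
  have L: "0 < L" using \<tau> q by (simp add: L_def)
  then have \<delta>: "0 < \<delta>" "L * \<delta> = 1 / (4 * C)" using C by (auto simp: \<delta>_def)
  have pos: "0 \<le> H" "0 \<le> W" "0 \<le> B" using L by (auto simp: H_def W_def B_def intro: avg_nonneg)
  have "E \<le> U / (4 * C) + L * avg n (\<lambda>i. signed_powr (q - 2) (u i) * lap u i)"
    using energy_test_lt2[OF q \<tau>(1) D(2), of u] unfolding \<tau>(2) by (simp add: E_def U_def L_def)
  also have "L * avg n (\<lambda>i. signed_powr (q - 2) (u i) * lap u i) \<le> L * (\<delta> * U + \<delta> powr (1 - q) * H)"
    unfolding U_def H_def using L q \<delta> by (intro mult_left_mono test_signed_powr) auto
  also have "\<dots> = (L * \<delta>) * U + B * H" by (simp add: B_def algebra_simps)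
  finally have E: "E \<le> U / (2 * C) + B * H" unfolding \<delta>(2) by (simp add: field_simps)
  have "U \<le> C * E + C * W" using poincare by (simp add: U_def E_def W_def)
  also have "C * E \<le> C * (U / (2 * C) + B * H)" using E C by (intro mult_left_mono) auto
  also have "\<dots> = U / 2 + C * (B * H)" using C by (simp add: algebra_simps)
  finally have U: "U \<le> 2 * C * (B * H) + 2 * C * W" by simp
  note E
  also have "U / (2 * C) \<le> (2 * C * (B * H) + 2 * C * W) / (2 * C)"
    using U C by (intro divide_right_mono) auto
  also have "\<dots> = B * H + W" using C by (simp add: field_simps)
  finally have "U + E \<le> (2 * C + 1) * W + 2 * (C + 1) * B * H" using U by (simp add: algebra_simps)
  also have "\<dots> \<le> bound_lt2 q C D * W + bound_lt2 q C D * H"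
    using q C pos by (intro add_mono mult_right_mono)
      (auto simp: bound_lt2_def Let_def B_def \<delta>_def L_def \<tau>_def)
  finally show ?thesis by (simp add: U_def E_def H_def W_def algebra_simps)
qed

end

section \<open>Moser iteration\<close>

lemma dyadic_floor:
  fixes X :: real
  assumes "1 \<le> X"
  obtains k where "2 ^ k \<le> X" "X < 2 ^ (k + 1)"
proof -
  have ex: "\<exists>m. X < 2 ^ m" using real_arch_pow[of 2 X] by simp
  define m where "m = (LEAST m. X < 2 ^ m)"
  have m: "X < 2 ^ m" unfolding m_def using ex by (rule LeastI_ex)
  then have "m \<noteq> 0" using assms by (intro notI) simp
  then obtain k where k: "m = k + 1" by (cases m) auto
  have "\<not> X < 2 ^ k" using not_less_Least[of k "\<lambda>m. X < 2 ^ m"] k by (simp add: m_def)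
  then show ?thesis using m unfolding k by (intro that[of k]) auto
qed

context weighted_graph
begin

text \<open>Testing with the power q = 2^(k+1) bounds the energy of v^(q/2) by 2 q times the mean of
  v^q. At the scale r with C r^2 2 q = 1/2 the Poincare inequality absorbs it, and the L1 term
  remains with the factor r^(-2d).\<close>

lemma moser_step:
  assumes C: "1 \<le> C" and e: "0 < e" and v: "\<And>i. 0 \<le> v i" and sub: "\<And>i. i \<in> {1..n} \<Longrightarrow> lap v i \<le> v i"
    and poincare: "\<And>\<phi> r. e \<le> r \<Longrightarrow> r \<le> 1 \<Longrightarrow>
      avg n (\<lambda>i. \<bar>\<phi> (v i)\<bar> powr 2)
        \<le> C * r\<^sup>2 * energy 2 (\<lambda>i. \<phi> (v i)) + C * (avg n (\<lambda>i. \<bar>\<phi> (v i)\<bar>) / r ^ d)\<^sup>2"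
    and k: "e\<^sup>2 * (C * 2 ^ (k + 3)) \<le> 1"
  shows "avg n (\<lambda>i. v i ^ 2 ^ (k + 1))
      \<le> 2 * C * (C * 2 ^ (k + 3)) ^ d * (avg n (\<lambda>i. v i ^ 2 ^ k))\<^sup>2"
proof -
  define q :: real where "q = 2 ^ (k + 1)"
  \<comment> \<open>This is 4 q C, so r^2 = 1 / X makes C r^2 2 q equal to 1/2; the hypothesis on
    \<open>k\<close> says that e \<le> r.\<close>
  define X where "X = C * 2 ^ (k + 3)"
  define r where "r = 1 / sqrt X"
  define Y where "Y = avg n (\<lambda>i. v i ^ 2 ^ (k + 1))"
  define W where "W = avg n (\<lambda>i. v i ^ 2 ^ k)"
  have "1 * 1 \<le> C * 2 ^ (k + 3)" using C by (intro mult_mono) auto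
  then have X: "1 \<le> X" by (simp add: X_def)
  then have r: "0 < r" "r \<le> 1" "r\<^sup>2 = 1 / X" by (auto simp: r_def power_divide)
  have "e\<^sup>2 * X \<le> 1" using k by (simp only: X_def)
  then have "e\<^sup>2 \<le> r\<^sup>2" using X by (simp add: r(3) pos_le_divide_eq)
  then have er: "e \<le> r" by (rule power2_le_imp_le) (use r(1) in simp)
  have q2: "2 \<le> q" by (simp add: q_def)
  \<comment> \<open>The condition \<open>m \<noteq> 0\<close> matters where v vanishes:
    \<open>0 powr 0 = 0\<close> but \<open>0 ^ 0 = 1\<close>.\<close>
  have pow: "v i powr real m = v i ^ m" if "m \<noteq> 0" for i m
  proof (cases "v i = 0")
    case False
    then have "0 < v i" using v[of i] by linarith
    then show ?thesis by (rule powr_realpow)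
  qed (use that in simp)
  have "q = real (2 ^ (k + 1))" by (simp add: q_def)
  then have vq: "v i powr q = v i ^ 2 ^ (k + 1)" for i
    using pow[of "2 ^ (k + 1)" i] by simp
  have "q = 2 * real (2 ^ k)" by (simp add: q_def)
  then have e2: "(q - 2) / 2 + 1 = real (2 ^ k)" by (simp add: field_simps)
  have f: "signed_powr ((q - 2) / 2) (v i) = v i ^ 2 ^ k" for i
    unfolding signed_powr_nonneg[OF v] e2 by (intro pow) simp
  have "avg n (\<lambda>i. signed_powr (q - 2) (v i) * lap v i) \<le> Y"
    unfolding Y_def
  proof (intro avg_mono)
    fix i assume i: "i \<in> {1..n}"
    have "signed_powr (q - 2) (v i) * lap v i \<le> signed_powr (q - 2) (v i) * v i"
      using v[of i] sub[OF i] by (intro mult_left_mono) (auto simp: signed_powr_def)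
    also have "\<dots> = v i powr q" using v[of i]
        by (simp add: signed_powr_nonneg powr_mult_base mult.commute)
    finally show "signed_powr (q - 2) (v i) * lap v i \<le> v i ^ 2 ^ (k + 1)" by (simp only: vq)
  qed
  then have "2 * q * avg n (\<lambda>i. signed_powr (q - 2) (v i) * lap v i) \<le> 2 * q * Y"
    using q2 by (intro mult_left_mono) auto
  with energy_test_ge2[OF q2, of v] have en: "energy 2 (\<lambda>i. v i ^ 2 ^ k) \<le> 2 * q * Y"
    unfolding f by linarith
  have Yf: "avg n (\<lambda>i. \<bar>v i ^ 2 ^ k\<bar> powr 2) = Y"
  proof -
    have "\<bar>v i ^ 2 ^ k\<bar> powr 2 = v i ^ 2 ^ (k + 1)" for i
    proof -
      have "\<bar>v i ^ 2 ^ k\<bar> powr 2 = (v i ^ 2 ^ k)\<^sup>2" using v[of i] by (simp add: powr_numeral)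
      also have "\<dots> = v i ^ 2 ^ (k + 1)"
          by (simp only: power_mult[symmetric] power_add power_one_right)
      finally show ?thesis .
    qed
    then show ?thesis by (simp add: Y_def)
  qed
  have Wf: "avg n (\<lambda>i. \<bar>v i ^ 2 ^ k\<bar>) = W"
    unfolding W_def using v by simp
  have "Y \<le> C * r\<^sup>2 * energy 2 (\<lambda>i. v i ^ 2 ^ k) + C * (W / r ^ d)\<^sup>2"
    using poincare[OF er r(2), of "\<lambda>t. t ^ 2 ^ k"] unfolding Yf Wf .
  also have "C * r\<^sup>2 * energy 2 (\<lambda>i. v i ^ 2 ^ k) \<le> C * r\<^sup>2 * (2 * q * Y)"
    using C by (intro mult_left_mono en) auto
  also have "\<dots> = Y / 2" using C by (simp add: r X_def q_def power_add)
  also have "(W / r ^ d)\<^sup>2 = X ^ d * W\<^sup>2"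
  proof -
    have "(r ^ d)\<^sup>2 = (r\<^sup>2) ^ d" unfolding power_mult[symmetric] by (simp only: mult.commute)
    also have "\<dots> = 1 / X ^ d" by (simp add: r power_divide)
    finally have "(r ^ d)\<^sup>2 = 1 / X ^ d" .
    then show ?thesis by (simp add: power_divide)
  qed
  finally have "Y \<le> 2 * C * X ^ d * W\<^sup>2" by (simp add: mult.assoc)
  then show ?thesis by (simp only: Y_def W_def X_def)
qed

text \<open>With Y_k the mean of v^(2^k), one step reads Y_(k+1) \<le> A B^(k+1) Y_k^2. The weight A
  B^(k+2) turns this into Z_(k+1) \<le> Z_k^2 for Z_k = A B^(k+2) Y_k, so no infinite product of
  constants has to be estimated.\<close>

lemma moser_iteration:
  assumes C: "1 \<le> C" and e: "0 < e" and v: "\<And>i. 0 \<le> v i" and sub: "\<And>i. i \<in> {1..n} \<Longrightarrow> lap v i \<le> v i"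
    and poincare: "\<And>\<phi> r. e \<le> r \<Longrightarrow> r \<le> 1 \<Longrightarrow>
      avg n (\<lambda>i. \<bar>\<phi> (v i)\<bar> powr 2)
        \<le> C * r\<^sup>2 * energy 2 (\<lambda>i. \<phi> (v i)) + C * (avg n (\<lambda>i. \<bar>\<phi> (v i)\<bar>) / r ^ d)\<^sup>2"
    and A: "A = 2 * C * (4 * C) ^ d" and B: "B = 2 ^ d"
  shows "e\<^sup>2 * (C * 2 ^ (k + 2)) \<le> 1 \<Longrightarrow>
      A * B ^ (k + 2) * avg n (\<lambda>i. v i ^ 2 ^ k) \<le> (A * B\<^sup>2 * avg n v) ^ 2 ^ k"
proof (induction k)
  case 0
  then show ?case by (simp add: power2_eq_square)
next
  case (Suc k)
  define Y where "Y k = avg n (\<lambda>i. v i ^ 2 ^ k)" for k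
  have AB: "0 \<le> A" "0 \<le> B" using C A B by auto
  \<comment> \<open>The condition on the exponent at \<open>Suc k\<close> is the one that
    \<open>moser_step\<close> requires at \<open>k\<close>.\<close>
  have k3: "Suc k + 2 = k + 3" by simp
  have Y: "0 \<le> Y k" for k unfolding Y_def using v by (intro avg_nonneg) auto
  have "e\<^sup>2 * (C * 2 ^ (k + 2)) \<le> e\<^sup>2 * (C * 2 ^ (Suc k + 2))" using C
      by (intro mult_left_mono) auto
  then have IH: "A * B ^ (k + 2) * Y k \<le> (A * B\<^sup>2 * avg n v) ^ 2 ^ k"
    using Suc by (simp add: Y_def)
  have "Y (Suc k) \<le> 2 * C * (C * 2 ^ (k + 3)) ^ d * (Y k)\<^sup>2"
    using moser_step[OF C e v sub poincare, of k] Suc.prems[unfolded k3]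
        by (simp only: Y_def Suc_eq_plus1)
  also have "2 * C * (C * 2 ^ (k + 3)) ^ d = A * B ^ (k + 1)"
  proof -
    have "C * 2 ^ (k + 3) = (4 * C) * 2 ^ (k + 1)" by (simp add: power_add)
    then have "(C * 2 ^ (k + 3)) ^ d = (4 * C) ^ d * (2 ^ (k + 1)) ^ d"
        by (simp only: power_mult_distrib)
    also have "(2 ^ (k + 1)) ^ d = B ^ (k + 1)" unfolding B power_mult[symmetric]
        by (simp only: mult.commute)
    finally show ?thesis by (simp add: A)
  qed
  finally have "A * B ^ (Suc k + 2) * Y (Suc k) \<le> A * B ^ (Suc k + 2) * (A * B ^ (k + 1) * (Y k)\<^sup>2)"
    using AB by (intro mult_left_mono) auto
  also have "\<dots> = (A * B ^ (k + 2) * Y k)\<^sup>2"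
    by (simp add: power2_eq_square mult_ac power_add)
  also have "\<dots> \<le> ((A * B\<^sup>2 * avg n v) ^ 2 ^ k)\<^sup>2"
    using AB Y IH by (intro power_mono) auto
  also have "\<dots> = (A * B\<^sup>2 * avg n v) ^ 2 ^ Suc k"
    unfolding power_mult[symmetric] power_Suc by (simp only: mult.commute)
  finally show ?case by (simp only: Y_def)
qed

text \<open>The iteration runs up to the largest \<open>p = 2 ^ k\<close> with \<open>C * \<epsilon>\<^sup>2 * p \<le> 1\<close>; as \<open>p\<close> is then comparable to
  \<open>1 / \<epsilon>\<^sup>2\<close>, the factor \<open>1 / \<epsilon> ^ d\<close> is at most the \<open>p\<close>-th power of a constant.\<close>

lemma subsolution_sup_bound:
  assumes C: "1 \<le> C" and \<epsilon>1: "\<epsilon> \<le> 1" "C * \<epsilon>\<^sup>2 \<le> 1" "2 * \<epsilon>\<^sup>2 \<le> c"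
    and v: "\<And>i. 0 \<le> v i" and sub: "\<And>i. i \<in> {1..n} \<Longrightarrow> lap v i \<le> v i"
    and poincare: "\<And>\<phi> r. \<epsilon> / 2 \<le> r \<Longrightarrow> r \<le> 1 \<Longrightarrow>
      avg n (\<lambda>i. \<bar>\<phi> (v i)\<bar> powr 2)
        \<le> C * r\<^sup>2 * energy 2 (\<lambda>i. \<phi> (v i)) + C * (avg n (\<lambda>i. \<bar>\<phi> (v i)\<bar>) / r ^ d)\<^sup>2"
    and c: "0 < c" "\<And>i. i \<in> {1..n} \<Longrightarrow> c \<le> avg n (K i)"
    and \<kappa>: "\<And>i j. K i j \<le> \<kappa> / \<epsilon> ^ d"
    and i: "i \<in> {1..n}"
  shows "v i \<le> 4 * (max 1 (\<kappa> / c) * (2 * C) ^ d * 2 ^ d) * (2 * C * (4 * C) ^ d * (2 ^ d)\<^sup>2)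
      * avg n v"
proof -
  define A where "A = 2 * C * (4 * C) ^ d"
  define B :: real where "B = 2 ^ d"
  define G where "G = max 1 (\<kappa> / c) * (2 * C) ^ d * 2 ^ d"
  have AB: "1 \<le> A" "1 \<le> B"
  proof -
    have "1 \<le> (4 * C) ^ d" using C by (intro one_le_power) auto
    then have "1 * 1 \<le> (2 * C) * (4 * C) ^ d" using C by (intro mult_mono) auto
    then show "1 \<le> A" by (simp add: A_def)
  qed (simp add: B_def)
  have avgv: "0 \<le> avg n v" using v by (intro avg_nonneg)
  obtain m where m: "m \<in> {1..n}" "\<And>j. j \<in> {1..n} \<Longrightarrow> v j \<le> v m"
  proof -
    have "Max (v ` {1..n}) \<in> v ` {1..n}" using n by (intro Max_in) auto
    then obtain m where "m \<in> {1..n}" "v m = Max (v ` {1..n})" by force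
    then show ?thesis using that[of m] by auto
  qed
  have "1 \<le> 1 / (C * \<epsilon>\<^sup>2)" using \<epsilon>1 C \<epsilon> by simp
  then obtain k where k: "2 ^ k \<le> 1 / (C * \<epsilon>\<^sup>2)" "1 / (C * \<epsilon>\<^sup>2) < 2 ^ (k + 1)"
    by (rule dyadic_floor)
  define p :: nat where "p = 2 ^ k"
  have p: "1 \<le> p" by (simp add: p_def)
  define Y where "Y = avg n (\<lambda>j. v j ^ p)"
  have Y0: "0 \<le> Y" unfolding Y_def using v by (intro avg_nonneg) auto
  \<comment> \<open>The iteration is used with e = \<epsilon>/2, so the 4 hidden in 2^(k+2) cancels
    and the choice of \<open>k\<close> is exactly the condition.\<close>
  have "(\<epsilon> / 2)\<^sup>2 * (C * 2 ^ (k + 2)) = C * \<epsilon>\<^sup>2 * 2 ^ k" by (simp add: power_divide power_add)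
  also have "\<dots> \<le> 1" using k(1) C \<epsilon> by (simp add: field_simps)
  finally have kk: "(\<epsilon> / 2)\<^sup>2 * (C * 2 ^ (k + 2)) \<le> 1" .
  have "A * B ^ (k + 2) * Y \<le> (A * B\<^sup>2 * avg n v) ^ p"
    unfolding Y_def p_def using \<epsilon> by (intro moser_iteration[OF C _ v sub poincare A_def B_def kk]) auto
  moreover have "1 * Y \<le> A * B ^ (k + 2) * Y"
  proof (intro mult_right_mono Y0)
    have "1 \<le> B ^ (k + 2)" using AB by (intro one_le_power)
    then have "1 * 1 \<le> A * B ^ (k + 2)" using AB by (intro mult_mono) auto
    then show "1 \<le> A * B ^ (k + 2)" by simp
  qed
  ultimately have Y: "Y \<le> (A * B\<^sup>2 * avg n v) ^ p" by simp
  define M where "M = v m"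
  have M: "0 \<le> M" using v by (simp add: M_def)
  define D where "D = avg n (K m)"
  have D: "c \<le> D" using c m by (simp add: D_def)
  \<comment> \<open>At the maximum point the subsolution property gives M D - avg (K v) \<le>
    \<epsilon>^2 M \<le> M D / 2, so avg (K v) is at least M D / 2. Neighbours with v \<le> M/4
    supply at most M D / 4 of this; for the others, v (M/4)^(p-1) \<le> v^p.\<close>
  have max_step: "M / 4 * D * (M / 4) ^ (p - 1) \<le> \<kappa> / \<epsilon> ^ d * Y"
  proof -
    have "\<epsilon>\<^sup>2 * lap v m = avg n (\<lambda>j. K m j * (v m - v j))" using \<epsilon> by (simp add: lap_def)
    also have "\<dots> = avg n (\<lambda>j. M * K m j + - 1 * (K m j * v j))" by (simp add: M_def algebra_simps)
    also have "\<dots> = M * D - avg n (\<lambda>j. K m j * v j)"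
      unfolding avg_add avg_cmult D_def by simp
    finally have "M * D - avg n (\<lambda>j. K m j * v j) \<le> \<epsilon>\<^sup>2 * M"
      using mult_left_mono[OF sub[OF m(1)], of "\<epsilon>\<^sup>2"] by (simp add: M_def)
    also have "\<dots> \<le> D / 2 * M" using \<epsilon>1(3) D M by (intro mult_right_mono) auto
    finally have 1: "M / 2 * D \<le> avg n (\<lambda>j. K m j * v j)" by (simp add: algebra_simps)
    have "avg n (\<lambda>j. K m j * v j) * (M / 4) ^ (p - 1)
        = avg n (\<lambda>j. (M / 4) ^ (p - 1) * (K m j * v j))"
      by (simp add: avg_cmult)
    also have "\<dots> \<le> avg n (\<lambda>j. (M / 4) ^ p * K m j + \<kappa> / \<epsilon> ^ d * v j ^ p)"
    proof (intro avg_mono)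
      fix j
      have pp: "x ^ p = x ^ (p - 1) * x" for x :: real using p by (cases p) auto
      have "(M / 4) ^ (p - 1) * v j \<le> (M / 4) ^ p + v j ^ p"
      proof (cases "v j \<le> M / 4")
        case True
        then have "(M / 4) ^ (p - 1) * v j \<le> (M / 4) ^ p" unfolding pp using M
            by (intro mult_left_mono) auto
        then show ?thesis using v[of j] by (simp add: add_increasing2)
      next
        case False
        then have "(M / 4) ^ (p - 1) * v j \<le> v j ^ p" unfolding pp using M v[of j]
            by (intro mult_right_mono power_mono) auto
        then show ?thesis using M by (simp add: add_increasing)
      qed
      then have "K m j * ((M / 4) ^ (p - 1) * v j) \<le> K m j * ((M / 4) ^ p + v j ^ p)"
        by (intro mult_left_mono K_nonneg)
      also have "\<dots> \<le> (M / 4) ^ p * K m j + \<kappa> / \<epsilon> ^ d * v j ^ p"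
        using mult_right_mono[OF \<kappa>[of m j], of "v j ^ p"] v[of j] by (simp add: algebra_simps)
      finally show "(M / 4) ^ (p - 1) * (K m j * v j) \<le> (M / 4) ^ p * K m j + \<kappa> / \<epsilon> ^ d * v j ^ p"
        by (simp add: mult_ac)
    qed
    also have "\<dots> = (M / 4) ^ p * D + \<kappa> / \<epsilon> ^ d * Y"
      unfolding avg_add avg_cmult D_def Y_def by simp
    also have "(M / 4) ^ p = M / 4 * (M / 4) ^ (p - 1)" using p by (cases p) auto
    finally have 2: "avg n (\<lambda>j. K m j * v j) * (M / 4) ^ (p - 1)
        \<le> M / 4 * (M / 4) ^ (p - 1) * D + \<kappa> / \<epsilon> ^ d * Y" .
    have "M / 2 * D * (M / 4) ^ (p - 1) \<le> avg n (\<lambda>j. K m j * v j) * (M / 4) ^ (p - 1)"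
      using 1 M by (intro mult_right_mono) auto
    moreover have "M / 2 * D * (M / 4) ^ (p - 1)
        = M / 4 * D * (M / 4) ^ (p - 1) + M / 4 * (M / 4) ^ (p - 1) * D"
      by (simp add: field_simps)
    ultimately show ?thesis using 2 by linarith
  qed
  have "(M / 4) ^ p * c \<le> (M / 4) ^ p * D" using M D by (intro mult_left_mono) auto
  also have "\<dots> = M / 4 * D * (M / 4) ^ (p - 1)" using p by (cases p) auto
  also note max_step
  finally have "(M / 4) ^ p * c \<le> \<kappa> / \<epsilon> ^ d * Y" .
  then have "(M / 4) ^ p \<le> (\<kappa> / \<epsilon> ^ d * Y) / c" using c(1) by (simp only: pos_le_divide_eq)
  also have "\<dots> = \<kappa> / c * (1 / \<epsilon> ^ d) * Y" by simp
  also have "\<dots> \<le> G ^ p * (A * B\<^sup>2 * avg n v) ^ p"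
  proof (intro mult_mono)
    show "\<kappa> / c * (1 / \<epsilon> ^ d) \<le> G ^ p"
    proof -
      \<comment> \<open>By maximality of \<open>k\<close>, 1/\<epsilon>^2 is below 2 C p, and the
        crude p \<le> 2^p already makes \<epsilon>^(-d) a constant times a p-th power. Constants
        that are at least 1 may be raised to the power p as well.\<close>
      have "1 / \<epsilon> \<le> 1 / \<epsilon>\<^sup>2" using \<epsilon> \<epsilon>1(1)
          by (simp add: field_simps power2_eq_square mult_le_cancel_left1)
      also have "1 / \<epsilon>\<^sup>2 = C * (1 / (C * \<epsilon>\<^sup>2))" using C by simp
      also have "\<dots> \<le> C * 2 ^ (k + 1)" using k C by (intro mult_left_mono) auto
      also have "\<dots> = 2 * C * real p" by (simp add: p_def)
      also have "\<dots> \<le> 2 * C * 2 ^ p" using C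
          by (intro mult_left_mono less_imp_le[OF of_nat_less_two_power]) auto
      finally have "(1 / \<epsilon>) ^ d \<le> (2 * C * 2 ^ p) ^ d" using \<epsilon> by (intro power_mono) auto
      then have "1 / \<epsilon> ^ d \<le> (2 * C) ^ d * (2 ^ d) ^ p"
        by (simp add: power_divide power_mult_distrib power_mult[symmetric] mult.commute[of d])
      then have "\<kappa> / c * (1 / \<epsilon> ^ d) \<le> max 1 (\<kappa> / c) * ((2 * C) ^ d * (2 ^ d) ^ p)"
        using \<epsilon> by (intro mult_mono) auto
      also have "\<dots> \<le> max 1 (\<kappa> / c) ^ p * (((2 * C) ^ d) ^ p * (2 ^ d) ^ p)"
      proof -
        have "max 1 (\<kappa> / c) \<le> max 1 (\<kappa> / c) ^ p" using p by (intro self_le_power) auto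
        moreover have "(2 * C) ^ d \<le> ((2 * C) ^ d) ^ p" using p C
            by (intro self_le_power one_le_power) auto
        ultimately show ?thesis using C by (intro mult_mono) auto
      qed
      finally show ?thesis by (simp add: G_def power_mult_distrib mult.assoc)
    qed
    show "0 \<le> G ^ p" unfolding G_def using C by (intro zero_le_power mult_nonneg_nonneg) auto
  qed (use Y Y0 in auto)
  also have "\<dots> = (G * (A * B\<^sup>2 * avg n v)) ^ p" by (simp only: power_mult_distrib)
  finally have le: "(M / 4) ^ p \<le> (G * (A * B\<^sup>2 * avg n v)) ^ p" .
  have "0 \<le> G * (A * B\<^sup>2 * avg n v)"
    unfolding G_def using C AB avgv by (intro mult_nonneg_nonneg) auto
  then have "M / 4 \<le> G * (A * B\<^sup>2 * avg n v)"
    using le p M power_mono_iff[of "M / 4" "G * (A * B\<^sup>2 * avg n v)" p] by auto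
  then have "M \<le> 4 * G * (A * B\<^sup>2) * avg n v" by simp
  then show ?thesis using m(2)[OF i] by (simp add: M_def G_def A_def B_def)
qed

text \<open>For v = |u| + H, a discrete Kato inequality gives lap v \<le> |lap u| \<le> H \<le> v;
  adding H thus turns the inhomogeneity into a term of order zero. Functions of v are functions of
  u, so v inherits the Poincare inequality.\<close>

lemma sup_bound:
  assumes C: "1 \<le> C" and \<epsilon>1: "\<epsilon> \<le> 1" "C * \<epsilon>\<^sup>2 \<le> 1" "2 * \<epsilon>\<^sup>2 \<le> c"
    and poincare: "\<And>\<phi> r. \<epsilon> / 2 \<le> r \<Longrightarrow> r \<le> 1 \<Longrightarrow>
      avg n (\<lambda>i. \<bar>\<phi> (u i)\<bar> powr 2)
        \<le> C * r\<^sup>2 * energy 2 (\<lambda>i. \<phi> (u i)) + C * (avg n (\<lambda>i. \<bar>\<phi> (u i)\<bar>) / r ^ d)\<^sup>2"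
    and c: "0 < c" "\<And>i. i \<in> {1..n} \<Longrightarrow> c \<le> avg n (K i)"
    and \<kappa>: "\<And>i j. K i j \<le> \<kappa> / \<epsilon> ^ d"
    and H: "0 \<le> H" "\<And>i. i \<in> {1..n} \<Longrightarrow> \<bar>lap u i\<bar> \<le> H"
    and i: "i \<in> {1..n}"
  shows "\<bar>u i\<bar> \<le> 4 * (max 1 (\<kappa> / c) * (2 * C) ^ d * 2 ^ d) * (2 * C * (4 * C) ^ d * (2 ^ d)\<^sup>2)
      * (avg n (\<lambda>i. \<bar>u i\<bar>) + H)"
proof -
  define v where "v j = \<bar>u j\<bar> + H" for j
  note poincare_v = poincare[of _ "\<lambda>t. _ (\<bar>t\<bar> + H)", folded v_def]
  have "lap v j \<le> v j" if j: "j \<in> {1..n}" for j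
  proof -
    have "lap v j \<le> \<bar>lap u j\<bar>"
    proof (cases "0 \<le> u j")
      case True
      have "avg n (\<lambda>l. K j l * (v j - v l)) \<le> avg n (\<lambda>l. K j l * (u j - u l))"
        using True by (intro avg_mono mult_left_mono K_nonneg) (auto simp: v_def)
      then have "lap v j \<le> lap u j" unfolding lap_def by (intro divide_right_mono) auto
      then show ?thesis by simp
    next
      case False
      have "avg n (\<lambda>l. K j l * (v j - v l)) \<le> avg n (\<lambda>l. - 1 * (K j l * (u j - u l)))"
      proof (intro avg_mono)
        fix l
        have "K j l * (v j - v l) \<le> K j l * - (u j - u l)"
          using False by (intro mult_left_mono K_nonneg) (auto simp: v_def)
        then show "K j l * (v j - v l) \<le> - 1 * (K j l * (u j - u l))" by (simp add: algebra_simps)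
      qed
      also have "\<dots> = - avg n (\<lambda>l. K j l * (u j - u l))" unfolding avg_cmult by simp
      finally have "lap v j \<le> - avg n (\<lambda>l. K j l * (u j - u l)) / \<epsilon>\<^sup>2"
        unfolding lap_def by (intro divide_right_mono) auto
      then have "lap v j \<le> - lap u j" by (simp add: lap_def)
      then show ?thesis by simp
    qed
    also have "\<dots> \<le> v j" using H(2)[OF j] by (simp add: v_def)
    finally show ?thesis .
  qed
  moreover have "0 \<le> v j" for j using H by (simp add: v_def)
  ultimately have "v i \<le> 4 * (max 1 (\<kappa> / c) * (2 * C) ^ d * 2 ^ d)
      * (2 * C * (4 * C) ^ d * (2 ^ d)\<^sup>2) * avg n v"
    by (intro subsolution_sup_bound[OF C \<epsilon>1 _ _ poincare_v c \<kappa> i])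
  moreover have "avg n v = avg n (\<lambda>i. \<bar>u i\<bar>) + H"
    unfolding v_def avg_add using n by (simp add: avg_const)
  ultimately show ?thesis using H by (simp add: v_def)
qed

end

section \<open>Transfer between the cloud and the domain\<close>

text \<open>A non-integrable \<open>f\<close> has Bochner integral 0 by convention, so the
  inequality survives in that case.\<close>

lemma ennreal_integral_le:
  fixes f :: "'b \<Rightarrow> real"
  assumes "\<And>x. 0 \<le> f x"
  shows "ennreal (integral\<^sup>L M f) \<le> (\<integral>\<^sup>+x. ennreal (f x) \<partial>M)"
proof (cases "integrable M f")
  case True
  then show ?thesis using assms by (simp add: nn_integral_eq_integral)
next
  case False
  then show ?thesis by (simp add: not_integrable_integral_eq)
qed

text \<open>Energies are only bounded from above here, so iterated Bochner integrals can be passed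
  to iterated nonnegative integrals one variable at a time.\<close>

lemma set_integral_pair_le:
  fixes g :: "'a::euclidean_space \<Rightarrow> 'a \<Rightarrow> real"
  assumes g: "\<And>y z. 0 \<le> g y z" and R: "0 \<le> R"
    and le: "(\<integral>\<^sup>+y. (\<integral>\<^sup>+z. indicator \<Omega> y * indicator \<Omega> z * ennreal (g y z) \<partial>lborel) \<partial>lborel)
        \<le> ennreal R"
  shows "(LINT y:\<Omega>|lborel. (LINT z:\<Omega>|lborel. g y z)) \<le> R"
proof -
  define G where "G y = (LINT z:\<Omega>|lborel. g y z)" for y
  have G0: "0 \<le> indicator \<Omega> y * G y" for y
    unfolding G_def set_lebesgue_integral_def using g
        by (intro mult_nonneg_nonneg integral_nonneg_AE) auto
  have "ennreal (\<integral>y. indicator \<Omega> y * G y \<partial>lborel) \<le> (\<integral>\<^sup>+y. ennreal (indicator \<Omega> y * G y) \<partial>lborel)"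
    using G0 by (intro ennreal_integral_le)
  also have "\<dots> \<le> (\<integral>\<^sup>+y. (\<integral>\<^sup>+z. indicator \<Omega> y * indicator \<Omega> z * ennreal (g y z) \<partial>lborel) \<partial>lborel)"
  proof (intro nn_integral_mono)
    fix y
    show "ennreal (indicator \<Omega> y * G y)
        \<le> (\<integral>\<^sup>+z. indicator \<Omega> y * indicator \<Omega> z * ennreal (g y z) \<partial>lborel)"
    proof (cases "y \<in> \<Omega>")
      case True
      have "ennreal (\<integral>z. indicator \<Omega> z * g y z \<partial>lborel)
          \<le> (\<integral>\<^sup>+z. ennreal (indicator \<Omega> z * g y z) \<partial>lborel)"
        using g by (intro ennreal_integral_le) auto
      also have "\<dots> = (\<integral>\<^sup>+z. indicator \<Omega> z * ennreal (g y z) \<partial>lborel)"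
        by (intro nn_integral_cong) (auto split: split_indicator)
      finally show ?thesis using True by (simp add: G_def set_lebesgue_integral_def)
    qed simp
  qed
  also note le
  finally show ?thesis using R by (simp add: set_lebesgue_integral_def G_def ennreal_le_iff)
qed

section \<open>Kernel weights on the sample and nearness of T to the identity\<close>

locale kernel_cloud = cloud +
  fixes \<eta> :: "real \<Rightarrow> real" and \<epsilon> :: real
  assumes \<epsilon>: "0 < \<epsilon>" and \<eta>_nonneg: "\<And>s. 0 \<le> s \<Longrightarrow> 0 \<le> \<eta> s"
    and \<eta>_anti: "\<And>s t. 0 \<le> s \<Longrightarrow> s \<le> t \<Longrightarrow> \<eta> t \<le> \<eta> s" and \<eta>1: "1 \<le> \<eta> 1" and \<eta>2: "\<eta> 2 = 0"
begin

definition kern :: "'a \<Rightarrow> 'a \<Rightarrow> real" where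
  "kern z z' = scaled_kernel DIM('a) \<eta> \<epsilon> (norm (z - z'))"

lemma kern_nonneg: "0 \<le> kern z z'"
  unfolding kern_def scaled_kernel_def using \<epsilon> by (intro divide_nonneg_nonneg \<eta>_nonneg) auto

lemma kern_le: "kern z z' \<le> \<eta> 0 / \<epsilon> ^ DIM('a)"
  unfolding kern_def scaled_kernel_def using \<epsilon> by (intro divide_right_mono \<eta>_anti) auto

lemma kern_ge: "norm (z - z') \<le> \<epsilon> \<Longrightarrow> 1 / \<epsilon> ^ DIM('a) \<le> kern z z'"
  unfolding kern_def scaled_kernel_def
  using \<epsilon> \<eta>1 \<eta>_anti[of "norm (z - z') / \<epsilon>" 1] by (intro divide_right_mono) auto

lemma kern_eq_0: "2 * \<epsilon> \<le> norm (z - z') \<Longrightarrow> kern z z' = 0"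
  unfolding kern_def scaled_kernel_def
  using \<epsilon> \<eta>2 \<eta>_anti[of 2 "norm (z - z') / \<epsilon>"] \<eta>_nonneg[of "norm (z - z') / \<epsilon>"]
      by (simp add: field_simps)

lemma \<eta>0: "1 \<le> \<eta> 0"
  using \<eta>1 \<eta>_anti[of 0 1] by simp

sublocale graph: weighted_graph n "\<lambda>i j. kern (x i) (x j)" \<epsilon>
  by standard (use n \<epsilon> kern_nonneg in \<open>auto simp: kern_def norm_minus_commute\<close>)

lemma lap_eq: "graph.lap (\<lambda>i. u (x i)) i = - graph_laplacian \<eta> \<epsilon> x n u (x i)"
proof -
  have "(\<Sum>j=1..n. kern (x i) (x j) * (u (x i) - u (x j)))
      = - (\<Sum>j=1..n. scaled_kernel DIM('a) \<eta> \<epsilon> (norm (x i - x j)) * (u (x j) - u (x i)))"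
    unfolding sum_negf[symmetric] kern_def by (intro sum.cong) (auto simp: algebra_simps)
  then show ?thesis unfolding graph.lap_def avg_def graph_laplacian_def by simp
qed

lemma solves_iff:
  "solves_graph_poisson \<eta> \<epsilon> x n u h \<longleftrightarrow> (\<forall>i\<in>{1..n}. graph.lap (\<lambda>i. u (x i)) i = h (x i))"
  unfolding solves_graph_poisson_def lap_eq point_cloud_def by auto

end

text \<open>The fraction 1/8 leaves room for all triangle inequalities: points at distance
  \<epsilon>/2 have images at distance at most \<epsilon>/2 + 2 \<epsilon>/8 < \<epsilon>.\<close>

locale close_cloud = kernel_cloud +
  assumes close: "AE y in lborel. y \<in> \<Omega> \<longrightarrow> norm (y - T y) \<le> \<epsilon> / 8"
begin

lemma norm_T_diff:
  assumes "norm (y - T y) \<le> \<epsilon> / 8" "norm (z - T z) \<le> \<epsilon> / 8" "norm (y - z) \<le> \<epsilon> / 2"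
  shows "norm (T y - T z) \<le> \<epsilon>"
proof -
  have "T y - T z = (y - z) + ((z - T z) - (y - T y))" by simp
  then have "norm (T y - T z) \<le> norm (y - z) + (norm (z - T z) + norm (y - T y))"
    using norm_triangle_ineq[of "y - z" "(z - T z) - (y - T y)"] norm_triangle_ineq4[of "z - T z"
        "y - T y"] by simp
  then show ?thesis using assms \<epsilon> by linarith
qed

text \<open>The common mechanism of the energy comparisons: a pointwise bound for pairs at distance
  at most \<epsilon>/2, used for almost every y and then almost every z, followed by the
  push-forward in both variables.\<close>

lemma close_pair_le:
  assumes g: "\<And>y z. 0 \<le> F y z"
    and le: "\<And>y z. y \<in> \<Omega> \<Longrightarrow> z \<in> \<Omega> \<Longrightarrow> norm (T y - T z) \<le> \<epsilon> \<Longrightarrow> norm (y - z) \<le> \<epsilon> / 2 \<Longrightarrow>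
        g y z \<le> F (T y) (T z)"
    and zero: "\<And>y z. \<epsilon> / 2 < norm (y - z) \<Longrightarrow> g y z \<le> 0"
  shows "pair_nnint g
     \<le> ennreal (avg n (\<lambda>i. avg n (\<lambda>j. F (x i) (x j))) / a\<^sup>2)"
proof -
  have "pair_nnint g
     \<le> (\<integral>\<^sup>+y. (\<integral>\<^sup>+z. indicator \<Omega> y * indicator \<Omega> z * ennreal (F (T y) (T z)) \<partial>lborel) \<partial>lborel)"
  proof (rule nn_integral_mono_AE)
    show "AE y in lborel. (\<integral>\<^sup>+z. indicator \<Omega> y * indicator \<Omega> z * ennreal (g y z) \<partial>lborel)
       \<le> (\<integral>\<^sup>+z. indicator \<Omega> y * indicator \<Omega> z * ennreal (F (T y) (T z)) \<partial>lborel)"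
      using close
    proof eventually_elim
      case y: (elim y)
      show ?case
      proof (rule nn_integral_mono_AE)
        show "AE z in lborel. indicator \<Omega> y * indicator \<Omega> z * ennreal (g y z)
            \<le> indicator \<Omega> y * indicator \<Omega> z * ennreal (F (T y) (T z))"
          using close
        proof eventually_elim
          case z: (elim z)
          show ?case
          proof (cases "y \<in> \<Omega> \<and> z \<in> \<Omega>")
            case True
            have "g y z \<le> F (T y) (T z)"
            proof (cases "norm (y - z) \<le> \<epsilon> / 2")
              case near: True
              show ?thesis using norm_T_diff[OF _ _ near] y z True near by (intro le) auto
            next
              case False
              then show ?thesis using zero[of y z] g[of "T y" "T z"] by linarith
            qed
            then show ?thesis using True by (simp add: ennreal_leI)
          qed auto
        qed
      qed
    qed
  qed
  also have "\<dots> \<le> ennreal (avg n (\<lambda>i. avg n (\<lambda>j. F (x i) (x j))) / a\<^sup>2)"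
    by (intro nn_integral_cloud_pair g)
  finally show ?thesis .
qed

text \<open>If |y - z| \<le> \<epsilon>/2, then the images are within \<epsilon>, so the graph
  weight is at least \<epsilon>^(-d) and dominates the rescaled \<open>\<zeta>\<close>, which
  vanishes at larger distances.\<close>

lemma nonlocal_energy_le:
  assumes \<zeta>: "\<And>s. 0 \<le> s \<Longrightarrow> 0 \<le> \<zeta> s" "\<And>s. 0 \<le> s \<Longrightarrow> \<zeta> s \<le> 1" "\<And>s. 1 / 2 < s \<Longrightarrow> \<zeta> s = 0"
  shows "nonlocal_energy \<zeta> \<epsilon> q \<Omega> (\<lambda>y. f (T y)) \<le> graph.energy q (\<lambda>i. f (x i)) / a\<^sup>2"
proof -
  define F where "F z z' = kern z z' * (\<bar>f z' - f z\<bar> / \<epsilon>) powr q" for z z'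
  define g where "g y z = scaled_kernel DIM('a) \<zeta> \<epsilon> (norm (y - z))
      * \<bar>(f (T z) - f (T y)) / \<epsilon>\<bar> powr q" for y z
  have F: "0 \<le> F z z'" for z z' unfolding F_def by (intro mult_nonneg_nonneg kern_nonneg) auto
  have "(LINT y:\<Omega>|lborel. (LINT z:\<Omega>|lborel. g y z)) \<le> avg n (\<lambda>i. avg n (\<lambda>j. F (x i) (x j))) / a\<^sup>2"
  proof (rule set_integral_pair_le)
    show "0 \<le> g y z" for y z
      unfolding g_def scaled_kernel_def using \<epsilon> \<zeta>
          by (intro mult_nonneg_nonneg divide_nonneg_nonneg) auto
    show "0 \<le> avg n (\<lambda>i. avg n (\<lambda>j. F (x i) (x j))) / a\<^sup>2"
      using F by (intro divide_nonneg_nonneg avg_nonneg) auto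
    show "pair_nnint g
      \<le> ennreal (avg n (\<lambda>i. avg n (\<lambda>j. F (x i) (x j))) / a\<^sup>2)"
    proof (rule close_pair_le[OF F])
      fix y z assume "norm (T y - T z) \<le> \<epsilon>"
      have "scaled_kernel DIM('a) \<zeta> \<epsilon> (norm (y - z)) \<le> 1 / \<epsilon> ^ DIM('a)"
        unfolding scaled_kernel_def using \<epsilon> \<zeta> by (intro divide_right_mono) auto
      also have "\<dots> \<le> kern (T y) (T z)" by (rule kern_ge) fact
      finally show "g y z \<le> F (T y) (T z)"
        unfolding g_def F_def using \<epsilon> by (simp add: mult_right_mono)
    next
      fix y z :: 'a assume "\<epsilon> / 2 < norm (y - z)"
      then have "\<zeta> (norm (y - z) / \<epsilon>) = 0" using \<epsilon> by (intro \<zeta>) (simp add: field_simps)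
      then show "g y z \<le> 0" by (simp add: g_def scaled_kernel_def)
    qed
  qed
  then show ?thesis by (simp add: nonlocal_energy_def g_def F_def graph.energy_def)
qed

text \<open>The factor \<epsilon>^q \<epsilon>^d undoes the normalisation of the graph energy; the
  indicator makes the function measurable on the whole space.\<close>

lemma pair_energy_cloud_le:
  assumes q: "0 \<le> q"
  shows "pair_energy \<Omega> (\<epsilon> / 2) q (\<lambda>y. indicator \<Omega> y * f (T y))
     \<le> ennreal (\<epsilon> powr q * \<epsilon> ^ DIM('a) / a\<^sup>2 * graph.energy q (\<lambda>i. f (x i)))"
proof -
  define F where "F z z' = \<epsilon> powr q * \<epsilon> ^ DIM('a) * (kern z z' * (\<bar>f z' - f z\<bar> / \<epsilon>) powr q)"
      for z z'
  define g where "g y z = indicator {..\<epsilon> / 2} (norm (y - z)) * \<bar>f (T z) - f (T y)\<bar> powr q" for y z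
  have F: "0 \<le> F z z'" for z z' unfolding F_def using \<epsilon>
      by (intro mult_nonneg_nonneg kern_nonneg) auto
  have "pair_energy \<Omega> (\<epsilon> / 2) q (\<lambda>y. indicator \<Omega> y * f (T y))
     = pair_nnint g"
    unfolding pair_energy_def g_def by (intro nn_integral_cong) (auto split: split_indicator)
  also have "\<dots> \<le> ennreal (avg n (\<lambda>i. avg n (\<lambda>j. F (x i) (x j))) / a\<^sup>2)"
  proof (rule close_pair_le[OF F])
    fix y z assume "norm (T y - T z) \<le> \<epsilon>" and near: "norm (y - z) \<le> \<epsilon> / 2"
    then have "1 / \<epsilon> ^ DIM('a) \<le> kern (T y) (T z)" by (intro kern_ge)
    then have "1 \<le> \<epsilon> ^ DIM('a) * kern (T y) (T z)" using \<epsilon> by (simp add: field_simps)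
    then have "1 * \<bar>f (T z) - f (T y)\<bar> powr q
        \<le> \<epsilon> ^ DIM('a) * kern (T y) (T z) * \<bar>f (T z) - f (T y)\<bar> powr q"
      by (intro mult_right_mono) auto
    also have "\<dots> = F (T y) (T z)" using \<epsilon> by (simp add: F_def powr_divide)
    finally show "g y z \<le> F (T y) (T z)" using near by (simp add: g_def)
  qed (simp add: g_def)
  also have "avg n (\<lambda>i. avg n (\<lambda>j. F (x i) (x j))) / a\<^sup>2
      = \<epsilon> powr q * \<epsilon> ^ DIM('a) / a\<^sup>2 * graph.energy q (\<lambda>i. f (x i))"
    unfolding F_def avg_cmult graph.energy_def by simp
  finally show ?thesis .
qed

text \<open>The continuum inequality for f o T at e = \<epsilon>/2, carried to the sample. Halving
  \<epsilon> accounts for 2^q 2^d, the transfer of the energy for 1 / a^2, that of the L1 norm for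
  (1/a)^q, and that of the left side for b.\<close>

lemma poincare:
  assumes C: "0 < C" and q: "1 \<le> q" and r: "\<epsilon> / 2 \<le> r" "r \<le> 1"
    and key: "scaled_poincare \<Omega> \<Omega> q C"
  shows "avg n (\<lambda>i. \<bar>f (x i)\<bar> powr q)
     \<le> b * C * (2 powr q * 2 ^ DIM('a) / a\<^sup>2) * r powr q * graph.energy q (\<lambda>i. f (x i))
       + b * C * (1 / a) powr q * (avg n (\<lambda>i. \<bar>f (x i)\<bar>) / r ^ DIM('a)) powr q"
proof -
  define w where "w y = indicator \<Omega> y * f (T y)" for y
  define I where "I = avg n (\<lambda>i. \<bar>f (x i)\<bar>) / a"
  define E where "E = graph.energy q (\<lambda>i. f (x i))"
  define d where "d = DIM('a)"
  have E: "0 \<le> E" unfolding E_def by (rule graph.energy_nonneg)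
  have I: "0 \<le> I" unfolding I_def using a by (intro divide_nonneg_nonneg avg_nonneg) auto
  have r0: "0 < r" using r \<epsilon> by linarith
  have meas: "w \<in> borel_measurable borel" unfolding w_def by (rule comp_measurable)
  have "(\<integral>\<^sup>+y. indicator \<Omega> y * ennreal \<bar>w y\<bar> \<partial>lborel)
      = nnint (\<lambda>z. \<bar>f z\<bar>)"
    by (intro nn_integral_cong) (auto simp: w_def split: split_indicator)
  also have "\<dots> \<le> ennreal I"
    unfolding I_def using nn_integral_cloud_le[of "\<lambda>z. \<bar>f z\<bar>"] by simp
  finally have int: "(\<integral>\<^sup>+y. indicator \<Omega> y * ennreal \<bar>w y\<bar> \<partial>lborel) \<le> ennreal I" .
  have "(\<integral>\<^sup>+y. indicator \<Omega> y * ennreal (\<bar>w y\<bar> powr q) \<partial>lborel)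
     \<le> ennreal (C * r powr q / ((\<epsilon> / 2) powr q * (\<epsilon> / 2) ^ d)) * pair_energy \<Omega> (\<epsilon> / 2) q w + ennreal (C * (I / r ^ d) powr q)"
    unfolding d_def using \<epsilon> r I int
        by (intro key[unfolded scaled_poincare_def, rule_format] meas) auto
  also have "\<dots> \<le> ennreal (C * r powr q / ((\<epsilon> / 2) powr q * (\<epsilon> / 2) ^ d))
      * ennreal (\<epsilon> powr q * \<epsilon> ^ d / a\<^sup>2 * E)
       + ennreal (C * (I / r ^ d) powr q)"
    unfolding w_def d_def E_def using q
        by (intro add_right_mono mult_left_mono pair_energy_cloud_le) auto
  also have "ennreal (C * r powr q / ((\<epsilon> / 2) powr q * (\<epsilon> / 2) ^ d))
      * ennreal (\<epsilon> powr q * \<epsilon> ^ d / a\<^sup>2 * E)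
      = ennreal (C * (2 powr q * 2 ^ d / a\<^sup>2) * r powr q * E)"
  proof -
    have "C * r powr q / ((\<epsilon> / 2) powr q * (\<epsilon> / 2) ^ d) * (\<epsilon> powr q * \<epsilon> ^ d / a\<^sup>2 * E)
        = C * (2 powr q * 2 ^ d / a\<^sup>2) * r powr q * E"
      using \<epsilon> a by (simp add: powr_divide power_divide)
    then show ?thesis using C E \<epsilon> a by (subst ennreal_mult[symmetric]) auto
  qed
  also have "ennreal (C * (2 powr q * 2 ^ d / a\<^sup>2) * r powr q * E)
      + ennreal (C * (I / r ^ d) powr q)
     = ennreal (C * (2 powr q * 2 ^ d / a\<^sup>2) * r powr q * E + C * (I / r ^ d) powr q)"
    using C E a by (intro ennreal_plus[symmetric]) auto
  finally have main: "(\<integral>\<^sup>+y. indicator \<Omega> y * ennreal (\<bar>w y\<bar> powr q) \<partial>lborel)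
     \<le> ennreal (C * (2 powr q * 2 ^ d / a\<^sup>2) * r powr q * E + C * (I / r ^ d) powr q)" .
  have "ennreal (avg n (\<lambda>i. \<bar>f (x i)\<bar> powr q))
      \<le> ennreal b * nnint (\<lambda>z. \<bar>f z\<bar> powr q)"
    using nn_integral_cloud_bounds(2)[of "\<lambda>z. \<bar>f z\<bar> powr q"] by simp
  also have "nnint (\<lambda>z. \<bar>f z\<bar> powr q)
      = (\<integral>\<^sup>+y. indicator \<Omega> y * ennreal (\<bar>w y\<bar> powr q) \<partial>lborel)"
    by (intro nn_integral_cong) (auto simp: w_def split: split_indicator)
  also have "ennreal b * \<dots> \<le> ennreal b * ennreal (C * (2 powr q * 2 ^ d / a\<^sup>2) * r powr q * E
      + C * (I / r ^ d) powr q)"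
    by (intro mult_left_mono main) auto
  also have "\<dots> = ennreal (b * (C * (2 powr q * 2 ^ d / a\<^sup>2) * r powr q * E
      + C * (I / r ^ d) powr q))"
    using b_pos C E a by (intro ennreal_mult[symmetric] add_nonneg_nonneg mult_nonneg_nonneg) auto
  finally have "avg n (\<lambda>i. \<bar>f (x i)\<bar> powr q)
      \<le> b * (C * (2 powr q * 2 ^ d / a\<^sup>2) * r powr q * E + C * (I / r ^ d) powr q)"
    using b_pos C E a by (subst (asm) ennreal_le_iff) (auto intro!: add_nonneg_nonneg mult_nonneg_nonneg)
  also have "(I / r ^ d) powr q = (1 / a) powr q * (avg n (\<lambda>i. \<bar>f (x i)\<bar>) / r ^ d) powr q"
    using a r0 by (subst powr_mult[symmetric]) (auto simp: I_def intro!: avg_nonneg divide_nonneg_nonneg)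
  finally show ?thesis by (simp add: d_def E_def algebra_simps)
qed

text \<open>The preimage of x i under \<open>T\<close> is not a null set, so it meets the full set
  where \<open>T\<close> is near the identity. The point found there replaces x i when a centre
  inside \<Omega> is required.\<close>

lemma near_point:
  assumes "i \<in> {1..n}"
  obtains y where "y \<in> \<Omega>" "norm (y - x i) \<le> \<epsilon> / 8"
proof (rule ccontr)
  assume "\<not> thesis"
  then have far: "\<not> norm (y - x i) \<le> \<epsilon> / 8" if "y \<in> \<Omega>" for y
      using that \<open>\<And>y. y \<in> \<Omega> \<Longrightarrow> norm (y - x i) \<le> \<epsilon> / 8 \<Longrightarrow> thesis\<close> by blast
  have "AE y in lborel. y \<in> \<Omega> \<longrightarrow> T y \<noteq> x i"
    using close by eventually_elim (use far in auto)
  then show False using point_has_mass[OF assms] by blast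
qed

text \<open>All points of \<Omega> within \<epsilon>/2 of y0 have images within \<epsilon>/8 +
  \<epsilon>/2 + \<epsilon>/8 < \<epsilon> of x i, where the weight is at least \<epsilon>^(-d); the
  cone condition bounds their volume from below.\<close>

lemma degree_lower:
  assumes c: "0 \<le> c" "\<epsilon> \<le> 1" and vol: "\<And>y s. y \<in> \<Omega> \<Longrightarrow> 0 < s \<Longrightarrow> s \<le> 1 \<Longrightarrow>
      ennreal (c * s ^ DIM('a)) \<le> emeasure lborel (\<Omega> \<inter> cball y s)"
    and i: "i \<in> {1..n}"
  shows "a * c / 2 ^ DIM('a) \<le> avg n (\<lambda>j. kern (x i) (x j))"
proof -
  define d where "d = DIM('a)"
  obtain y0 where y0: "y0 \<in> \<Omega>" "norm (y0 - x i) \<le> \<epsilon> / 8" using near_point[OF i] .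
  have "ennreal (1 / \<epsilon> ^ d) * emeasure lborel (\<Omega> \<inter> cball y0 (\<epsilon> / 2))
      = (\<integral>\<^sup>+y. ennreal (1 / \<epsilon> ^ d) * indicator (\<Omega> \<inter> cball y0 (\<epsilon> / 2)) y \<partial>lborel)"
    by (intro nn_integral_cmult_indicator[symmetric]) simp
  also have "\<dots> \<le> nnint (kern (x i))"
  proof (rule nn_integral_mono_AE)
    show "AE y in lborel. ennreal (1 / \<epsilon> ^ d) * indicator (\<Omega> \<inter> cball y0 (\<epsilon> / 2)) y
        \<le> indicator \<Omega> y * ennreal (kern (x i) (T y))"
      using close
    proof eventually_elim
      case (elim y)
      show ?case
      proof (cases "y \<in> \<Omega> \<inter> cball y0 (\<epsilon> / 2)")
        case True
        have "x i - T y = (y - T y) + ((y0 - y) - (y0 - x i))" by simp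
        then have "norm (x i - T y) \<le> norm (y - T y) + (norm (y0 - y) + norm (y0 - x i))"
          using norm_triangle_ineq[of "y - T y"
              "(y0 - y) - (y0 - x i)"] norm_triangle_ineq4[of "y0 - y" "y0 - x i"] by simp
        then have "norm (x i - T y) \<le> \<epsilon>" using elim True y0 \<epsilon> by (simp add: dist_norm)
        then show ?thesis using True kern_ge[of "x i" "T y"] by (simp add: d_def ennreal_leI)
      qed auto
    qed
  qed
  finally have inner: "ennreal (1 / \<epsilon> ^ d) * emeasure lborel (\<Omega> \<inter> cball y0 (\<epsilon> / 2))
      \<le> nnint (kern (x i))" .
  have "ennreal (a * c / 2 ^ d) = ennreal a * (ennreal (1 / \<epsilon> ^ d) * ennreal (c * (\<epsilon> / 2) ^ d))"
    using a c \<epsilon> by (simp add: ennreal_mult[symmetric] power_divide)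
  also have "\<dots> \<le> ennreal a * (ennreal (1 / \<epsilon> ^ d) * emeasure lborel (\<Omega> \<inter> cball y0 (\<epsilon> / 2)))"
    unfolding d_def using c \<epsilon> by (intro mult_left_mono vol y0) auto
  also have "\<dots> \<le> ennreal a * nnint (kern (x i))"
    by (intro mult_left_mono inner) simp
  also have "\<dots> \<le> ennreal (avg n (\<lambda>j. kern (x i) (x j)))"
    using kern_nonneg by (intro nn_integral_cloud_bounds)
  finally show ?thesis unfolding d_def
    by (subst (asm) ennreal_le_iff) (auto intro!: avg_nonneg kern_nonneg)
qed

text \<open>The weight vanishes from distance 2 \<epsilon> on, so only points within 2 \<epsilon> +
  2 \<epsilon>/8 < 3 \<epsilon> of y0 count.\<close>

lemma degree_upper:
  assumes i: "i \<in> {1..n}"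
  shows "avg n (\<lambda>j. kern (x i) (x j)) \<le> b * \<eta> 0 * unit_ball_vol (real DIM('a)) * 3 ^ DIM('a)"
proof -
  define d where "d = DIM('a)"
  obtain y0 where y0: "y0 \<in> \<Omega>" "norm (y0 - x i) \<le> \<epsilon> / 8" using near_point[OF i] .
  have "nnint (kern (x i))
    \<le> (\<integral>\<^sup>+y. ennreal (\<eta> 0 / \<epsilon> ^ d) * indicator (ball y0 (3 * \<epsilon>)) y \<partial>lborel)"
  proof (rule nn_integral_mono_AE)
    show "AE y in lborel. indicator \<Omega> y * ennreal (kern (x i) (T y))
        \<le> ennreal (\<eta> 0 / \<epsilon> ^ d) * indicator (ball y0 (3 * \<epsilon>)) y"
      using close
    proof eventually_elim
      case (elim y)
      show ?case
      proof (cases "y \<in> \<Omega> \<and> kern (x i) (T y) \<noteq> 0")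
        case True
        have "norm (x i - T y) < 2 * \<epsilon>" using True kern_eq_0[of "x i" "T y"] by linarith
        moreover have "norm (((y0 - x i) + (x i - T y)) - (y - T y))
            \<le> norm (y0 - x i) + norm (x i - T y) + norm (y - T y)"
          using norm_triangle_ineq4[of "(y0 - x i) + (x i - T y)"
              "y - T y"] norm_triangle_ineq[of "y0 - x i" "x i - T y"] by linarith
        then have "norm (y0 - y) \<le> norm (y0 - x i) + norm (x i - T y) + norm (y - T y)" by simp
        ultimately have "y \<in> ball y0 (3 * \<epsilon>)" using elim True y0 \<epsilon> by (simp add: dist_norm)
        then show ?thesis using True kern_le[of "x i" "T y"] by (simp add: d_def ennreal_leI)
      qed auto
    qed
  qed
  also have "\<dots> = ennreal (\<eta> 0 / \<epsilon> ^ d) * emeasure lborel (ball y0 (3 * \<epsilon>))"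
    by (intro nn_integral_cmult_indicator) simp
  also have "\<dots> = ennreal (\<eta> 0 / \<epsilon> ^ d * (unit_ball_vol (real d) * (3 * \<epsilon>) ^ d))"
  proof -
    have "emeasure lborel (ball y0 (3 * \<epsilon>)) = ennreal (unit_ball_vol (real d) * (3 * \<epsilon>) ^ d)"
      unfolding d_def using \<epsilon> by (intro emeasure_ball) simp
    moreover have "0 \<le> \<eta> 0 / \<epsilon> ^ d" "0 \<le> unit_ball_vol (real d) * (3 * \<epsilon>) ^ d" using \<epsilon> \<eta>0 by auto
    ultimately show ?thesis by (simp only: ennreal_mult)
  qed
  also have "\<eta> 0 / \<epsilon> ^ d * (unit_ball_vol (real d) * (3 * \<epsilon>) ^ d)
      = \<eta> 0 * unit_ball_vol (real d) * 3 ^ d"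
    using \<epsilon> by (simp add: power_mult_distrib)
  finally have inner: "nnint (kern (x i))
      \<le> ennreal (\<eta> 0 * unit_ball_vol (real d) * 3 ^ d)" .
  have "ennreal (avg n (\<lambda>j. kern (x i) (x j)))
      \<le> ennreal b * nnint (kern (x i))"
    using kern_nonneg by (intro nn_integral_cloud_bounds)
  also have "\<dots> \<le> ennreal b * ennreal (\<eta> 0 * unit_ball_vol (real d) * 3 ^ d)"
    by (intro mult_left_mono inner) simp
  also have "ennreal b * ennreal (\<eta> 0 * unit_ball_vol (real d) * 3 ^ d)
      = ennreal (b * (\<eta> 0 * unit_ball_vol (real d) * 3 ^ d))"
    using b_pos \<eta>0 by (intro ennreal_mult[symmetric]) auto
  finally show ?thesis unfolding d_def using b_pos \<eta>0
    by (subst (asm) ennreal_le_iff) (auto simp: mult.assoc)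
qed

end

section \<open>A smooth kernel\<close>

text \<open>With y = 1/t, the derivative of p(y) exp (-y) in t is y^2 (p - p')(y) exp (-y); the k-th
  polynomial therefore belongs to the k-th derivative of exp (-1/t).\<close>

fun bump_poly :: "nat \<Rightarrow> real poly" where
  "bump_poly 0 = 1"
| "bump_poly (Suc k) = [:0, 0, 1:] * (bump_poly k - pderiv (bump_poly k))"

definition flat :: "real poly \<Rightarrow> real \<Rightarrow> real" where
  "flat p t = (if 0 < t then poly p (1 / t) * exp (- (1 / t)) else 0)"

lemma poly_mult_exp_tendsto_0:
  fixes p :: "real poly"
  shows "((\<lambda>y. poly p y * exp (- y)) \<longlongrightarrow> 0) at_top"
proof -
  have "((\<lambda>y::real. \<Sum>i\<le>degree p. coeff p i * (y ^ i / exp y)) \<longlongrightarrow>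
      (\<Sum>i\<le>degree p. coeff p i * 0)) at_top"
    by (intro tendsto_sum tendsto_mult tendsto_const tendsto_power_div_exp_0)
  moreover have "poly p y * exp (- y) = (\<Sum>i\<le>degree p. coeff p i * (y ^ i / exp y))" for y
    by (simp add: poly_altdef sum_distrib_right exp_minus divide_inverse mult.assoc)
  ultimately show ?thesis by simp
qed

lemma flat_tendsto_0: "(flat p \<longlongrightarrow> 0) (at_right 0)"
proof -
  have "((\<lambda>t. poly p (inverse t) * exp (- inverse t)) \<longlongrightarrow> 0) (at_right 0)"
    by (rule filterlim_compose[OF poly_mult_exp_tendsto_0 filterlim_inverse_at_top_right])
  then show ?thesis
    by (rule Lim_transform_eventually)
      (auto simp: eventually_at_filter flat_def inverse_eq_divide intro!: always_eventually)
qed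

lemma flat_has_derivative:
  "(flat p has_real_derivative flat ([:0, 0, 1:] * (p - pderiv p)) t) (at t)"
proof -
  consider "0 < t" | "t < 0" | "t = 0" by linarith
  then show ?thesis
  proof cases
    case 1
    have "((\<lambda>t. poly p (1 / t) * exp (- (1 / t))) has_real_derivative
        flat ([:0, 0, 1:] * (p - pderiv p)) t) (at t)"
      using 1 by (auto intro!: derivative_eq_intros simp: flat_def algebra_simps power2_eq_square field_simps)
    then show ?thesis
      by (rule has_field_derivative_transform_within_open[of _ _ _ "{0<..}"]) (use 1 in \<open>auto simp: flat_def\<close>)
  next
    case 2
    have "((\<lambda>t. 0) has_real_derivative flat ([:0, 0, 1:] * (p - pderiv p)) t) (at t)"
      using 2 by (simp add: flat_def)
    then show ?thesis
      by (rule has_field_derivative_transform_within_open[of _ _ _ "{..<0}"]) (use 2 in \<open>auto simp: flat_def\<close>)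
  next
    case 3
    have "((\<lambda>h. flat p h / h) \<longlongrightarrow> 0) (at 0)"
    proof (rule filterlim_split_at)
      show "((\<lambda>h. flat p h / h) \<longlongrightarrow> 0) (at_left 0)"
        by (rule tendsto_eventually) (auto simp: eventually_at_filter flat_def intro!: always_eventually)
      \<comment> \<open>Dividing by h multiplies the polynomial in 1/h by its variable, so the
        difference quotient is again a function of the same family.\<close>
      show "((\<lambda>h. flat p h / h) \<longlongrightarrow> 0) (at_right 0)"
        by (rule Lim_transform_eventually[OF flat_tendsto_0[of "[:0, 1:] * p"]])
          (auto simp: eventually_at_filter flat_def intro!: always_eventually)
    qed
    then show ?thesis using 3 by (simp add: DERIV_def flat_def)
  qed
qed

text \<open>For s < 1/2 this is exp (-1 / (1/2 - s)): at most 1 and zero from 1/2 on, as the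
  comparison with the graph energy requires.\<close>

definition bump :: "real \<Rightarrow> real" where
  "bump s = flat 1 (1 / 2 - s)"

lemma bump_bounds: "0 \<le> bump s" "bump s \<le> 1" "1 / 2 \<le> s \<Longrightarrow> bump s = 0"
  by (auto simp: bump_def flat_def)

lemma bump_antimono: "s \<le> t \<Longrightarrow> bump t \<le> bump s"
  by (auto simp: bump_def flat_def frac_le)

lemma smooth_kernel_bump: "smooth_kernel bump"
  unfolding smooth_kernel_def radial_kernel_def
proof (intro conjI allI impI)
  show "antimono_on {0..} bump"
    by (auto intro!: monotone_onI bump_antimono)
  have "{s \<in> {0..}. bump s \<noteq> 0} \<subseteq> {0..1 / 2}"
  proof
    fix s assume s: "s \<in> {s \<in> {0..}. bump s \<noteq> 0}"
    then have "\<not> 1 / 2 \<le> s" using bump_bounds(3)[of s] by blast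
    then show "s \<in> {0..1 / 2}" using s by simp
  qed
  then show "compact (closure {s \<in> {0..}. bump s \<noteq> 0})"
    by (meson bounded_closed_interval bounded_subset compact_closure)
  show "smooth_halfline bump"
    unfolding smooth_halfline_def
  proof (intro exI[of _ "\<lambda>k s. (- 1) ^ k * flat (bump_poly k) (1 / 2 - s)"] conjI allI impI)
    show "(\<lambda>s. (- 1) ^ 0 * flat (bump_poly 0) (1 / 2 - s)) = bump"
      by (simp add: bump_def fun_eq_iff)
    fix k and s :: real
    \<comment> \<open>The inner derivative -1 is the source of the sign (-1)^k.\<close>
    have "((\<lambda>s. flat (bump_poly k) (1 / 2 - s)) has_real_derivative flat (bump_poly (Suc k)) (1 / 2 - s) * (- 1)) (at s)"
      by (rule DERIV_chain2[OF flat_has_derivative[of "bump_poly k", folded bump_poly.simps]]) (auto intro!: derivative_eq_intros)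
    from DERIV_cmult[OF this, of "(- 1) ^ k"]
    have "((\<lambda>s. (- 1) ^ k * flat (bump_poly k) (1 / 2 - s)) has_real_derivative
        (- 1) ^ Suc k * flat (bump_poly (Suc k)) (1 / 2 - s)) (at s)"
      by (simp del: bump_poly.simps add: mult_ac)
    then show "((\<lambda>s. (- 1) ^ k * flat (bump_poly k) (1 / 2 - s)) has_real_derivative
        (- 1) ^ Suc k * flat (bump_poly (Suc k)) (1 / 2 - s)) (at s within {0..})"
      by (rule has_field_derivative_at_within)
  qed
  show "0 < bump 0" by (simp add: bump_def flat_def)
qed (use bump_bounds in auto)

section \<open>Estimates uniform in the sample size\<close>

lemma set_integral_nonneg_lborel: "(\<And>y. 0 \<le> g y) \<Longrightarrow> 0 \<le> (LINT y:\<Omega>|lborel. g y)"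
    for g :: "'a::euclidean_space \<Rightarrow> real"
  unfolding set_lebesgue_integral_def by (intro integral_nonneg_AE) auto

text \<open>Below the threshold there are finitely many n, and their separate constants are simply
  added; the nonnegative right side \<open>B\<close> allows any constant to be enlarged.\<close>

lemma uniform_constant:
  fixes A B :: "nat \<Rightarrow> 'u \<Rightarrow> 'h \<Rightarrow> real"
  assumes B: "\<And>n u h. 1 \<le> n \<Longrightarrow> 0 \<le> B n u h"
    and each: "\<And>n. 1 \<le> n \<Longrightarrow> \<exists>C. \<forall>u h. S n u h \<longrightarrow> A n u h \<le> C * B n u h"
    and large: "\<And>n u h. 1 \<le> n \<Longrightarrow> N \<le> n \<Longrightarrow> S n u h \<Longrightarrow> A n u h \<le> C\<^sub>0 * B n u h"
  shows "\<exists>C>0. \<forall>n\<ge>1. \<forall>u h. S n u h \<longrightarrow> A n u h \<le> C * B n u h"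
proof -
  from each obtain c where c: "\<And>n u h. 1 \<le> n \<Longrightarrow> S n u h \<Longrightarrow> A n u h \<le> c n * B n u h" by metis
  \<comment> \<open>Absolute values, since the given constants carry no sign; the summand 1 makes
    the result positive.\<close>
  define C where "C = \<bar>C\<^sub>0\<bar> + (\<Sum>n\<le>N. \<bar>c n\<bar>) + 1"
  have s: "0 \<le> (\<Sum>n\<le>N. \<bar>c n\<bar>)" by (intro sum_nonneg) simp
  have "A n u h \<le> C * B n u h" if n: "1 \<le> n" and S: "S n u h" for n u h
  proof (cases "N \<le> n")
    case True
    have "C\<^sub>0 \<le> C" using s abs_ge_self[of "C\<^sub>0"] unfolding C_def by linarith
    then have "C\<^sub>0 * B n u h \<le> C * B n u h" by (intro mult_right_mono B n)
    with large[OF n True S] show ?thesis by linarith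
  next
    case False
    then have "\<bar>c n\<bar> \<le> (\<Sum>n\<le>N. \<bar>c n\<bar>)" by (intro member_le_sum) auto
    then have "c n \<le> C" by (simp add: C_def)
    then have "c n * B n u h \<le> C * B n u h" by (intro mult_right_mono B n)
    with c[OF n S] show ?thesis by linarith
  qed
  moreover have "0 < C" using s unfolding C_def by linarith
  ultimately show ?thesis by blast
qed

section \<open>Bounds for a single sample size\<close>

context kernel_cloud
begin

lemma value_le_mean:
  assumes "i \<in> {1..n}"
  shows "\<bar>f (x i)\<bar> \<le> real n * b * (LINT y:\<Omega>|lborel. \<bar>f (T y)\<bar>)"
proof -
  have "\<bar>f (x i)\<bar> \<le> real n * avg n (\<lambda>j. \<bar>f (x j)\<bar>)" using assms
      by (intro le_avg[of n "\<lambda>j. \<bar>f (x j)\<bar>"]) auto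
  also have "\<dots> \<le> real n * (b * (LINT y:\<Omega>|lborel. \<bar>f (T y)\<bar>))"
    by (intro mult_left_mono LINT_cloud_bounds(2)[of "\<lambda>z. \<bar>f z\<bar>"]) auto
  finally show ?thesis by (simp add: mult.assoc)
qed

text \<open>For small \<open>n\<close> the graph may be disconnected, but then constants depending on \<open>n\<close> suffice, as
  every sample point carries mass at least \<open>1 / n\<close>.\<close>

lemma crude_bound:
  assumes q: "1 \<le> q"
  shows "(LINT y:\<Omega>|lborel. \<bar>f (T y)\<bar> powr q) + nonlocal_energy bump \<epsilon> q \<Omega> (\<lambda>y. f (T y))
     \<le> ((real n * b) powr q / a + (2 * real n * b / \<epsilon>) powr q / (\<epsilon> ^ DIM('a) * a\<^sup>2)) * (LINT y:\<Omega>|lborel. \<bar>f (T y)\<bar>) powr q"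
proof -
  define L where "L = (LINT y:\<Omega>|lborel. \<bar>f (T y)\<bar>)"
  define M where "M = real n * b * L"
  have L: "0 \<le> L" unfolding L_def by (intro set_integral_nonneg_lborel) simp
  have M: "\<bar>f (x i)\<bar> \<le> M" if "i \<in> {1..n}" for i unfolding M_def L_def
      by (rule value_le_mean[OF that])
  have M0: "0 \<le> M" using M[of 1] n by (auto intro: order_trans[OF abs_ge_zero])
  have "(LINT y:\<Omega>|lborel. \<bar>f (T y)\<bar> powr q) \<le> avg n (\<lambda>i. \<bar>f (x i)\<bar> powr q) / a"
    by (intro LINT_cloud_bounds(1)[of "\<lambda>z. \<bar>f z\<bar> powr q"]) simp
  also have "\<dots> \<le> avg n (\<lambda>_. M powr q) / a"
    using M q a by (intro divide_right_mono avg_mono powr_mono2) auto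
  also have "\<dots> = (real n * b) powr q / a * L powr q"
    using n b_pos L by (simp add: avg_const M_def powr_mult)
  finally have 1: "(LINT y:\<Omega>|lborel. \<bar>f (T y)\<bar> powr q) \<le> (real n * b) powr q / a * L powr q" .
  \<comment> \<open>As \<open>bump\<close> is at most 1, its rescaled version is replaced by the
    constant 1 / \<epsilon>^d for all pairs of points.\<close>
  define F where "F z z' = 1 / \<epsilon> ^ DIM('a) * \<bar>(f z' - f z) / \<epsilon>\<bar> powr q" for z z'
  define R where "R = 1 / \<epsilon> ^ DIM('a) * (2 * M / \<epsilon>) powr q"
  have F0: "0 \<le> F z z'" for z z' unfolding F_def using \<epsilon> by simp
  have R0: "0 \<le> R" unfolding R_def using \<epsilon> by simp
  have FR: "F (x i) (x j) \<le> R" if "i \<in> {1..n}" "j \<in> {1..n}" for i j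
  proof -
    have "\<bar>f (x j) - f (x i)\<bar> \<le> 2 * M" using M[OF that(1)] M[OF that(2)] by linarith
    then have "\<bar>(f (x j) - f (x i)) / \<epsilon>\<bar> \<le> 2 * M / \<epsilon>" using \<epsilon> by (simp add: divide_right_mono)
    then show ?thesis unfolding F_def R_def using q \<epsilon> by (intro mult_left_mono powr_mono2) auto
  qed
  have "nonlocal_energy bump \<epsilon> q \<Omega> (\<lambda>y. f (T y)) \<le> R / a\<^sup>2"
    unfolding nonlocal_energy_def
  proof (rule set_integral_pair_le)
    have "(\<integral>\<^sup>+y. (\<integral>\<^sup>+z. indicator \<Omega> y * indicator \<Omega> z *
          ennreal (scaled_kernel DIM('a) bump \<epsilon> (norm (y - z)) * \<bar>(f (T z) - f (T y)) / \<epsilon>\<bar> powr q) \<partial>lborel) \<partial>lborel)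
       \<le> (\<integral>\<^sup>+y. (\<integral>\<^sup>+z. indicator \<Omega> y * indicator \<Omega> z * ennreal (F (T y) (T z)) \<partial>lborel) \<partial>lborel)"
      unfolding F_def scaled_kernel_def using \<epsilon> bump_bounds
      by (intro nn_integral_mono mult_left_mono ennreal_leI mult_right_mono divide_right_mono) auto
    also have "\<dots> \<le> ennreal (avg n (\<lambda>i. avg n (\<lambda>j. F (x i) (x j))) / a\<^sup>2)"
      by (intro nn_integral_cloud_pair F0)
    also have "\<dots> \<le> ennreal (avg n (\<lambda>i. avg n (\<lambda>j. R)) / a\<^sup>2)"
      using FR by (intro ennreal_leI divide_right_mono avg_mono) auto
    also have "\<dots> = ennreal (R / a\<^sup>2)" using n by (simp add: avg_const)
    finally show "(\<integral>\<^sup>+y. (\<integral>\<^sup>+z. indicator \<Omega> y * indicator \<Omega> z *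
          ennreal (scaled_kernel DIM('a) bump \<epsilon> (norm (y - z)) * \<bar>(f (T z) - f (T y)) / \<epsilon>\<bar> powr q) \<partial>lborel) \<partial>lborel)
       \<le> ennreal (R / a\<^sup>2)" .
  qed (use \<epsilon> R0 bump_bounds in \<open>auto simp: scaled_kernel_def\<close>)
  also have "R / a\<^sup>2 = (2 * real n * b / \<epsilon>) powr q / (\<epsilon> ^ DIM('a) * a\<^sup>2) * L powr q"
  proof -
    have "2 * M / \<epsilon> = (2 * real n * b / \<epsilon>) * L" by (simp add: M_def)
    then have "(2 * M / \<epsilon>) powr q = (2 * real n * b / \<epsilon>) powr q * L powr q"
      using L b_pos \<epsilon> by (simp only: powr_mult)
    then show ?thesis by (simp add: R_def)
  qed
  finally show ?thesis using 1 by (simp add: L_def distrib_right)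
qed

end

text \<open>The sum of the two coefficients in \<open>poincare\<close>, so that one constant serves
  both terms; the summand 1 makes it at least 1, as the iteration requires.\<close>

definition poincare_constant :: "real \<Rightarrow> real \<Rightarrow> nat \<Rightarrow> real \<Rightarrow> real \<Rightarrow> real" where
  "poincare_constant a b d q C = b * C * (2 powr q * 2 ^ d / a\<^sup>2) + b * C * (1 / a) powr q + 1"

section \<open>Bounds for large sample sizes\<close>

context close_cloud
begin

lemma graph_poincare:
  assumes C: "0 < C" and q: "1 \<le> q" and r: "\<epsilon> / 2 \<le> r" "r \<le> 1" and key: "scaled_poincare \<Omega> \<Omega> q C"
  shows "avg n (\<lambda>i. \<bar>f (x i)\<bar> powr q)
     \<le> poincare_constant a b DIM('a) q C * r powr q * graph.energy q (\<lambda>i. f (x i))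
       + poincare_constant a b DIM('a) q C * (avg n (\<lambda>i. \<bar>f (x i)\<bar>) / r ^ DIM('a)) powr q"
proof -
  have "avg n (\<lambda>i. \<bar>f (x i)\<bar> powr q)
     \<le> b * C * (2 powr q * 2 ^ DIM('a) / a\<^sup>2) * r powr q * graph.energy q (\<lambda>i. f (x i))
       + b * C * (1 / a) powr q * (avg n (\<lambda>i. \<bar>f (x i)\<bar>) / r ^ DIM('a)) powr q"
    by (intro poincare C q r key)
  also have "\<dots> \<le> poincare_constant a b DIM('a) q C * r powr q * graph.energy q (\<lambda>i. f (x i))
       + poincare_constant a b DIM('a) q C * (avg n (\<lambda>i. \<bar>f (x i)\<bar>) / r ^ DIM('a)) powr q"
    using b_pos C graph.energy_nonneg
    by (intro add_mono mult_right_mono) (auto simp: poincare_constant_def)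
  finally show ?thesis .
qed

lemma poincare_constant_ge_1: "0 < C \<Longrightarrow> 1 \<le> poincare_constant a b d q C"
  using b_pos by (simp add: poincare_constant_def)

lemma nonlocal_energy_bump_le:
  "nonlocal_energy bump \<epsilon> q \<Omega> (\<lambda>y. f (T y)) \<le> graph.energy q (\<lambda>i. f (x i)) / a\<^sup>2"
  by (intro nonlocal_energy_le) (auto simp: bump_bounds)

text \<open>The graph estimate at r = 1, where \<epsilon> \<le> 1 makes that scale admissible,
  transferred to \<Omega>. The left side costs 1 / a and 1 / a^2, the squared mean b^2 and the data
  b.\<close>

lemma cloud_estimate_ge2:
  assumes C: "0 < C" "scaled_poincare \<Omega> \<Omega> 2 C" and \<epsilon>1: "\<epsilon> \<le> 1" and q: "2 \<le> q"
    and eq: "solves_graph_poisson \<eta> \<epsilon> x n u h"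
  shows "(LINT y:\<Omega>|lborel. \<bar>u (T y)\<bar> powr q)
      + nonlocal_energy bump \<epsilon> 2 \<Omega> (\<lambda>y. \<bar>u (T y)\<bar> powr ((q - 2) / 2) * u (T y))
     \<le> (1 / a + 1 / a\<^sup>2) * bound_ge2 q (poincare_constant a b DIM('a) 2 C) * (b\<^sup>2 + b) *
        ((LINT y:\<Omega>|lborel. \<bar>u (T y)\<bar> powr (q / 2))\<^sup>2 + (LINT y:\<Omega>|lborel. \<bar>h (T y)\<bar> powr q))"
proof -
  define P where "P = poincare_constant a b DIM('a) 2 C"
  define L where "L = (LINT y:\<Omega>|lborel. \<bar>u (T y)\<bar> powr (q / 2))"
  define H where "H = (LINT y:\<Omega>|lborel. \<bar>h (T y)\<bar> powr q)"
  define U where "U = avg n (\<lambda>i. \<bar>u (x i)\<bar> powr q)"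
  define E where "E = graph.energy 2 (\<lambda>i. signed_powr ((q - 2) / 2) (u (x i)))"
  have P: "0 < P" using poincare_constant_ge_1[of C] C
      by (auto simp: P_def intro: less_le_trans[of 0 1])
  have H0: "0 \<le> H" unfolding H_def by (intro set_integral_nonneg_lborel) simp
  have L0: "0 \<le> L" unfolding L_def by (intro set_integral_nonneg_lborel) simp
  have E0: "0 \<le> E" unfolding E_def by (rule graph.energy_nonneg)
  have U0: "0 \<le> U" unfolding U_def by (intro avg_nonneg) simp
  have B0: "0 \<le> bound_ge2 q P" using bound_ge2_pos[OF q P] by simp
  have poin: "avg n (\<lambda>i. \<bar>\<phi> (u (x i))\<bar> powr 2)
      \<le> P * graph.energy 2 (\<lambda>i. \<phi> (u (x i))) + P * avg n (\<lambda>i. \<bar>\<phi> (u (x i))\<bar>) powr 2" for \<phi>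
    using graph_poincare[OF C(1) _ _ _ C(2), of 1 "\<lambda>z. \<phi> (u z)"] \<epsilon>1 by (simp add: P_def)
  have lap: "avg n (\<lambda>i. \<bar>graph.lap (\<lambda>i. u (x i)) i\<bar> powr q) = avg n (\<lambda>i. \<bar>h (x i)\<bar> powr q)"
    using eq unfolding solves_iff by (intro avg_cong) simp
  have "(LINT y:\<Omega>|lborel. \<bar>u (T y)\<bar> powr q) \<le> U / a"
    unfolding U_def by (intro LINT_cloud_bounds(1)[of "\<lambda>z. \<bar>u z\<bar> powr q"]) simp
  moreover have "nonlocal_energy bump \<epsilon> 2 \<Omega> (\<lambda>y. \<bar>u (T y)\<bar> powr ((q - 2) / 2) * u (T y)) \<le> E / a\<^sup>2"
    using nonlocal_energy_bump_le[of 2 "\<lambda>z. signed_powr ((q - 2) / 2) (u z)"]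
    by (simp add: E_def signed_powr_def)
  moreover have "U / a + E / a\<^sup>2 \<le> (1 / a + 1 / a\<^sup>2) * (U + E)"
    using U0 E0 a by (simp add: algebra_simps add_divide_distrib)
  moreover have "(1 / a + 1 / a\<^sup>2) * (U + E)
      \<le> (1 / a + 1 / a\<^sup>2) * (bound_ge2 q P * (b\<^sup>2 + b) * (L\<^sup>2 + H))"
  proof (intro mult_left_mono)
    have "U + E \<le> bound_ge2 q P * ((avg n (\<lambda>i. \<bar>u (x i)\<bar> powr (q / 2)))\<^sup>2
        + avg n (\<lambda>i. \<bar>h (x i)\<bar> powr q))"
      unfolding U_def E_def lap[symmetric] by (intro graph.estimate_ge2 q P poin)
    also have "\<dots> \<le> bound_ge2 q P * ((b * L)\<^sup>2 + b * H)"
      unfolding L_def H_def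
      by (intro mult_left_mono add_mono power_mono LINT_cloud_bounds(2)[of "\<lambda>z. \<bar>u z\<bar> powr (q / 2)"]
          LINT_cloud_bounds(2)[of "\<lambda>z. \<bar>h z\<bar> powr q"] avg_nonneg B0) auto
    also have "\<dots> \<le> bound_ge2 q P * ((b\<^sup>2 + b) * (L\<^sup>2 + H))"
      using b_pos H0 B0 by (intro mult_left_mono) (auto simp: algebra_simps power_mult_distrib)
    finally show "U + E \<le> bound_ge2 q P * (b\<^sup>2 + b) * (L\<^sup>2 + H)" by (simp add: mult.assoc)
  qed (use a in auto)
  ultimately show ?thesis unfolding P_def[symmetric] L_def[symmetric] H_def[symmetric]
      by (simp add: mult.assoc)
qed

lemma cloud_estimate_lt2:
  assumes C: "0 < C" "scaled_poincare \<Omega> \<Omega> q C" and \<epsilon>1: "\<epsilon> \<le> 1" and q: "1 < q" "q < 2"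
    and eq: "solves_graph_poisson \<eta> \<epsilon> x n u h"
  shows "(LINT y:\<Omega>|lborel. \<bar>u (T y)\<bar> powr q) + nonlocal_energy bump \<epsilon> q \<Omega> (\<lambda>y. u (T y))
     \<le> (1 / a + 1 / a\<^sup>2) * bound_lt2 q (poincare_constant a b DIM('a) q C)
          (b * \<eta> 0 * unit_ball_vol (real DIM('a)) * 3 ^ DIM('a)) * (b powr q + b) *
        ((LINT y:\<Omega>|lborel. \<bar>u (T y)\<bar>) powr q + (LINT y:\<Omega>|lborel. \<bar>h (T y)\<bar> powr q))"
proof -
  define P where "P = poincare_constant a b DIM('a) q C"
  define D where "D = b * \<eta> 0 * unit_ball_vol (real DIM('a)) * 3 ^ DIM('a)"
  define L where "L = (LINT y:\<Omega>|lborel. \<bar>u (T y)\<bar>)"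
  define H where "H = (LINT y:\<Omega>|lborel. \<bar>h (T y)\<bar> powr q)"
  define U where "U = avg n (\<lambda>i. \<bar>u (x i)\<bar> powr q)"
  define E where "E = graph.energy q (\<lambda>i. u (x i))"
  have P: "0 < P" using poincare_constant_ge_1[of C] C
      by (auto simp: P_def intro: less_le_trans[of 0 1])
  have D: "0 < D" using b_pos \<eta>0 by (simp add: D_def unit_ball_vol_pos)
  have H0: "0 \<le> H" unfolding H_def by (intro set_integral_nonneg_lborel) simp
  have L0: "0 \<le> L" unfolding L_def by (intro set_integral_nonneg_lborel) simp
  have E0: "0 \<le> E" unfolding E_def by (rule graph.energy_nonneg)
  have U0: "0 \<le> U" unfolding U_def by (intro avg_nonneg) simp
  have B0: "0 \<le> bound_lt2 q P D" using bound_lt2_pos[OF q(1) P] by (simp add: less_imp_le)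
  have poin: "avg n (\<lambda>i. \<bar>u (x i)\<bar> powr q)
      \<le> P * graph.energy q (\<lambda>i. u (x i)) + P * avg n (\<lambda>i. \<bar>u (x i)\<bar>) powr q"
    using graph_poincare[OF C(1) _ _ _ C(2), of 1 u] \<epsilon>1 q by (simp add: P_def)
  have lap: "avg n (\<lambda>i. \<bar>graph.lap (\<lambda>i. u (x i)) i\<bar> powr q) = avg n (\<lambda>i. \<bar>h (x i)\<bar> powr q)"
    using eq unfolding solves_iff by (intro avg_cong) simp
  have "(LINT y:\<Omega>|lborel. \<bar>u (T y)\<bar> powr q) \<le> U / a"
    unfolding U_def by (intro LINT_cloud_bounds(1)[of "\<lambda>z. \<bar>u z\<bar> powr q"]) simp
  moreover have "nonlocal_energy bump \<epsilon> q \<Omega> (\<lambda>y. u (T y)) \<le> E / a\<^sup>2"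
    unfolding E_def by (rule nonlocal_energy_bump_le)
  moreover have "U / a + E / a\<^sup>2 \<le> (1 / a + 1 / a\<^sup>2) * (U + E)"
    using U0 E0 a by (simp add: algebra_simps add_divide_distrib)
  moreover have "(1 / a + 1 / a\<^sup>2) * (U + E)
      \<le> (1 / a + 1 / a\<^sup>2) * (bound_lt2 q P D * (b powr q + b) * (L powr q + H))"
  proof (intro mult_left_mono)
    have "U + E \<le> bound_lt2 q P D * (avg n (\<lambda>i. \<bar>u (x i)\<bar>) powr q + avg n (\<lambda>i. \<bar>h (x i)\<bar> powr q))"
      unfolding U_def E_def lap[symmetric]
          by (intro graph.estimate_lt2 q P D poin) (simp add: D_def degree_upper)
    also have "\<dots> \<le> bound_lt2 q P D * ((b * L) powr q + b * H)"
      unfolding L_def H_def using q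
      by (intro mult_left_mono add_mono powr_mono2 LINT_cloud_bounds(2)[of "\<lambda>z. \<bar>u z\<bar>"]
          LINT_cloud_bounds(2)[of "\<lambda>z. \<bar>h z\<bar> powr q"] avg_nonneg B0) auto
    also have "\<dots> \<le> bound_lt2 q P D * ((b powr q + b) * (L powr q + H))"
      using b_pos H0 L0 B0 by (intro mult_left_mono) (auto simp: algebra_simps powr_mult)
    finally show "U + E \<le> bound_lt2 q P D * (b powr q + b) * (L powr q + H)"
        by (simp add: mult.assoc)
  qed (use a in auto)
  ultimately show ?thesis unfolding P_def[symmetric] D_def[symmetric] L_def[symmetric] H_def[symmetric] by (simp add: mult.assoc)
qed

lemma cloud_sup_bound:
  assumes C: "0 < C" "scaled_poincare \<Omega> \<Omega> 2 C" and P: "P = poincare_constant a b DIM('a) 2 C"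
    and c\<^sub>0: "0 < c\<^sub>0" "\<And>y s. y \<in> \<Omega> \<Longrightarrow> 0 < s \<Longrightarrow> s \<le> 1 \<Longrightarrow>
        ennreal (c\<^sub>0 * s ^ DIM('a)) \<le> emeasure lborel (\<Omega> \<inter> cball y s)"
    and c: "c = a * c\<^sub>0 / 2 ^ DIM('a)"
    and S: "S = 4 * (max 1 (\<eta> 0 / c) * (2 * P) ^ DIM('a) * 2 ^ DIM('a))
        * (2 * P * (4 * P) ^ DIM('a) * (2 ^ DIM('a))\<^sup>2)"
    and \<epsilon>1: "\<epsilon> \<le> 1" "P * \<epsilon>\<^sup>2 \<le> 1" "2 * \<epsilon>\<^sup>2 \<le> c"
    and eq: "solves_graph_poisson \<eta> \<epsilon> x n u h" and i: "i \<in> {1..n}"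
  shows "\<bar>u (x i)\<bar> \<le> S * (b + 1) * ((LINT y:\<Omega>|lborel. \<bar>u (T y)\<bar>) + Max ((\<lambda>i. \<bar>h (x i)\<bar>) ` {1..n}))"
proof -
  define L where "L = (LINT y:\<Omega>|lborel. \<bar>u (T y)\<bar>)"
  define H where "H = Max ((\<lambda>i. \<bar>h (x i)\<bar>) ` {1..n})"
  have hH: "\<bar>h (x j)\<bar> \<le> H" if "j \<in> {1..n}" for j unfolding H_def using that by (intro Max_ge) auto
  have H0: "0 \<le> H" using hH[OF i] by (rule order_trans[OF abs_ge_zero])
  have L0: "0 \<le> L" unfolding L_def by (intro set_integral_nonneg_lborel) simp
  have P1: "1 \<le> P" unfolding P by (rule poincare_constant_ge_1[OF C(1)])
  have cp: "0 < c" using a c\<^sub>0 by (simp add: c)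
  have S0: "0 \<le> S" unfolding S using P1 by (intro mult_nonneg_nonneg) auto
  have "\<bar>u (x i)\<bar> \<le> S * (avg n (\<lambda>i. \<bar>u (x i)\<bar>) + H)"
    unfolding S
  proof (rule graph.sup_bound[OF P1 \<epsilon>1 _ cp _ _ H0 _ i])
    show "avg n (\<lambda>i. \<bar>\<phi> (u (x i))\<bar> powr 2) \<le> P * r\<^sup>2 * graph.energy 2 (\<lambda>i. \<phi> (u (x i)))
        + P * (avg n (\<lambda>i. \<bar>\<phi> (u (x i))\<bar>) / r ^ DIM('a))\<^sup>2" if r: "\<epsilon> / 2 \<le> r" "r \<le> 1" for \<phi> r
    proof -
      have r0: "0 < r" using r \<epsilon> by linarith
      have "0 \<le> avg n (\<lambda>i. \<bar>\<phi> (u (x i))\<bar>) / r ^ DIM('a)" using r0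
          by (intro divide_nonneg_nonneg avg_nonneg) auto
      then show ?thesis
        using graph_poincare[OF C(1) _ r C(2), of "\<lambda>z. \<phi> (u z)"] r0 by (simp add: P powr_numeral)
    qed
    show "c \<le> avg n (\<lambda>j. kern (x j') (x j))" if "j' \<in> {1..n}" for j'
      unfolding c using c\<^sub>0 \<epsilon>1 that by (intro degree_lower) auto
    show "kern (x i) (x j) \<le> \<eta> 0 / \<epsilon> ^ DIM('a)" for i j by (rule kern_le)
    show "\<bar>graph.lap (\<lambda>i. u (x i)) j\<bar> \<le> H" if "j \<in> {1..n}" for j
      using eq hH[OF that] that unfolding solves_iff by simp
  qed
  also have "\<dots> \<le> S * (b * L + H)"
    unfolding L_def by (intro mult_left_mono add_right_mono LINT_cloud_bounds(2)[of "\<lambda>z. \<bar>u z\<bar>"] S0) auto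
  also have "\<dots> \<le> S * ((b + 1) * (L + H))"
    using b_pos H0 L0 S0 by (intro mult_left_mono) (auto simp: algebra_simps)
  finally show ?thesis by (simp add: L_def H_def mult.assoc)
qed

end

section \<open>Nearness of the transport maps for large sample sizes\<close>

lemma transport_scale_pos: "2 \<le> n \<Longrightarrow> 0 < transport_scale d n"
  by (simp add: transport_scale_def)

text \<open>Divergence of \<epsilon> / sqrt \<delta> gives \<delta> \<le> \<epsilon>^2 eventually,
  and \<epsilon> tending to 0 then makes K \<epsilon> smaller than 1/8.\<close>

lemma scale_le_eventually:
  assumes "admissible_scales d \<epsilon>" "0 < K"
  shows "\<forall>\<^sub>F n in sequentially. K * transport_scale d n \<le> \<epsilon> n / 8"
proof -
  have \<epsilon>: "\<forall>n\<ge>1. 0 < \<epsilon> n" "\<epsilon> \<longlonglongrightarrow> 0" "filterlim (\<lambda>n. \<epsilon> n / sqrt (transport_scale d n)) at_top sequentially"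
    using assms by (auto simp: admissible_scales_def)
  have "\<forall>\<^sub>F n in sequentially. 1 \<le> \<epsilon> n / sqrt (transport_scale d n)"
    using \<epsilon>(3) by (simp add: filterlim_at_top)
  moreover have "\<forall>\<^sub>F n in sequentially. \<epsilon> n < 1 / (8 * K)"
    using order_tendstoD(2)[OF \<epsilon>(2), of "1 / (8 * K)"] assms by simp
  moreover have "\<forall>\<^sub>F n in sequentially. 2 \<le> n" by (rule eventually_ge_at_top)
  ultimately show ?thesis
  proof eventually_elim
    case (elim n)
    define s where "s = transport_scale d n"
    have s: "0 < s" using elim(3) by (simp add: s_def transport_scale_pos)
    have e: "0 < \<epsilon> n" using \<epsilon>(1) elim(3) by simp
    have "sqrt s \<le> \<epsilon> n" using elim(1) s by (simp add: s_def[symmetric] pos_le_divide_eq)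
    then have "sqrt s * sqrt s \<le> \<epsilon> n * \<epsilon> n" using s e by (intro mult_mono) auto
    then have "s \<le> \<epsilon> n * \<epsilon> n" using s by simp
    then have "K * s \<le> K * (\<epsilon> n * \<epsilon> n)" using assms by (intro mult_left_mono) auto
    also have "\<dots> = (K * \<epsilon> n) * \<epsilon> n" by simp
    also have "\<dots> \<le> 1 / 8 * \<epsilon> n"
      using elim(2) assms e by (intro mult_right_mono) (auto simp: field_simps)
    finally show ?case by (simp add: s_def)
  qed
qed

lemma transport_maps_close:
  fixes \<Omega> :: "'a::euclidean_space set"
  assumes "transport_maps \<Omega> \<rho> x T" "admissible_scales DIM('a) \<epsilon>" and [measurable]: "\<Omega> \<in> sets borel"
  shows "\<forall>\<^sub>F n in sequentially. AE y in lborel. y \<in> \<Omega> \<longrightarrow> norm (y - T n y) \<le> \<epsilon> n / 8"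
proof -
  define \<delta> where "\<delta> n = transport_scale DIM('a) n" for n
  define L where "L n = Linf_norm \<Omega> (\<lambda>y. y - T n y)" for n
  obtain C\<^sub>0 where C\<^sub>0: "0 < C\<^sub>0" "limsup (\<lambda>n. L n / ereal (\<delta> n)) \<le> ereal C\<^sub>0"
    using assms(1) unfolding transport_maps_def L_def \<delta>_def by blast
  \<comment> \<open>The margin 1 turns a bound on the upper limit into an inequality that holds
    eventually.\<close>
  have "limsup (\<lambda>n. L n / ereal (\<delta> n)) < ereal (C\<^sub>0 + 1)"
    using C\<^sub>0(2) by (rule le_less_trans) simp
  then have "\<forall>\<^sub>F n in sequentially. L n / ereal (\<delta> n) < ereal (C\<^sub>0 + 1)"
    by (rule Limsup_lessD)
  moreover have "\<forall>\<^sub>F n in sequentially. (C\<^sub>0 + 1) * \<delta> n \<le> \<epsilon> n / 8"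
    unfolding \<delta>_def using C\<^sub>0 by (intro scale_le_eventually assms(2)) simp
  moreover have "\<forall>\<^sub>F n in sequentially. 2 \<le> n" by (rule eventually_ge_at_top)
  ultimately show ?thesis
  proof eventually_elim
    case (elim n)
    have \<delta>: "0 < \<delta> n" using elim(3) by (simp add: \<delta>_def transport_scale_pos)
    have "L n \<le> ereal ((C\<^sub>0 + 1) * \<delta> n)"
      using elim(1) \<delta> by (cases "L n") (auto simp: field_simps)
    also have "\<dots> \<le> ereal (\<epsilon> n / 8)" using elim(2) by simp
    finally have L: "L n \<le> ereal (\<epsilon> n / 8)" .
    have "AE y in restrict_space lborel \<Omega>. ereal (norm (y - T n y)) \<le> L n"
      unfolding L_def Linf_norm_def by (rule esssup_AE)
    then have "AE y in lborel. y \<in> \<Omega> \<longrightarrow> ereal (norm (y - T n y)) \<le> L n"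
      by (subst (asm) AE_restrict_space_iff) auto
    then show ?case
    proof eventually_elim
      case (elim y)
      then show ?case using L by (auto dest: order_trans)
    qed
  qed
qed

section \<open>Application to the sequence of transport maps\<close>

lemma kernel_cloud_transport:
  fixes \<Omega> :: "'a::euclidean_space set"
  assumes \<Omega>: "open \<Omega>" "bounded \<Omega>" and \<eta>: "graph_kernel \<eta>" and \<epsilon>: "admissible_scales DIM('a) \<epsilon>"
    and \<rho>: "admissible_density \<Omega> \<rho>" and ab: "0 < a" "\<And>y. y \<in> \<Omega> \<Longrightarrow> a \<le> \<rho> y" "\<And>y. y \<in> \<Omega> \<Longrightarrow> \<rho> y \<le> b"
    and T: "transport_maps \<Omega> \<rho> x T" and n: "1 \<le> n"
  shows "kernel_cloud \<Omega> \<rho> a b x n (T n) \<eta> (\<epsilon> n)"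
proof
  have Tn: "T n \<in> measurable (density_measure \<Omega> \<rho>) borel" "T n ` \<Omega> \<subseteq> point_cloud x n"
    "distr (density_measure \<Omega> \<rho>) borel (T n) = empirical_measure x n"
    using T n unfolding transport_maps_def by simp_all
  show "\<Omega> \<in> sets borel" using \<Omega> by simp
  have "continuous_on \<Omega> \<rho>"
    by (rule continuous_on_subset[OF _ closure_subset]) (use \<rho> in \<open>simp add: admissible_density_def C1_closure_def\<close>)
  then have "\<rho> \<in> borel_measurable (restrict_space borel \<Omega>)"
    by (rule borel_measurable_continuous_on_restrict)
  also have "borel_measurable (restrict_space borel \<Omega>)
      = borel_measurable (restrict_space (lborel :: 'a measure) \<Omega>)"
    by (rule measurable_cong_sets[OF sets_restrict_space_cong[OF sets_lborel[symmetric]] refl])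
  finally show "\<rho> \<in> borel_measurable (restrict_space lborel \<Omega>)" .
  show "T n \<in> measurable (restrict_space lborel \<Omega>) borel"
    using Tn(1) by (simp add: density_measure_def)
  show "T n y \<in> point_cloud x n" if "y \<in> \<Omega>" for y using Tn(2) that by blast
  show "distr (density_measure \<Omega> \<rho>) borel (T n) = empirical_measure x n" by (fact Tn(3))
  show "0 < \<epsilon> n" using \<epsilon> n by (simp add: admissible_scales_def)
  show "0 \<le> \<eta> s" if "0 \<le> s" for s using \<eta> that by (simp add: graph_kernel_def radial_kernel_def)
  have "antimono_on {0..} \<eta>" using \<eta> by (simp add: graph_kernel_def radial_kernel_def)
  then show "\<eta> t \<le> \<eta> s" if "0 \<le> s" "s \<le> t" for s t
    using that by (simp add: monotone_on_def)
  show "1 \<le> \<eta> 1" "\<eta> 2 = 0" using \<eta> by (auto simp: graph_kernel_def)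
  show "bounded \<Omega>" "0 < a" "1 \<le> n" by fact+
  show "a \<le> \<rho> y" "\<rho> y \<le> b" if "y \<in> \<Omega>" for y by (fact ab(2)[OF that], fact ab(3)[OF that])
qed

text \<open>The thresholds depend on the fixed data only, not on u or h: beyond them
  \<open>close_cloud\<close> provides constants free of n, below them the bounds for a single n
  suffice.\<close>

lemma regularity_estimates:
  fixes \<Omega> :: "'a::euclidean_space set"
  assumes \<Omega>: "C_k_domain (Suc 0) \<Omega>" and \<eta>: "graph_kernel \<eta>" and \<epsilon>: "admissible_scales DIM('a) \<epsilon>"
    and \<rho>: "admissible_density \<Omega> \<rho>" and T: "transport_maps \<Omega> \<rho> x T"
  shows "1 < q \<Longrightarrow> q < 2 \<Longrightarrow> \<exists>C>0. \<forall>n\<ge>1. \<forall>u h. solves_graph_poisson \<eta> (\<epsilon> n) x n u h \<longrightarrow>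
        (LINT y:\<Omega>|lborel. \<bar>u (T n y)\<bar> powr q) + nonlocal_energy bump (\<epsilon> n) q \<Omega> (\<lambda>y. u (T n y))
          \<le> C * ((LINT y:\<Omega>|lborel. \<bar>u (T n y)\<bar>) powr q + (LINT y:\<Omega>|lborel. \<bar>h (T n y)\<bar> powr q))"
    (is "_ \<Longrightarrow> _ \<Longrightarrow> \<exists>C>0. \<forall>n\<ge>1. ?P1 n C")
    and "2 \<le> q \<Longrightarrow> \<exists>C>0. \<forall>n\<ge>1. \<forall>u h. solves_graph_poisson \<eta> (\<epsilon> n) x n u h \<longrightarrow>
        (LINT y:\<Omega>|lborel. \<bar>u (T n y)\<bar> powr q)
            + nonlocal_energy bump (\<epsilon> n) 2 \<Omega> (\<lambda>y. \<bar>u (T n y)\<bar> powr ((q - 2) / 2) * u (T n y))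
          \<le> C * ((LINT y:\<Omega>|lborel. \<bar>u (T n y)\<bar> powr (q / 2))\<^sup>2 + (LINT y:\<Omega>|lborel. \<bar>h (T n y)\<bar> powr q))"
    (is "_ \<Longrightarrow> \<exists>C>0. \<forall>n\<ge>1. ?P2 n C")
    and "\<exists>C>0. \<forall>n\<ge>1. \<forall>u h. solves_graph_poisson \<eta> (\<epsilon> n) x n u h \<longrightarrow>
        Linf_norm \<Omega> (u \<circ> T n)
          \<le> ereal C * ereal (LINT y:\<Omega>|lborel. \<bar>u (T n y)\<bar>) + ereal C * Linf_norm \<Omega> (h \<circ> T n)"
    (is "\<exists>C>0. \<forall>n\<ge>1. ?P3 n C")
proof -
  let ?L = "\<lambda>n u. LINT y:\<Omega>|lborel. \<bar>u (T n y)\<bar>"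
  let ?A1 = "\<lambda>n u. (LINT y:\<Omega>|lborel. \<bar>u (T n y)\<bar> powr q)
    + nonlocal_energy bump (\<epsilon> n) q \<Omega> (\<lambda>y. u (T n y))"
  let ?B1 = "\<lambda>n u h. ?L n u powr q + (LINT y:\<Omega>|lborel. \<bar>h (T n y)\<bar> powr q)"
  let ?A2 = "\<lambda>n u. (LINT y:\<Omega>|lborel. \<bar>u (T n y)\<bar> powr q)
    + nonlocal_energy bump (\<epsilon> n) 2 \<Omega> (\<lambda>y. \<bar>u (T n y)\<bar> powr ((q - 2) / 2) * u (T n y))"
  let ?B2 = "\<lambda>n u h. (LINT y:\<Omega>|lborel. \<bar>u (T n y)\<bar> powr (q / 2))\<^sup>2
    + (LINT y:\<Omega>|lborel. \<bar>h (T n y)\<bar> powr q)"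
  have o: "open \<Omega>" and bdd: "bounded \<Omega>" using \<Omega> by (auto simp: C_k_domain_def)
  have bor: "\<Omega> \<in> sets borel" using o by simp
  have cone: "uniform_cone \<Omega>" by (rule C_k_domain_uniform_cone[OF \<Omega>])
  obtain a b where ab: "0 < a" "\<And>y. y \<in> \<Omega> \<Longrightarrow> a \<le> \<rho> y" "\<And>y. y \<in> \<Omega> \<Longrightarrow> \<rho> y \<le> b"
    using \<rho> by (auto simp: admissible_density_def)
  have kc: "kernel_cloud \<Omega> \<rho> a b x n (T n) \<eta> (\<epsilon> n)" if "1 \<le> n" for n
    by (rule kernel_cloud_transport[OF o bdd \<eta> \<epsilon> \<rho> ab T that])
  have \<epsilon>0: "\<epsilon> \<longlonglongrightarrow> 0" using \<epsilon> by (simp add: admissible_scales_def)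
  have "\<forall>\<^sub>F n in sequentially. \<epsilon> n < 1" using order_tendstoD(2)[OF \<epsilon>0, of 1] by simp
  moreover note transport_maps_close[OF T \<epsilon> bor]
  ultimately have "\<forall>\<^sub>F n in sequentially. \<epsilon> n \<le> 1
      \<and> (AE y in lborel. y \<in> \<Omega> \<longrightarrow> norm (y - T n y) \<le> \<epsilon> n / 8)"
    by eventually_elim auto
  then obtain N where N: "\<And>n. N \<le> n \<Longrightarrow> \<epsilon> n \<le> 1"
      "\<And>n. N \<le> n \<Longrightarrow> AE y in lborel. y \<in> \<Omega> \<longrightarrow> norm (y - T n y) \<le> \<epsilon> n / 8"
    unfolding eventually_sequentially by blast
  have cc: "close_cloud \<Omega> \<rho> a b x n (T n) \<eta> (\<epsilon> n)" if "1 \<le> n" "N \<le> n" for n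
    using kc[OF that(1)] N(2)[OF that(2)] by (intro close_cloud.intro close_cloud_axioms.intro)

  show "\<exists>C>0. \<forall>n\<ge>1. ?P1 n C" if q: "1 < q" "q < 2"
  proof -
    obtain C where C: "0 < C" "scaled_poincare \<Omega> \<Omega> q C"
      using uniform_cone_poincare[OF bor bdd cone] q by (metis less_imp_le)
    show ?thesis
    proof (rule uniform_constant[where N = N])
      show "0 \<le> ?B1 n u h"
        for n and u h :: "'a \<Rightarrow> real"
        by (intro add_nonneg_nonneg set_integral_nonneg_lborel) auto
    next
      fix n :: nat assume n: "1 \<le> n"
      interpret kernel_cloud \<Omega> \<rho> a b x n "T n" \<eta> "\<epsilon> n" by (rule kc[OF n])
      define K where "K = (real n * b) powr q / a
          + (2 * real n * b / \<epsilon> n) powr q / (\<epsilon> n ^ DIM('a) * a\<^sup>2)"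
      have "?P1 n K"
      proof (intro allI impI)
        fix u h :: "'a \<Rightarrow> real"
        have "?A1 n u \<le> K * ?L n u powr q"
          unfolding K_def using q by (intro crude_bound) auto
        also have "\<dots> \<le> K * ?B1 n u h"
          using a \<epsilon> set_integral_nonneg_lborel[of "\<lambda>y. \<bar>h (T n y)\<bar> powr q" \<Omega>]
          by (intro mult_left_mono) (auto simp: K_def intro!: add_nonneg_nonneg)
        finally show "?A1 n u \<le> K * ?B1 n u h" .
      qed
      then show "\<exists>C. ?P1 n C" by blast
    next
      fix n :: nat assume nN: "1 \<le> n" "N \<le> n"
      interpret close_cloud \<Omega> \<rho> a b x n "T n" \<eta> "\<epsilon> n" by (rule cc[OF nN])
      fix u h assume "solves_graph_poisson \<eta> (\<epsilon> n) x n u h"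
      then show "?A1 n u \<le> ((1 / a + 1 / a\<^sup>2) * bound_lt2 q (poincare_constant a b DIM('a) q C)
              (b * \<eta> 0 * unit_ball_vol (real DIM('a)) * 3 ^ DIM('a)) * (b powr q + b)) *
            ?B1 n u h"
        by (rule cloud_estimate_lt2[OF C N(1)[OF nN(2)] q])
    qed
  qed

  show "\<exists>C>0. \<forall>n\<ge>1. ?P2 n C" if q: "2 \<le> q"
  proof -
    obtain C where C: "0 < C" "scaled_poincare \<Omega> \<Omega> 2 C"
      using uniform_cone_poincare[OF bor bdd cone] by (metis one_le_numeral)
    show ?thesis
    proof (rule uniform_constant[where N = N])
      show "0 \<le> ?B2 n u h"
        for n and u h :: "'a \<Rightarrow> real"
        by (intro add_nonneg_nonneg set_integral_nonneg_lborel) auto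
    next
      fix n :: nat assume n: "1 \<le> n"
      interpret kernel_cloud \<Omega> \<rho> a b x n "T n" \<eta> "\<epsilon> n" by (rule kc[OF n])
      define K where "K = (real n * b) powr 2 / a
          + (2 * real n * b / \<epsilon> n) powr 2 / (\<epsilon> n ^ DIM('a) * a\<^sup>2)"
      have "?P2 n K"
      proof (intro allI impI)
        fix u h :: "'a \<Rightarrow> real"
        \<comment> \<open>For q \<ge> 2 the crude bound is applied to this power of u with exponent
          2: |f| = |u|^(q/2) and |f|^2 = |u|^q give both sides their form.\<close>
        define f where "f z = signed_powr ((q - 2) / 2) (u z)" for z
        have e: "(q - 2) / 2 + 1 = q / 2" by (simp add: field_simps)
        have f: "\<bar>f z\<bar> = \<bar>u z\<bar> powr (q / 2)" "\<bar>f z\<bar> powr 2 = \<bar>u z\<bar> powr q" for z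
          unfolding f_def abs_signed_powr e by (simp_all add: powr_powr)
        have L: "0 \<le> (LINT y:\<Omega>|lborel. \<bar>u (T n y)\<bar> powr (q / 2))"
            by (intro set_integral_nonneg_lborel) simp
        have "(LINT y:\<Omega>|lborel. \<bar>f (T n y)\<bar> powr 2) + nonlocal_energy bump (\<epsilon> n) 2 \<Omega> (\<lambda>y. f (T n y))
          \<le> K * (LINT y:\<Omega>|lborel. \<bar>f (T n y)\<bar>) powr 2"
          unfolding K_def by (intro crude_bound) auto
        then have "?A2 n u \<le> K * (LINT y:\<Omega>|lborel. \<bar>u (T n y)\<bar> powr (q / 2)) powr 2"
          unfolding f(2) unfolding f(1) unfolding f_def signed_powr_def .
        also have "\<dots> = K * (LINT y:\<Omega>|lborel. \<bar>u (T n y)\<bar> powr (q / 2))\<^sup>2"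
          using L by (simp add: powr_numeral)
        also have "\<dots> \<le> K * ?B2 n u h"
          using a \<epsilon> set_integral_nonneg_lborel[of "\<lambda>y. \<bar>h (T n y)\<bar> powr q" \<Omega>]
          by (intro mult_left_mono) (auto simp: K_def intro!: add_nonneg_nonneg)
        finally show "?A2 n u \<le> K * ?B2 n u h" .
      qed
      then show "\<exists>C. ?P2 n C" by blast
    next
      fix n :: nat assume nN: "1 \<le> n" "N \<le> n"
      interpret close_cloud \<Omega> \<rho> a b x n "T n" \<eta> "\<epsilon> n" by (rule cc[OF nN])
      fix u h assume "solves_graph_poisson \<eta> (\<epsilon> n) x n u h"
      then show "?A2 n u \<le> ((1 / a + 1 / a\<^sup>2) * bound_ge2 q (poincare_constant a b DIM('a) 2 C)
          * (b\<^sup>2 + b)) *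
            ?B2 n u h"
        by (rule cloud_estimate_ge2[OF C N(1)[OF nN(2)] q])
    qed
  qed

  show "\<exists>C>0. \<forall>n\<ge>1. ?P3 n C"
  proof -
    obtain C where C: "0 < C" "scaled_poincare \<Omega> \<Omega> 2 C"
      using uniform_cone_poincare[OF bor bdd cone] by (metis one_le_numeral)
    define P where "P = poincare_constant a b DIM('a) 2 C"
    obtain c\<^sub>0 where c\<^sub>0: "0 < c\<^sub>0"
        "\<And>y s. y \<in> \<Omega> \<Longrightarrow> 0 < s \<Longrightarrow> s \<le> 1 \<Longrightarrow>
            ennreal (c\<^sub>0 * s ^ DIM('a)) \<le> emeasure lborel (\<Omega> \<inter> cball y s)"
      using uniform_cone_volume[OF bor cone] by blast
    define c where "c = a * c\<^sub>0 / 2 ^ DIM('a)"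
    define S where "S = 4 * (max 1 (\<eta> 0 / c) * (2 * P) ^ DIM('a) * 2 ^ DIM('a))
        * (2 * P * (4 * P) ^ DIM('a) * (2 ^ DIM('a))\<^sup>2)"
    have "(\<lambda>n. P * (\<epsilon> n)\<^sup>2) \<longlonglongrightarrow> P * 0\<^sup>2" by (intro tendsto_intros \<epsilon>0)
    from order_tendstoD(2)[OF this, of 1] have "\<forall>\<^sub>F n in sequentially. P * (\<epsilon> n)\<^sup>2 < 1" by simp
    moreover have "(\<lambda>n. 2 * (\<epsilon> n)\<^sup>2) \<longlonglongrightarrow> 2 * 0\<^sup>2" by (intro tendsto_intros \<epsilon>0)
    from order_tendstoD(2)[OF this, of c] have "\<forall>\<^sub>F n in sequentially. 2 * (\<epsilon> n)\<^sup>2 < c"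
      using ab(1) c\<^sub>0(1) by (simp add: c_def)
    ultimately have "\<forall>\<^sub>F n in sequentially. P * (\<epsilon> n)\<^sup>2 \<le> 1
        \<and> 2 * (\<epsilon> n)\<^sup>2 \<le> c" by eventually_elim auto
    then obtain N' where N': "\<And>n. N' \<le> n \<Longrightarrow> P * (\<epsilon> n)\<^sup>2 \<le> 1" "\<And>n. N' \<le> n \<Longrightarrow> 2 * (\<epsilon> n)\<^sup>2 \<le> c"
      unfolding eventually_sequentially by blast
    \<comment> \<open>The sup norms are maxima over the sample, so the estimate is proved in real
      numbers and carried to \<open>ereal\<close> at the end.\<close>
    define M where "M n f = Max ((\<lambda>i. \<bar>f (x i)\<bar>) ` {1..n})" for n and f :: "'a \<Rightarrow> real"
    have M_le: "M n f \<le> X" if "1 \<le> n" "\<And>i. i \<in> {1..n} \<Longrightarrow> \<bar>f (x i)\<bar> \<le> X" for n f X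
      unfolding M_def using that by (subst Max_le_iff) auto
    have M0: "0 \<le> M n f" if "1 \<le> n" for n f
    proof -
      have "\<bar>f (x 1)\<bar> \<le> M n f" unfolding M_def using that by (intro Max_ge) auto
      then show ?thesis by linarith
    qed
    have L0: "0 \<le> ?L n u" for n and u :: "'a \<Rightarrow> real"
      by (intro set_integral_nonneg_lborel) simp
    have "\<exists>C>0. \<forall>n\<ge>1. \<forall>u h. solves_graph_poisson \<eta> (\<epsilon> n) x n u h \<longrightarrow>
        M n u \<le> C * (?L n u + M n h)"
    proof (rule uniform_constant[where N = "max N N'"])
      show "0 \<le> ?L n u + M n h" if "1 \<le> n" for n u h
        by (intro add_nonneg_nonneg L0 M0 that)
    next
      fix n :: nat assume n: "1 \<le> n"
      interpret kernel_cloud \<Omega> \<rho> a b x n "T n" \<eta> "\<epsilon> n" by (rule kc[OF n])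
      have "M n u \<le> real n * b * (?L n u + M n h)" for u h
      proof (rule M_le[OF n])
        fix i assume i: "i \<in> {1..n}"
        have "\<bar>u (x i)\<bar> \<le> real n * b * ?L n u" by (rule value_le_mean[OF i])
        also have "\<dots> \<le> real n * b * (?L n u + M n h)"
          using M0[OF n, of h] b_pos by (intro mult_left_mono) auto
        finally show "\<bar>u (x i)\<bar> \<le> real n * b * (?L n u + M n h)" .
      qed
      then show "\<exists>C. \<forall>u h. solves_graph_poisson \<eta> (\<epsilon> n) x n u h \<longrightarrow>
          M n u \<le> C * (?L n u + M n h)" by blast
    next
      fix n :: nat assume n: "1 \<le> n" "max N N' \<le> n"
      then have nN: "N \<le> n" "N' \<le> n" by auto
      interpret close_cloud \<Omega> \<rho> a b x n "T n" \<eta> "\<epsilon> n" by (rule cc[OF n(1) nN(1)])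
      fix u h assume "solves_graph_poisson \<eta> (\<epsilon> n) x n u h"
      from cloud_sup_bound[OF C P_def c\<^sub>0 c_def S_def N(1)[OF nN(1)] N'(1)[OF nN(2)] N'(2)[OF nN(2)] this, folded M_def]
      show "M n u \<le> S * (b + 1) * (?L n u + M n h)"
        by (intro M_le n)
    qed
    then obtain C where C: "0 < C" "\<And>n u h. 1 \<le> n \<Longrightarrow> solves_graph_poisson \<eta> (\<epsilon> n) x n u h \<Longrightarrow>
        M n u \<le> C * (?L n u + M n h)" by blast
    have "?P3 n C" if n: "1 \<le> n" for n
    proof (intro allI impI)
      interpret kernel_cloud \<Omega> \<rho> a b x n "T n" \<eta> "\<epsilon> n" by (rule kc[OF n])
      fix u h assume "solves_graph_poisson \<eta> (\<epsilon> n) x n u h"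
      from C(2)[OF n this] show "Linf_norm \<Omega> (u \<circ> T n)
          \<le> ereal C * ereal (?L n u) + ereal C * Linf_norm \<Omega> (h \<circ> T n)"
        unfolding Linf_norm_cloud M_def[symmetric] by (simp add: distrib_left)
    qed
    then show ?thesis using C(1) by blast
  qed
qed

theorem corollary4p2:
  assumes "3 \<le> DIM('a::euclidean_space)"
  shows "\<exists>k. \<forall>(\<Omega> :: 'a set) \<rho> \<eta> \<epsilon> (P :: 'w measure) X \<omega> T.
    C_k_domain k \<Omega> \<longrightarrow>
    graph_kernel \<eta> \<longrightarrow>
    admissible_scales DIM('a) \<epsilon> \<longrightarrow>
    admissible_density \<Omega> \<rho> \<longrightarrow>
    iid_samples P X (density_measure \<Omega> \<rho>) \<longrightarrow>
    \<omega> \<in> space P \<longrightarrow>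
    transport_maps \<Omega> \<rho> (\<lambda>i. X i \<omega>) T \<longrightarrow>
    (\<exists>\<zeta>. smooth_kernel \<zeta> \<and>
      (\<forall>q::real. 1 < q \<and> q < 2 \<longrightarrow> (\<exists>C>0. \<forall>n\<ge>1. \<forall>u h.
        solves_graph_poisson \<eta> (\<epsilon> n) (\<lambda>i. X i \<omega>) n u h \<longrightarrow>
        (LINT x:\<Omega>|lborel. \<bar>u (T n x)\<bar> powr q) + nonlocal_energy \<zeta> (\<epsilon> n) q \<Omega> (u \<circ> T n)
          \<le> C * (LINT x:\<Omega>|lborel. \<bar>u (T n x)\<bar>) powr q
             + C * (LINT x:\<Omega>|lborel. \<bar>h (T n x)\<bar> powr q) + C)) \<and>
      (\<forall>q::real. 2 \<le> q \<longrightarrow> (\<exists>C>0. \<forall>n\<ge>1. \<forall>u h.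
        solves_graph_poisson \<eta> (\<epsilon> n) (\<lambda>i. X i \<omega>) n u h \<longrightarrow>
        (LINT x:\<Omega>|lborel. \<bar>u (T n x)\<bar> powr q)
            + nonlocal_energy \<zeta> (\<epsilon> n) 2 \<Omega> (\<lambda>x. \<bar>u (T n x)\<bar> powr ((q - 2) / 2) * u (T n x))
          \<le> C * (LINT x:\<Omega>|lborel. \<bar>u (T n x)\<bar> powr (q / 2))\<^sup>2
             + C * (LINT x:\<Omega>|lborel. \<bar>h (T n x)\<bar> powr q))) \<and>
      (\<exists>C>0. \<forall>n\<ge>1. \<forall>u h.
        solves_graph_poisson \<eta> (\<epsilon> n) (\<lambda>i. X i \<omega>) n u h \<longrightarrow>
        Linf_norm \<Omega> (u \<circ> T n)
          \<le> ereal C * ereal (LINT x:\<Omega>|lborel. \<bar>u (T n x)\<bar>)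
             + ereal C * Linf_norm \<Omega> (h \<circ> T n)))"
proof (intro exI[of _ "Suc 0"] allI impI exI[of _ bump] conjI)
  \<comment> \<open>C^1 boundaries have the uniform cone property, hence the smoothness order 1;
    \<open>bump\<close> is chosen once for all data and all q.\<close>
  fix \<Omega> :: "'a set" and \<rho> \<eta> \<epsilon> and P :: "'w measure" and X \<omega> T
  assume \<Omega>: "C_k_domain (Suc 0) \<Omega>" and \<eta>: "graph_kernel \<eta>" and \<epsilon>: "admissible_scales DIM('a) \<epsilon>"
    and \<rho>: "admissible_density \<Omega> \<rho>" and T: "transport_maps \<Omega> \<rho> (\<lambda>i. X i \<omega>) T"
  note est = regularity_estimates[OF \<Omega> \<eta> \<epsilon> \<rho> T]
  show "smooth_kernel bump" by (rule smooth_kernel_bump)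
  show "\<exists>C>0. \<forall>n\<ge>1. \<forall>u h. solves_graph_poisson \<eta> (\<epsilon> n) (\<lambda>i. X i \<omega>) n u h \<longrightarrow>
        (LINT x:\<Omega>|lborel. \<bar>u (T n x)\<bar> powr q) + nonlocal_energy bump (\<epsilon> n) q \<Omega> (u \<circ> T n)
          \<le> C * (LINT x:\<Omega>|lborel. \<bar>u (T n x)\<bar>) powr q + C * (LINT x:\<Omega>|lborel. \<bar>h (T n x)\<bar> powr q) + C"
    if "1 < q \<and> q < 2" for q
  proof -
    from that have "1 < q" "q < 2" by auto
    from est(1)[OF this] obtain C where C: "C > 0" "\<forall>n\<ge>1. \<forall>u h.
        solves_graph_poisson \<eta> (\<epsilon> n) (\<lambda>i. X i \<omega>) n u h \<longrightarrow>
        (LINT y:\<Omega>|lborel. \<bar>u (T n y)\<bar> powr q) + nonlocal_energy bump (\<epsilon> n) q \<Omega> (\<lambda>y. u (T n y))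
          \<le> C * ((LINT y:\<Omega>|lborel. \<bar>u (T n y)\<bar>) powr q + (LINT y:\<Omega>|lborel. \<bar>h (T n y)\<bar> powr q))"
      by blast
    show ?thesis
    proof (intro exI[of _ C] conjI allI impI)
      fix n :: nat and u h assume "1 \<le> n" "solves_graph_poisson \<eta> (\<epsilon> n) (\<lambda>i. X i \<omega>) n u h"
      with C show "(LINT x:\<Omega>|lborel. \<bar>u (T n x)\<bar> powr q) + nonlocal_energy bump (\<epsilon> n) q \<Omega> (u \<circ> T n)
          \<le> C * (LINT x:\<Omega>|lborel. \<bar>u (T n x)\<bar>) powr q + C * (LINT x:\<Omega>|lborel. \<bar>h (T n x)\<bar> powr q) + C"
        by (fastforce simp: comp_def distrib_left)
    qed (fact C)
  qed
  show "\<exists>C>0. \<forall>n\<ge>1. \<forall>u h. solves_graph_poisson \<eta> (\<epsilon> n) (\<lambda>i. X i \<omega>) n u h \<longrightarrow>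
        (LINT x:\<Omega>|lborel. \<bar>u (T n x)\<bar> powr q)
            + nonlocal_energy bump (\<epsilon> n) 2 \<Omega> (\<lambda>x. \<bar>u (T n x)\<bar> powr ((q - 2) / 2) * u (T n x))
          \<le> C * (LINT x:\<Omega>|lborel. \<bar>u (T n x)\<bar> powr (q / 2))\<^sup>2
             + C * (LINT x:\<Omega>|lborel. \<bar>h (T n x)\<bar> powr q)" if "2 \<le> q" for q
    using est(2)[OF that] by (simp add: distrib_left)
  show "\<exists>C>0. \<forall>n\<ge>1. \<forall>u h. solves_graph_poisson \<eta> (\<epsilon> n) (\<lambda>i. X i \<omega>) n u h \<longrightarrow>
        Linf_norm \<Omega> (u \<circ> T n)
          \<le> ereal C * ereal (LINT x:\<Omega>|lborel. \<bar>u (T n x)\<bar>) + ereal C * Linf_norm \<Omega> (h \<circ> T n)"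
    by (rule est(3))
qed

end
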